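(* Let $T$ be a complete first-order theory with monster model $\bar M$, and let $\mathfrak p$ be a global type that is generically stable and strongly regular. Then: (1) $\mathfrak p$ is minimal in the global Rudin–Keisler order $\leq_{RK}$, i.e. for every non-algebraic global type $\mathfrak q$, if $\mathfrak q\leq_{RK}\mathfrak p$ then $\mathfrak p\leq_{RK}\mathfrak q$. (2) For every invariant global type $\mathfrak q$: $\mathfrak p$ and $\mathfrak q$ are non-orthogonal if and only if $\mathfrak p\leq_{RK}\mathfrak q$.
   Context: $T$ is a complete first-order theory with monster model $\bar M$; "small" means of cardinality less than the saturation of $\bar M$. A global type is a complete type over $\bar M$ (in finitely many variables); $\mathfrak p\upharpoonright A$ is the restriction of $\mathfrak p$ to $A$. Realizations of global types live in a larger monster model. For small $A$, $\mathfrak p(x)$ is $A$-invariant if for all $\bar b_1\equiv\bar b_2\,(A)$ and all formulas $\phi(x;\bar y)$ over $A$: $\phi(x,\bar b_1)\in\mathfrak p$ iff $\phi(x,\bar b_2)\in\mathfrak p$; it is invariant if it is $A$-invariant for some small $A$. Morley sequence: $(a_i\mid i<\alpha)$ is a Morley sequence in $\mathfrak p$ over $A$ if $a_i\models\mathfrak p\upharpoonright Aa_{<i}$ for all $i<\alpha$. Generic stability: a non-algebraic global type $\mathfrak p$ is generically stable if for some small $A$ it is $A$-invariant and, for every infinite $\alpha$ and every Morley sequence $(a_i\mid i<\alpha)$ in $\mathfrak p$ over $A$, for every formula $\phi(x)$ with parameters from $\bar M$ the set $\{i\mid\ \models\phi(a_i)\}$ is finite or co-finite. Strong regularity (for types in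 a single variable, possibly of a sort of $\bar M^{eq}$): $(\mathfrak p(x),\phi(x))$ is an $A$-invariant pair if $\mathfrak p$ is $A$-invariant and $\phi(x)\in\mathfrak p\upharpoonright A$. $(\mathfrak p,\phi)$ is strongly regular if for some small $A$ it is an $A$-invariant pair and for all small $B\supseteq A$ and all $a$ satisfying $\phi(x)$: either $a\models\mathfrak p\upharpoonright B$ or $\mathfrak p\upharpoonright B\vdash\mathfrak p\upharpoonright Ba$. $\mathfrak p$ is strongly regular if $(\mathfrak p,\phi)$ is strongly regular for some $\phi\in\mathfrak p$. Orthogonality: global types $\mathfrak p,\mathfrak q$ are orthogonal if $\mathfrak p(x)\cup\mathfrak q(y)$ (disjoint variables) determines a complete type over $\bar M$; otherwise non-orthogonal. Semi-isolation: $\bar b\in\mathrm{Sem}_A(\bar a)$ iff some formula in $\mathrm{tp}(\bar b/A\bar a)$ implies $\mathrm{tp}(\bar b/A)$. Rudin–Keisler order: $\mathfrak p\leq_{RK}\mathfrak q$ iff there are $\bar a\models\mathfrak p$ and $\bar b\models\mathfrak q$ with $\bar a\in\mathrm{Sem}_{\bar M}(\bar b)$. This is a quasi-order. *)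

theory Defs
  imports Main
begin

unbundle cardinal_syntax

section \<open>Many-sorted first-order logic\<close>

text \<open>A variable is a pair of its sort and an index. Formulas may mention parameters
  (names \<open>Par c\<close>), so that a formula over a set \<open>A\<close> is a formula all of whose parameters lie in \<open>A\<close>.\<close>

datatype ('v, 'f, 'c) tm = Var 'v | Par 'c | Fun 'f "('v, 'f, 'c) tm list"

datatype ('v, 'f, 'r, 'c) fm =
    Equal "('v, 'f, 'c) tm" "('v, 'f, 'c) tm"
  | Rel 'r "('v, 'f, 'c) tm list"
  | Neg "('v, 'f, 'r, 'c) fm"
  | Conj "('v, 'f, 'r, 'c) fm" "('v, 'f, 'r, 'c) fm"
  | Exists 'v "('v, 'f, 'r, 'c) fm"

type_synonym ('s, 'f, 'r, 'c) sfm = "('s \<times> nat, 'f, 'r, 'c) fm"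

text \<open>The symbols of the language are those with a signature different from \<open>None\<close>;
  so a language may have no function symbols, or no relation symbols.\<close>

record ('s, 'f, 'r) lang =
  sorts :: "'s set"
  fsig :: "'f \<Rightarrow> ('s list \<times> 's) option"
  rsig :: "'r \<Rightarrow> 's list option"

record ('s, 'f, 'r, 'a) struc =
  car :: "'s \<Rightarrow> 'a set"
  fint :: "'f \<Rightarrow> 'a list \<Rightarrow> 'a"
  rint :: "'r \<Rightarrow> 'a list set"

definition language :: "('s, 'f, 'r) lang \<Rightarrow> bool" where
  "language L \<longleftrightarrow>
     (\<forall>f ss s. fsig L f = Some (ss, s) \<longrightarrow> set ss \<subseteq> sorts L \<and> s \<in> sorts L) \<and>
     (\<forall>r ss. rsig L r = Some ss \<longrightarrow> set ss \<subseteq> sorts L)"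

definition univ :: "('s, 'f, 'r) lang \<Rightarrow> ('s, 'f, 'r, 'a) struc \<Rightarrow> 'a set" where
  "univ L M = (\<Union>s\<in>sorts L. car M s)"

definition tuples :: "('s, 'f, 'r, 'a) struc \<Rightarrow> 's list \<Rightarrow> 'a list set" where
  "tuples M ss = {xs. list_all2 (\<lambda>x s. x \<in> car M s) xs ss}"

definition is_structure :: "('s, 'f, 'r) lang \<Rightarrow> ('s, 'f, 'r, 'a) struc \<Rightarrow> bool" where
  "is_structure L M \<longleftrightarrow>
     (\<forall>s\<in>sorts L. car M s \<noteq> {}) \<and>
     (\<forall>s\<in>sorts L. \<forall>t\<in>sorts L. s \<noteq> t \<longrightarrow> car M s \<inter> car M t = {}) \<and>
     (\<forall>f ss s. fsig L f = Some (ss, s) \<longrightarrow> (\<forall>xs\<in>tuples M ss. fint M f xs \<in> car M s)) \<and>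
     (\<forall>r ss. rsig L r = Some ss \<longrightarrow> rint M r \<subseteq> tuples M ss)"

text \<open>Satisfaction; \<open>j\<close> interprets the parameters and \<open>e\<close> the variables.\<close>

primrec eval :: "('s, 'f, 'r, 'a) struc \<Rightarrow> ('c \<Rightarrow> 'a) \<Rightarrow> ('v \<Rightarrow> 'a) \<Rightarrow> ('v, 'f, 'c) tm \<Rightarrow> 'a" where
  "eval M j e (Var v) = e v"
| "eval M j e (Par c) = j c"
| "eval M j e (Fun f ts) = fint M f (map (eval M j e) ts)"

primrec sat :: "('s, 'f, 'r, 'a) struc \<Rightarrow> ('c \<Rightarrow> 'a) \<Rightarrow> ('s \<times> nat \<Rightarrow> 'a) \<Rightarrow> ('s, 'f, 'r, 'c) sfm \<Rightarrow> bool" where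
  "sat M j e (Equal t u) \<longleftrightarrow> eval M j e t = eval M j e u"
| "sat M j e (Rel r ts) \<longleftrightarrow> map (eval M j e) ts \<in> rint M r"
| "sat M j e (Neg \<phi>) \<longleftrightarrow> \<not> sat M j e \<phi>"
| "sat M j e (Conj \<phi> \<psi>) \<longleftrightarrow> sat M j e \<phi> \<and> sat M j e \<psi>"
| "sat M j e (Exists v \<phi>) \<longleftrightarrow> (\<exists>a\<in>car M (fst v). sat M j (e(v := a)) \<phi>)"

text \<open>Well-sortedness; \<open>C s\<close> is the set of parameters of sort \<open>s\<close> that may be used.\<close>

inductive has_sort :: "('s, 'f, 'r) lang \<Rightarrow> ('s \<Rightarrow> 'c set) \<Rightarrow> ('s \<times> nat, 'f, 'c) tm \<Rightarrow> 's \<Rightarrow> bool"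
  for L :: "('s, 'f, 'r) lang" and C :: "'s \<Rightarrow> 'c set" where
  "s \<in> sorts L \<Longrightarrow> has_sort L C (Var (s, n)) s"
| "s \<in> sorts L \<Longrightarrow> c \<in> C s \<Longrightarrow> has_sort L C (Par c) s"
| "fsig L f = Some (ss, s) \<Longrightarrow> list_all2 (has_sort L C) ts ss \<Longrightarrow> has_sort L C (Fun f ts) s"

primrec well_sorted :: "('s, 'f, 'r) lang \<Rightarrow> ('s \<Rightarrow> 'c set) \<Rightarrow> ('s, 'f, 'r, 'c) sfm \<Rightarrow> bool" where
  "well_sorted L C (Equal t u) \<longleftrightarrow> (\<exists>s. has_sort L C t s \<and> has_sort L C u s)"
| "well_sorted L C (Rel r ts) \<longleftrightarrow> (\<exists>ss. rsig L r = Some ss \<and> list_all2 (has_sort L C) ts ss)"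
| "well_sorted L C (Neg \<phi>) \<longleftrightarrow> well_sorted L C \<phi>"
| "well_sorted L C (Conj \<phi> \<psi>) \<longleftrightarrow> well_sorted L C \<phi> \<and> well_sorted L C \<psi>"
| "well_sorted L C (Exists v \<phi>) \<longleftrightarrow> fst v \<in> sorts L \<and> well_sorted L C \<phi>"

primrec fv :: "('v, 'f, 'r, 'c) fm \<Rightarrow> 'v set" where
  "fv (Equal t u) = set1_tm t \<union> set1_tm u"
| "fv (Rel r ts) = (\<Union>t\<in>set ts. set1_tm t)"
| "fv (Neg \<phi>) = fv \<phi>"
| "fv (Conj \<phi> \<psi>) = fv \<phi> \<union> fv \<psi>"
| "fv (Exists v \<phi>) = fv \<phi> - {v}"

text \<open>A tuple of variables of sorts \<open>[s\<^sub>0, \<dots>, s\<^sub>k]\<close> is always \<open>(s\<^sub>0, 0), \<dots>, (s\<^sub>k, k)\<close>.\<close>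

definition fmlas :: "('s, 'f, 'r) lang \<Rightarrow> ('s \<Rightarrow> 'c set) \<Rightarrow> 's list \<Rightarrow> ('s, 'f, 'r, 'c) sfm set" where
  "fmlas L C ss = {\<phi>. well_sorted L C \<phi> \<and> fv \<phi> \<subseteq> {(ss ! i, i) |i. i < length ss}}"

definition fmlas_over ::
    "('s, 'f, 'r) lang \<Rightarrow> ('s, 'f, 'r, 'a) struc \<Rightarrow> 'a set \<Rightarrow> 's list \<Rightarrow> ('s, 'f, 'r, 'a) sfm set" where
  "fmlas_over L M A ss = fmlas L (\<lambda>s. car M s \<inter> A) ss"

definition holds :: "('s, 'f, 'r, 'a) struc \<Rightarrow> ('c \<Rightarrow> 'a) \<Rightarrow> 'a list \<Rightarrow> ('s, 'f, 'r, 'c) sfm \<Rightarrow> bool" where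
  "holds M j xs \<phi> \<longleftrightarrow> sat M j (\<lambda>(s, i). xs ! i) \<phi>"

definition realizes ::
    "('s, 'f, 'r, 'a) struc \<Rightarrow> ('c \<Rightarrow> 'a) \<Rightarrow> 'a list \<Rightarrow> ('s, 'f, 'r, 'c) sfm set \<Rightarrow> bool" where
  "realizes M j xs \<Sigma> \<longleftrightarrow> (\<forall>\<phi>\<in>\<Sigma>. holds M j xs \<phi>)"

text \<open>\<open>inst \<sigma> \<phi>\<close> replaces free variables by parameters. If \<open>\<phi>(x, y)\<close> has the variables \<open>x\<close> in the
  first \<open>n\<close> positions, then \<open>plug n bs \<phi>\<close> is \<open>\<phi>(x, bs)\<close>.\<close>

primrec inst_tm :: "('v \<Rightarrow> 'c option) \<Rightarrow> ('v, 'f, 'c) tm \<Rightarrow> ('v, 'f, 'c) tm" where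
  "inst_tm \<sigma> (Var v) = (case \<sigma> v of None \<Rightarrow> Var v | Some c \<Rightarrow> Par c)"
| "inst_tm \<sigma> (Par c) = Par c"
| "inst_tm \<sigma> (Fun f ts) = Fun f (map (inst_tm \<sigma>) ts)"

primrec inst :: "('v \<Rightarrow> 'c option) \<Rightarrow> ('v, 'f, 'r, 'c) fm \<Rightarrow> ('v, 'f, 'r, 'c) fm" where
  "inst \<sigma> (Equal t u) = Equal (inst_tm \<sigma> t) (inst_tm \<sigma> u)"
| "inst \<sigma> (Rel r ts) = Rel r (map (inst_tm \<sigma>) ts)"
| "inst \<sigma> (Neg \<phi>) = Neg (inst \<sigma> \<phi>)"
| "inst \<sigma> (Conj \<phi> \<psi>) = Conj (inst \<sigma> \<phi>) (inst \<sigma> \<psi>)"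
| "inst \<sigma> (Exists v \<phi>) = Exists v (inst (\<sigma>(v := None)) \<phi>)"

definition plug :: "nat \<Rightarrow> 'c list \<Rightarrow> ('s, 'f, 'r, 'c) sfm \<Rightarrow> ('s, 'f, 'r, 'c) sfm" where
  "plug n bs = inst (\<lambda>(s, i). if n \<le> i \<and> i < n + length bs then Some (bs ! (i - n)) else None)"

definition shift :: "nat \<Rightarrow> ('s, 'f, 'r, 'c) sfm \<Rightarrow> ('s, 'f, 'r, 'c) sfm" where
  "shift n = map_fm (\<lambda>(s, i). (s, n + i)) id id id"


section \<open>Complete theories and monster models\<close>

definition sentences :: "('s, 'f, 'r) lang \<Rightarrow> ('s, 'f, 'r, unit) sfm set" where
  "sentences L = fmlas L (\<lambda>_. {}) []"

definition models :: "('s, 'f, 'r, 'a) struc \<Rightarrow> ('s, 'f, 'r, unit) sfm set \<Rightarrow> bool" where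
  "models M T \<longleftrightarrow> realizes M (\<lambda>_. undefined) [] T"

definition theory_of :: "('s, 'f, 'r) lang \<Rightarrow> ('s, 'f, 'r, 'a) struc \<Rightarrow> ('s, 'f, 'r, unit) sfm set" where
  "theory_of L M = {\<sigma> \<in> sentences L. models M {\<sigma>}}"

text \<open>Consistency is not part of this definition: it is only used for theories having a model.\<close>

definition complete_theory :: "('s, 'f, 'r) lang \<Rightarrow> ('s, 'f, 'r, unit) sfm set \<Rightarrow> bool" where
  "complete_theory L T \<longleftrightarrow> T \<subseteq> sentences L \<and> (\<forall>\<sigma>\<in>sentences L. \<sigma> \<in> T \<longleftrightarrow> Neg \<sigma> \<notin> T)"

definition small :: "'k rel \<Rightarrow> 'a set \<Rightarrow> bool" where
  "small \<kappa> A \<longleftrightarrow> |A| <o \<kappa>"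

definition finitely_satisfiable ::
    "('s, 'f, 'r, 'a) struc \<Rightarrow> 's list \<Rightarrow> ('s, 'f, 'r, 'a) sfm set \<Rightarrow> bool" where
  "finitely_satisfiable M ss \<Sigma> \<longleftrightarrow> (\<forall>F. finite F \<and> F \<subseteq> \<Sigma> \<longrightarrow> (\<exists>xs\<in>tuples M ss. realizes M id xs F))"

definition saturated :: "('s, 'f, 'r) lang \<Rightarrow> 'k rel \<Rightarrow> ('s, 'f, 'r, 'a) struc \<Rightarrow> bool" where
  "saturated L \<kappa> M \<longleftrightarrow>
     (\<forall>A ss \<Sigma>. A \<subseteq> univ L M \<and> small \<kappa> A \<and> set ss \<subseteq> sorts L \<and> \<Sigma> \<subseteq> fmlas_over L M A ss \<and>
        finitely_satisfiable M ss \<Sigma> \<longrightarrow> (\<exists>xs\<in>tuples M ss. realizes M id xs \<Sigma>))"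

text \<open>\<open>f\<close> is an elementary map on \<open>A\<close>: the expansions \<open>(M, a)\<close> and \<open>(N, f a)\<close> by constants for
  \<open>a \<in> A\<close> are elementarily equivalent.\<close>

definition elementary_on ::
    "('s, 'f, 'r) lang \<Rightarrow> ('s, 'f, 'r, 'a) struc \<Rightarrow> ('s, 'f, 'r, 'b) struc \<Rightarrow> 'a set \<Rightarrow> ('a \<Rightarrow> 'b) \<Rightarrow> bool" where
  "elementary_on L M N A f \<longleftrightarrow>
     (\<forall>s\<in>sorts L. f ` (car M s \<inter> A) \<subseteq> car N s) \<and>
     (\<forall>\<sigma>\<in>fmlas_over L M A []. holds M id [] \<sigma> \<longleftrightarrow> holds N f [] \<sigma>)"

definition automorphism :: "('s, 'f, 'r) lang \<Rightarrow> ('s, 'f, 'r, 'a) struc \<Rightarrow> ('a \<Rightarrow> 'a) \<Rightarrow> bool" where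
  "automorphism L M g \<longleftrightarrow>
     (\<forall>s\<in>sorts L. bij_betw g (car M s) (car M s)) \<and>
     (\<forall>f ss s. fsig L f = Some (ss, s) \<longrightarrow>
        (\<forall>xs\<in>tuples M ss. g (fint M f xs) = fint M f (map g xs))) \<and>
     (\<forall>r ss. rsig L r = Some ss \<longrightarrow> (\<forall>xs\<in>tuples M ss. xs \<in> rint M r \<longleftrightarrow> map g xs \<in> rint M r))"

definition strongly_homogeneous :: "('s, 'f, 'r) lang \<Rightarrow> 'k rel \<Rightarrow> ('s, 'f, 'r, 'a) struc \<Rightarrow> bool" where
  "strongly_homogeneous L \<kappa> M \<longleftrightarrow>
     (\<forall>A f. A \<subseteq> univ L M \<and> small \<kappa> A \<and> elementary_on L M M A f \<longrightarrow>
        (\<exists>g. automorphism L M g \<and> (\<forall>a\<in>A. g a = f a)))"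

definition monster_model ::
    "('s, 'f, 'r) lang \<Rightarrow> ('s, 'f, 'r, unit) sfm set \<Rightarrow> 'k rel \<Rightarrow> ('s, 'f, 'r, 'a) struc \<Rightarrow> bool" where
  "monster_model L T \<kappa> M \<longleftrightarrow>
     Card_order \<kappa> \<and> natLeq <o \<kappa> \<and>
     small \<kappa> (sorts L) \<and> small \<kappa> {f. fsig L f \<noteq> None} \<and> small \<kappa> {r. rsig L r \<noteq> None} \<and>
     is_structure L M \<and> models M T \<and> saturated L \<kappa> M \<and> strongly_homogeneous L \<kappa> M"


section \<open>Imaginaries\<close>

text \<open>The language \<open>L\<^sup>e\<^sup>q\<close> and the structure \<open>M\<^sup>e\<^sup>q\<close>: for every \<open>\<emptyset>\<close>-definable equivalence relation
  \<open>E\<close> on tuples of sorts \<open>ss\<close> there are a new sort \<open>Quot ss E\<close>, whose elements are the \<open>E\<close>-classes,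
  and a function symbol \<open>Proj ss E\<close> for the map taking a tuple to its class.\<close>

datatype ('s, 'f, 'r) eq_sort = Home 's | Quot "'s list" "('s, 'f, 'r, unit) sfm"

datatype ('s, 'f, 'r) eq_fun = Base 'f | Proj "'s list" "('s, 'f, 'r, unit) sfm"

datatype ('s, 'f, 'r, 'a) eq_elem =
    Elem (the_elem: 'a)
  | Class "'s list" "('s, 'f, 'r, unit) sfm" "'a list set"

definition def_rel ::
    "('s, 'f, 'r, 'a) struc \<Rightarrow> 's list \<Rightarrow> ('s, 'f, 'r, unit) sfm \<Rightarrow> 'a list rel" where
  "def_rel M ss E = {(xs, ys) \<in> tuples M ss \<times> tuples M ss. holds M (\<lambda>_. undefined) (xs @ ys) E}"

definition def_equiv ::
    "('s, 'f, 'r) lang \<Rightarrow> ('s, 'f, 'r, 'a) struc \<Rightarrow> 's list \<Rightarrow> ('s, 'f, 'r, unit) sfm \<Rightarrow> bool" where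
  "def_equiv L M ss E \<longleftrightarrow>
     set ss \<subseteq> sorts L \<and> E \<in> fmlas L (\<lambda>_. {}) (ss @ ss) \<and> equiv (tuples M ss) (def_rel M ss E)"

definition eq_lang ::
    "('s, 'f, 'r) lang \<Rightarrow> ('s, 'f, 'r, 'a) struc \<Rightarrow>
     (('s, 'f, 'r) eq_sort, ('s, 'f, 'r) eq_fun, 'r) lang" where
  "eq_lang L M =
     \<lparr> sorts = Home ` sorts L \<union> {Quot ss E |ss E. def_equiv L M ss E},
       fsig = (\<lambda>h. case h of
           Base f \<Rightarrow> map_option (\<lambda>(ss, s). (map Home ss, Home s)) (fsig L f)
         | Proj ss E \<Rightarrow> if def_equiv L M ss E then Some (map Home ss, Quot ss E) else None),
       rsig = (\<lambda>r. map_option (map Home) (rsig L r)) \<rparr>"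

definition eq_struc ::
    "('s, 'f, 'r, 'a) struc \<Rightarrow>
     (('s, 'f, 'r) eq_sort, ('s, 'f, 'r) eq_fun, 'r, ('s, 'f, 'r, 'a) eq_elem) struc" where
  "eq_struc M =
     \<lparr> car = (\<lambda>z. case z of
           Home s \<Rightarrow> Elem ` car M s
         | Quot ss E \<Rightarrow> Class ss E ` (tuples M ss // def_rel M ss E)),
       fint = (\<lambda>h xs. case h of
           Base f \<Rightarrow> Elem (fint M f (map the_elem xs))
         | Proj ss E \<Rightarrow> Class ss E (def_rel M ss E `` {map the_elem xs})),
       rint = (\<lambda>r. map Elem ` rint M r) \<rparr>"


section \<open>Global types\<close>

definition global_type ::
    "('s, 'f, 'r) lang \<Rightarrow> ('s, 'f, 'r, 'a) struc \<Rightarrow> 's list \<Rightarrow> ('s, 'f, 'r, 'a) sfm set \<Rightarrow> bool" where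
  "global_type L M ss p \<longleftrightarrow>
     set ss \<subseteq> sorts L \<and> p \<subseteq> fmlas_over L M (univ L M) ss \<and> finitely_satisfiable M ss p \<and>
     (\<forall>\<phi>\<in>fmlas_over L M (univ L M) ss. \<phi> \<in> p \<or> Neg \<phi> \<in> p)"

definition algebraic :: "('s, 'f, 'r, 'a) struc \<Rightarrow> 's list \<Rightarrow> ('s, 'f, 'r, 'a) sfm set \<Rightarrow> bool" where
  "algebraic M ss p \<longleftrightarrow> (\<exists>\<phi>\<in>p. finite {xs \<in> tuples M ss. holds M id xs \<phi>})"

definition restrict_type ::
    "('s, 'f, 'r) lang \<Rightarrow> ('s, 'f, 'r, 'a) struc \<Rightarrow> 's list \<Rightarrow> ('s, 'f, 'r, 'a) sfm set \<Rightarrow> 'a set \<Rightarrow>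
     ('s, 'f, 'r, 'a) sfm set" where
  "restrict_type L M ss p A = p \<inter> fmlas_over L M A ss"

definition same_type ::
    "('s, 'f, 'r) lang \<Rightarrow> ('s, 'f, 'r, 'a) struc \<Rightarrow> 'a set \<Rightarrow> 's list \<Rightarrow> 'a list \<Rightarrow> 'a list \<Rightarrow> bool" where
  "same_type L M A ts bs cs \<longleftrightarrow>
     (\<forall>\<phi>\<in>fmlas_over L M A ts. holds M id bs \<phi> \<longleftrightarrow> holds M id cs \<phi>)"

definition invariant_over ::
    "('s, 'f, 'r) lang \<Rightarrow> ('s, 'f, 'r, 'a) struc \<Rightarrow> 's list \<Rightarrow> ('s, 'f, 'r, 'a) sfm set \<Rightarrow> 'a set \<Rightarrow> bool" where
  "invariant_over L M ss p A \<longleftrightarrow>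
     (\<forall>ts bs cs. set ts \<subseteq> sorts L \<and> bs \<in> tuples M ts \<and> cs \<in> tuples M ts \<and> same_type L M A ts bs cs \<longrightarrow>
        (\<forall>\<phi>\<in>fmlas_over L M A (ss @ ts).
           plug (length ss) bs \<phi> \<in> p \<longleftrightarrow> plug (length ss) cs \<phi> \<in> p))"

definition invariant_type ::
    "('s, 'f, 'r) lang \<Rightarrow> 'k rel \<Rightarrow> ('s, 'f, 'r, 'a) struc \<Rightarrow> 's list \<Rightarrow> ('s, 'f, 'r, 'a) sfm set \<Rightarrow> bool" where
  "invariant_type L \<kappa> M ss p \<longleftrightarrow> (\<exists>A. A \<subseteq> univ L M \<and> small \<kappa> A \<and> invariant_over L M ss p A)"

text \<open>Sequences are indexed by the field of a well-order \<open>r\<close>.\<close>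

definition morley_sequence ::
    "('s, 'f, 'r) lang \<Rightarrow> ('s, 'f, 'r, 'a) struc \<Rightarrow> 's list \<Rightarrow> ('s, 'f, 'r, 'a) sfm set \<Rightarrow> 'a set \<Rightarrow>
     'i rel \<Rightarrow> ('i \<Rightarrow> 'a list) \<Rightarrow> bool" where
  "morley_sequence L M ss p A r a \<longleftrightarrow>
     (\<forall>i\<in>Field r. a i \<in> tuples M ss \<and>
        realizes M id (a i)
          (restrict_type L M ss p (A \<union> (\<Union>k\<in>{k. (k, i) \<in> r \<and> k \<noteq> i}. set (a k)))))"

text \<open>A Morley sequence in a non-algebraic type has no repetitions, so its length is the order type
  of a well-order of a set of tuples. Hence well-orders on the type of tuples represent all infinite
  lengths.\<close>

definition generically_stable ::
    "('s, 'f, 'r) lang \<Rightarrow> 'k rel \<Rightarrow> ('s, 'f, 'r, 'a) struc \<Rightarrow> 's list \<Rightarrow> ('s, 'f, 'r, 'a) sfm set \<Rightarrow> bool" where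
  "generically_stable L \<kappa> M ss p \<longleftrightarrow>
     global_type L M ss p \<and> \<not> algebraic M ss p \<and>
     (\<exists>A. A \<subseteq> univ L M \<and> small \<kappa> A \<and> invariant_over L M ss p A \<and>
        (\<forall>(r :: 'a list rel) a. Well_order r \<and> infinite (Field r) \<and> morley_sequence L M ss p A r a \<longrightarrow>
           (\<forall>\<phi>\<in>fmlas_over L M (univ L M) ss.
              finite {i \<in> Field r. holds M id (a i) \<phi>} \<or>
              finite {i \<in> Field r. \<not> holds M id (a i) \<phi>})))"

definition entails ::
    "('s, 'f, 'r, 'a) struc \<Rightarrow> 's list \<Rightarrow> ('s, 'f, 'r, 'a) sfm set \<Rightarrow> ('s, 'f, 'r, 'a) sfm set \<Rightarrow> bool" where
  "entails M ss \<Gamma> \<Delta> \<longleftrightarrow>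
     (\<forall>\<delta>\<in>\<Delta>. \<exists>F. finite F \<and> F \<subseteq> \<Gamma> \<and> (\<forall>xs\<in>tuples M ss. realizes M id xs F \<longrightarrow> holds M id xs \<delta>))"

definition strongly_regular_pair ::
    "('s, 'f, 'r) lang \<Rightarrow> 'k rel \<Rightarrow> ('s, 'f, 'r, 'a) struc \<Rightarrow> 's \<Rightarrow>
     ('s, 'f, 'r, 'a) sfm set \<Rightarrow> ('s, 'f, 'r, 'a) sfm \<Rightarrow> bool" where
  "strongly_regular_pair L \<kappa> M s p \<phi> \<longleftrightarrow>
     (\<exists>A. A \<subseteq> univ L M \<and> small \<kappa> A \<and> invariant_over L M [s] p A \<and> \<phi> \<in> restrict_type L M [s] p A \<and>
        (\<forall>B a. A \<subseteq> B \<and> B \<subseteq> univ L M \<and> small \<kappa> B \<and> a \<in> car M s \<and> holds M id [a] \<phi> \<longrightarrow>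
           realizes M id [a] (restrict_type L M [s] p B) \<or>
           entails M [s] (restrict_type L M [s] p B) (restrict_type L M [s] p (insert a B))))"

definition strongly_regular ::
    "('s, 'f, 'r) lang \<Rightarrow> 'k rel \<Rightarrow> ('s, 'f, 'r, 'a) struc \<Rightarrow> 's \<Rightarrow> ('s, 'f, 'r, 'a) sfm set \<Rightarrow> bool" where
  "strongly_regular L \<kappa> M s p \<longleftrightarrow>
     global_type L M [s] p \<and> (\<exists>\<phi>\<in>p. strongly_regular_pair L \<kappa> M s p \<phi>)"

definition orthogonal ::
    "('s, 'f, 'r) lang \<Rightarrow> ('s, 'f, 'r, 'a) struc \<Rightarrow>
     's list \<Rightarrow> ('s, 'f, 'r, 'a) sfm set \<Rightarrow> 's list \<Rightarrow> ('s, 'f, 'r, 'a) sfm set \<Rightarrow> bool" where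
  "orthogonal L M ss p ts q \<longleftrightarrow>
     (\<exists>!u. global_type L M (ss @ ts) u \<and> p \<union> shift (length ss) ` q \<subseteq> u)"

text \<open>\<open>semi_isolated L N A ts b a\<close> says that \<open>b\<close>, a tuple of sorts \<open>ts\<close>, belongs to \<open>Sem\<^sub>A(a)\<close>.\<close>

definition semi_isolated ::
    "('s, 'f, 'r) lang \<Rightarrow> ('s, 'f, 'r, 'a) struc \<Rightarrow> 'a set \<Rightarrow> 's list \<Rightarrow> 'a list \<Rightarrow> 'a list \<Rightarrow> bool" where
  "semi_isolated L N A ts b a \<longleftrightarrow>
     (\<exists>\<phi>\<in>fmlas_over L N (A \<union> set a) ts. holds N id b \<phi> \<and>
        entails N ts {\<phi>} {\<psi> \<in> fmlas_over L N A ts. holds N id b \<psi>})"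

text \<open>Realizations of global types are taken in \<open>N\<close>, an elementary extension of \<open>M\<close> via \<open>j\<close>.\<close>

definition rk_le ::
    "('s, 'f, 'r) lang \<Rightarrow> ('s, 'f, 'r, 'a) struc \<Rightarrow> ('s, 'f, 'r, 'b) struc \<Rightarrow> ('a \<Rightarrow> 'b) \<Rightarrow>
     's list \<Rightarrow> ('s, 'f, 'r, 'a) sfm set \<Rightarrow> 's list \<Rightarrow> ('s, 'f, 'r, 'a) sfm set \<Rightarrow> bool" where
  "rk_le L M N j ss p ts q \<longleftrightarrow>
     (\<exists>a\<in>tuples N ss. \<exists>b\<in>tuples N ts. realizes N j a p \<and> realizes N j b q \<and>
        semi_isolated L N (j ` univ L M) ss a b)"

text \<open>\<open>N\<close> is a larger monster model of \<open>Th(M)\<close>: it extends \<open>M\<close> elementarily via \<open>j\<close>, and \<open>M\<close> is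
  small for \<open>N\<close>.\<close>

definition larger_monster ::
    "('s, 'f, 'r) lang \<Rightarrow> ('s, 'f, 'r, 'a) struc \<Rightarrow> 'l rel \<Rightarrow> ('s, 'f, 'r, 'b) struc \<Rightarrow> ('a \<Rightarrow> 'b) \<Rightarrow> bool" where
  "larger_monster L M \<mu> N j \<longleftrightarrow>
     monster_model L (theory_of L M) \<mu> N \<and> small \<mu> (univ L M) \<and> elementary_on L M N (univ L M) j"

end

theory Submission
  imports Defs
begin

text \<open>Let \<open>M\<close> be a saturated structure, \<open>p\<close> generically stable and strongly regular through \<open>\<phi>\<close>.

  A compactness argument turns stability of Morley sequences into a majority rule: for every
  \<open>\<psi>(x, y)\<close> there is \<open>n\<close> such that \<open>\<psi>(x, c) \<in> p\<close> as soon as \<open>\<psi>(x, c)\<close> holds on a Morley sequence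
  of length \<open>n\<close>. Hence \<open>p\<close> is definable; let \<open>\<delta>(y)\<close> define \<open>{c. \<psi>(x, c) \<in> p}\<close>.

  Suppose \<open>b \<Turnstile> p\<close> and \<open>a\<close> satisfy \<open>\<psi>(b, a) \<and> \<not> \<delta>(a)\<close> and no formula over \<open>Ma\<close> that is true of \<open>b\<close>
  isolates \<open>p\<close>. An element \<open>z\<close> that satisfies \<open>\<phi>\<close> but omits \<open>p\<close> is free over \<open>p\<close>, in the sense that
  \<open>p\<close> entails its extension to \<open>Mz\<close>. So one finds, one after the other, elements \<open>z\<^sub>1, \<dots>, z\<^sub>n\<close> that satisfy \<open>\<phi>\<close>
  and \<open>\<psi>(x, a)\<close>, omit \<open>p\<close>, and still satisfy any given formula true of Morley sequences of \<open>p\<close>. Applied to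
  the formula \<open>\<forall>y. (\<And>\<^sub>i \<psi>(x\<^sub>i, y)) \<longrightarrow> \<delta>(y)\<close> this yields \<open>\<delta>(a)\<close>, a contradiction. Therefore
  \<open>b\<close> is semi-isolated over \<open>a\<close>.

  Non-orthogonality of \<open>p\<close> and \<open>q\<close> supplies such \<open>b\<close>, \<open>a \<Turnstile> q\<close> and \<open>\<psi>\<close>. Conversely, if \<open>\<theta>(x, b)\<close>
  isolates a non-algebraic type \<open>p\<close> and \<open>p(x) \<union> q(y)\<close> is complete, then \<open>\<sigma>(x) \<and> \<tau>(y)\<close> implies
  \<open>\<theta>(x, y)\<close> for some \<open>\<sigma> \<in> p\<close>, \<open>\<tau> \<in> q\<close>, and any \<open>m \<in> \<sigma>(M)\<close> would realize \<open>p\<close>. The theorem applies this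
  to the structure of imaginaries, whose saturation follows from that of the home sorts.\<close>

section \<open>Substitution\<close>

text \<open>Generic stability and strong regularity speak of elements and small subsets of
  \<open>M\<close>, but \<open>a\<close>, \<open>b\<close> and the elements \<open>z\<close> of the
  overview lie in \<open>N\<close>. So every step must become a first-order statement over
  \<open>M\<close> before it can be used in \<open>N\<close>. Two facts make this possible.
  Definability turns \<open>plug (Suc 0) zs \<rho> \<in> p\<close> into a formula in
  \<open>zs\<close>. Compactness in \<open>M\<close> replaces the entailment of the extension of
  \<open>p\<close> to \<open>zs\<close> by a single formula \<pi> in \<open>p\<close> that serves
  all tuples from \<phi> omitting a given \<sigma> in \<open>p\<close>.

  The elements \<open>z\<close> omit \<open>p\<close>, so stability cannot be applied to them as to
  a Morley sequence. They only share with Morley sequences one formula fixed in advance. This is why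
  the majority rule is needed with a finite bound \<open>n\<close>, which can be written into that
  formula.

  Minimality uses that non-orthogonality is symmetric: if q is non-algebraic and lies below p, then
  the two are non-orthogonal, and this puts p below q.\<close>

abbreviation tm_vars :: "('v, 'f, 'c) tm \<Rightarrow> 'v set" where "tm_vars \<equiv> set1_tm"

definition vars_of :: "'s list \<Rightarrow> ('s \<times> nat) set" where
  "vars_of ss = {(ss ! i, i) |i. i < length ss}"

definition val :: "'a list \<Rightarrow> 's \<times> nat \<Rightarrow> 'a" where
  "val xs = (\<lambda>(s, i). xs ! i)"

lemma val_simp [simp]: "val xs (s, i) = xs ! i"
  by (simp add: val_def)

lemma fmlas_iff: "\<phi> \<in> fmlas L C ss \<longleftrightarrow> well_sorted L C \<phi> \<and> fv \<phi> \<subseteq> vars_of ss"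
  by (simp add: fmlas_def vars_of_def)

lemma vars_of_append: "vars_of ss \<subseteq> vars_of (ss @ ts)"
  by (force simp: vars_of_def nth_append)

lemma vars_ofE: "v \<in> vars_of ss \<Longrightarrow> (\<And>i. v = (ss ! i, i) \<Longrightarrow> i < length ss \<Longrightarrow> P) \<Longrightarrow> P"
  unfolding vars_of_def by blast

lemma fmlas_fv: "\<phi> \<in> fmlas L C ss \<Longrightarrow> v \<in> fv \<phi> \<Longrightarrow> v \<in> vars_of ss"
  unfolding fmlas_iff by blast

lemma holds_val: "holds M j xs \<phi> \<longleftrightarrow> sat M j (val xs) \<phi>"
  by (simp add: holds_def val_def)

section \<open>Monotonicity in the parameters, and the finite number of parameters of a
  formula\<close>

lemma has_sort_mono:
  assumes "has_sort L C t s" "\<And>s. s \<in> sorts L \<Longrightarrow> C s \<subseteq> D s"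
  shows "has_sort L D t s"
  using assms(1)
proof (induction rule: has_sort.induct)
  case (3 f ss s ts)
  then show ?case by (auto intro!: has_sort.intros elim: list_all2_mono)
qed (use assms(2) in \<open>auto intro!: has_sort.intros\<close>)

lemma well_sorted_mono:
  assumes "well_sorted L C \<phi>" "\<And>s. s \<in> sorts L \<Longrightarrow> C s \<subseteq> D s"
  shows "well_sorted L D \<phi>"
  using assms(1)
proof (induction \<phi>)
  case (Equal t u) then show ?case using has_sort_mono[OF _ assms(2)] by fastforce
next
  case (Rel r ts)
  then show ?case using has_sort_mono[OF _ assms(2)] by (fastforce elim!: list_all2_mono)
qed auto

lemma fmlas_mono:
  "\<phi> \<in> fmlas L C ss \<Longrightarrow> (\<And>s. s \<in> sorts L \<Longrightarrow> C s \<subseteq> D s) \<Longrightarrow> \<phi> \<in> fmlas L D ss"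
  unfolding fmlas_iff by (blast intro: well_sorted_mono)

lemma fmlas_append: "\<phi> \<in> fmlas L C ss \<Longrightarrow> \<phi> \<in> fmlas L C (ss @ ts)"
  using vars_of_append[of ss ts] unfolding fmlas_iff by blast

lemma has_sort_finite_params:
  assumes "has_sort L C t s"
  shows "\<exists>P. finite P \<and> has_sort L (\<lambda>s. C s \<inter> P) t s"
  using assms
proof (induction rule: has_sort.induct)
  case (1 s n) then show ?case by (blast intro: has_sort.intros)
next
  case (2 s c)
  then have "has_sort L (\<lambda>s. C s \<inter> {c}) (Par c) s" by (auto intro: has_sort.intros)
  then show ?case by blast
next
  case (3 f ss s ts)
  have "\<exists>P. finite P \<and> list_all2 (has_sort L (\<lambda>s. C s \<inter> P)) ts ss"
    using 3(2)
  proof (induction rule: list_all2_induct)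
    case Nil then show ?case by auto
  next
    case (Cons x xs y ys)
    then obtain P Q where "finite P" "has_sort L (\<lambda>s. C s \<inter> P) x y"
      "finite Q" "list_all2 (has_sort L (\<lambda>s. C s \<inter> Q)) xs ys" by blast
    then have "has_sort L (\<lambda>s. C s \<inter> (P \<union> Q)) x y"
      "list_all2 (has_sort L (\<lambda>s. C s \<inter> (P \<union> Q))) xs ys"
      by (auto elim!: has_sort_mono list_all2_mono)
    with \<open>finite P\<close> \<open>finite Q\<close> show ?case by (intro exI[of _ "P \<union> Q"]) auto
  qed
  with 3(1) show ?case by (blast intro: has_sort.intros)
qed

lemma well_sorted_finite_params:
  assumes "well_sorted L C \<phi>"
  shows "\<exists>P. finite P \<and> well_sorted L (\<lambda>s. C s \<inter> P) \<phi>"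
  using assms
proof (induction \<phi>)
  case (Equal t u)
  then obtain s where s: "has_sort L C t s" "has_sort L C u s" by auto
  then obtain P Q where "finite P" "has_sort L (\<lambda>s. C s \<inter> P) t s"
      "finite Q" "has_sort L (\<lambda>s. C s \<inter> Q) u s" using has_sort_finite_params by metis
  then have "finite (P \<union> Q)" "has_sort L (\<lambda>s. C s \<inter> (P \<union> Q)) t s"
      "has_sort L (\<lambda>s. C s \<inter> (P \<union> Q)) u s" by (auto elim!: has_sort_mono)
  then show ?case by (metis well_sorted.simps(1))
next
  case (Rel r ts)
  then obtain ss where ss: "rsig L r = Some ss" "list_all2 (has_sort L C) ts ss" by auto
  have "\<exists>P. finite P \<and> list_all2 (has_sort L (\<lambda>s. C s \<inter> P)) ts ss"
    using ss(2)
  proof (induction rule: list_all2_induct)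
    case Nil then show ?case by auto
  next
    case (Cons x xs y ys)
    then obtain P Q where "finite P" "has_sort L (\<lambda>s. C s \<inter> P) x y"
      "finite Q" "list_all2 (has_sort L (\<lambda>s. C s \<inter> Q)) xs ys" by (metis has_sort_finite_params)
    then have "has_sort L (\<lambda>s. C s \<inter> (P \<union> Q)) x y"
      "list_all2 (has_sort L (\<lambda>s. C s \<inter> (P \<union> Q))) xs ys"
      by (auto elim!: has_sort_mono list_all2_mono)
    with \<open>finite P\<close> \<open>finite Q\<close> show ?case by (intro exI[of _ "P \<union> Q"]) auto
  qed
  with ss(1) show ?case by auto
next
  case (Conj \<phi> \<psi>)
  then obtain P Q where "finite P" "well_sorted L (\<lambda>s. C s \<inter> P) \<phi>"
      "finite Q" "well_sorted L (\<lambda>s. C s \<inter> Q) \<psi>" by auto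
  then have "well_sorted L (\<lambda>s. C s \<inter> (P \<union> Q)) \<phi>" "well_sorted L (\<lambda>s. C s \<inter> (P \<union> Q)) \<psi>"
    by (auto elim!: well_sorted_mono)
  with \<open>finite P\<close> \<open>finite Q\<close> show ?case by (intro exI[of _ "P \<union> Q"]) auto
qed auto

lemma fmlas_finite_params:
  assumes "\<phi> \<in> fmlas L C ss"
  obtains P where "finite P" "\<phi> \<in> fmlas L (\<lambda>s. C s \<inter> P) ss"
  using assms well_sorted_finite_params[of L C \<phi>] by (auto simp: fmlas_iff)

lemma eval_cong:
  assumes "has_sort L C t s" "\<And>s c. s \<in> sorts L \<Longrightarrow> c \<in> C s \<Longrightarrow> j c = k c"
    "\<And>v. v \<in> tm_vars t \<Longrightarrow> e v = e' v"
  shows "eval M j e t = eval M k e' t"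
  using assms(1,3)
proof (induction rule: has_sort.induct)
  case (3 f ss s ts)
  have "map (eval M j e) ts = map (eval M k e') ts"
  proof (rule map_cong[OF refl])
    fix t assume t: "t \<in> set ts"
    then obtain i where "i < length ts" "t = ts ! i" by (metis in_set_conv_nth)
    with 3(2) have "(\<forall>v. v \<in> tm_vars t \<longrightarrow> e v = e' v) \<longrightarrow> eval M j e t = eval M k e' t"
      by (auto simp: list_all2_conv_all_nth)
    then show "eval M j e t = eval M k e' t" using 3(3) t by auto
  qed
  then show ?case by (simp only: eval.simps)
qed (use assms(2) in auto)

text \<open>Well-sortedness bounds the parameters that occur, so \<open>j\<close> and
  \<open>k\<close> may differ outside \<open>C\<close>; for a formula without parameters their
  values are irrelevant.\<close>

lemma sat_cong:
  assumes "well_sorted L C \<phi>" "\<And>s c. s \<in> sorts L \<Longrightarrow> c \<in> C s \<Longrightarrow> j c = k c"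
    "\<And>v. v \<in> fv \<phi> \<Longrightarrow> e v = e' v"
  shows "sat M j e \<phi> \<longleftrightarrow> sat M k e' \<phi>"
  using assms(1,3)
proof (induction \<phi> arbitrary: e e')
  case (Equal t u)
  then obtain s where "has_sort L C t s" "has_sort L C u s" by auto
  then have "eval M j e t = eval M k e' t" "eval M j e u = eval M k e' u"
    using Equal(2) assms(2) by (auto intro!: eval_cong)
  then show ?case by simp
next
  case (Rel r ts)
  then obtain ss where ss: "list_all2 (has_sort L C) ts ss" by auto
  have "map (eval M j e) ts = map (eval M k e') ts"
  proof (rule map_cong[OF refl])
    fix t assume t: "t \<in> set ts"
    then obtain i where "i < length ts" "t = ts ! i" by (metis in_set_conv_nth)
    with ss have "has_sort L C t (ss ! i)" by (simp add: list_all2_conv_all_nth)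
    then show "eval M j e t = eval M k e' t"
    proof (rule eval_cong)
      show "e v = e' v" if "v \<in> tm_vars t" for v using Rel(2)[of v] that t by auto
    qed (use assms(2) in auto)
  qed
  then show ?case by (simp only: sat.simps)
next
  case (Exists v \<phi>)
  have "sat M j (e(v := a)) \<phi> \<longleftrightarrow> sat M k (e'(v := a)) \<phi>" for a
    by (rule Exists.IH) (use Exists.prems in auto)
  then show ?case by simp
next
  case (Conj \<phi> \<psi>)
  have "sat M j e \<phi> \<longleftrightarrow> sat M k e' \<phi>" by (rule Conj.IH(1)) (use Conj.prems in auto)
  moreover have "sat M j e \<psi> \<longleftrightarrow> sat M k e' \<psi>" by (rule Conj.IH(2)) (use Conj.prems in auto)
  ultimately show ?case by simp
next
  case (Neg \<phi>)
  have "sat M j e \<phi> \<longleftrightarrow> sat M k e' \<phi>" by (rule Neg.IH) (use Neg.prems in auto)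
  then show ?case by simp
qed

lemma holds_cong:
  assumes "\<phi> \<in> fmlas L C ss" "\<And>s c. s \<in> sorts L \<Longrightarrow> c \<in> C s \<Longrightarrow> j c = k c"
    "\<And>i. i < length ss \<Longrightarrow> xs ! i = ys ! i"
  shows "holds M j xs \<phi> \<longleftrightarrow> holds M k ys \<phi>"
  unfolding holds_val
  by (rule sat_cong) (use assms in \<open>auto simp: fmlas_iff vars_of_def\<close>)

text \<open>Simultaneous substitution of terms for free variables and for parameters. Bound variables are
  shifted by \<open>K\<close>, so that nothing is captured if the substituted terms only use indices below \<open>K\<close>.\<close>

primrec sub_tm ::
    "('v \<Rightarrow> ('w, 'f, 'd) tm) \<Rightarrow> ('c \<Rightarrow> ('w, 'f, 'd) tm) \<Rightarrow> ('v, 'f, 'c) tm \<Rightarrow> ('w, 'f, 'd) tm" where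
  "sub_tm \<theta> g (Var v) = \<theta> v"
| "sub_tm \<theta> g (Par c) = g c"
| "sub_tm \<theta> g (Fun f ts) = Fun f (map (sub_tm \<theta> g) ts)"

primrec sub ::
    "nat \<Rightarrow> ('s \<times> nat \<Rightarrow> ('s \<times> nat, 'f, 'd) tm) \<Rightarrow> ('c \<Rightarrow> ('s \<times> nat, 'f, 'd) tm) \<Rightarrow>
     ('s, 'f, 'r, 'c) sfm \<Rightarrow> ('s, 'f, 'r, 'd) sfm" where
  "sub K \<theta> g (Equal t u) = Equal (sub_tm \<theta> g t) (sub_tm \<theta> g u)"
| "sub K \<theta> g (Rel r ts) = Rel r (map (sub_tm \<theta> g) ts)"
| "sub K \<theta> g (Neg \<phi>) = Neg (sub K \<theta> g \<phi>)"
| "sub K \<theta> g (Conj \<phi> \<psi>) = Conj (sub K \<theta> g \<phi>) (sub K \<theta> g \<psi>)"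
| "sub K \<theta> g (Exists v \<phi>) =
     Exists (fst v, snd v + K) (sub K (\<theta>(v := Var (fst v, snd v + K))) g \<phi>)"

lemma eval_sub_tm:
  "eval M j e (sub_tm \<theta> g t) = eval M (\<lambda>c. eval M j e (g c)) (\<lambda>v. eval M j e (\<theta> v)) t"
  by (induction t) (auto cong: map_cong)

lemma eval_cong_vars: "(\<And>v. v \<in> tm_vars t \<Longrightarrow> e v = e' v) \<Longrightarrow> eval M j e t = eval M j e' t"
proof (induction t)
  case (Fun f ts)
  then have "map (eval M j e) ts = map (eval M j e') ts" by (auto intro!: map_cong)
  then show ?case by (simp only: eval.simps)
qed auto

text \<open>The second alternative in the condition on \<theta> makes it stable under quantifiers: a
  bound variable is sent to its copy raised by \<open>K\<close>. Copies of different variables are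
  different, and none has an index below \<open>K\<close>, so assigning a value to the copy of
  \<open>v\<close> leaves the value of every other \<open>\<theta> u\<close> unchanged.\<close>

lemma sat_sub:
  assumes "\<And>v w. w \<in> tm_vars (\<theta> v) \<Longrightarrow> snd w < K \<or> w = (fst v, snd v + K)"
    and g: "\<And>c w. w \<in> tm_vars (g c) \<Longrightarrow> snd w < K"
  shows "sat M j e (sub K \<theta> g \<phi>) \<longleftrightarrow> sat M (\<lambda>c. eval M j e (g c)) (\<lambda>v. eval M j e (\<theta> v)) \<phi>"
  using assms(1)
proof (induction \<phi> arbitrary: e \<theta>)
  case (Exists v \<phi>)
  let ?v = "(fst v, snd v + K)"
  have "sat M j (e(?v := a)) (sub K (\<theta>(v := Var ?v)) g \<phi>) \<longleftrightarrow>
      sat M (\<lambda>c. eval M j e (g c)) ((\<lambda>v. eval M j e (\<theta> v))(v := a)) \<phi>" for a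
  proof -
    have "sat M j (e(?v := a)) (sub K (\<theta>(v := Var ?v)) g \<phi>) \<longleftrightarrow>
      sat M (\<lambda>c. eval M j (e(?v := a)) (g c))
        (\<lambda>u. eval M j (e(?v := a)) ((\<theta>(v := Var ?v)) u)) \<phi>"
      by (rule Exists.IH) (use Exists.prems in \<open>auto split: if_splits\<close>)
    also have "(\<lambda>c. eval M j (e(?v := a)) (g c)) = (\<lambda>c. eval M j e (g c))"
      by (intro ext eval_cong_vars) (use g in fastforce)
    also have "(\<lambda>u. eval M j (e(?v := a)) ((\<theta>(v := Var ?v)) u)) = (\<lambda>v. eval M j e (\<theta> v))(v := a)"
    proof
      fix u
      have "eval M j (e(?v := a)) (\<theta> u) = eval M j e (\<theta> u)" if "u \<noteq> v"
      proof (rule eval_cong_vars)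
        fix w assume "w \<in> tm_vars (\<theta> u)"
        from Exists.prems[OF this] that have "w \<noteq> ?v" by (auto simp: prod_eq_iff)
        then show "(e(?v := a)) w = e w" by simp
      qed
      then show "eval M j (e(?v := a)) ((\<theta>(v := Var ?v)) u) = ((\<lambda>v. eval M j e (\<theta> v))(v := a)) u"
        by simp
    qed
    finally show ?thesis .
  qed
  then show ?case by simp
qed (auto simp: eval_sub_tm cong: map_cong)

lemma has_sort_sub_tm:
  assumes "has_sort L C t s" "\<And>v. v \<in> tm_vars t \<Longrightarrow> has_sort L D (\<theta> v) (fst v)"
    "\<And>s c. s \<in> sorts L \<Longrightarrow> c \<in> C s \<Longrightarrow> has_sort L D (g c) s"
  shows "has_sort L D (sub_tm \<theta> g t) s"
  using assms(1,2)
proof (induction rule: has_sort.induct)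
  case (3 f ss s ts)
  have "list_all2 (has_sort L D) (map (sub_tm \<theta> g) ts) ss"
    unfolding list_all2_conv_all_nth
  proof (intro conjI allI impI)
    show "length (map (sub_tm \<theta> g) ts) = length ss" using 3(2) by (auto dest: list_all2_lengthD)
    fix i assume i: "i < length (map (sub_tm \<theta> g) ts)"
    with 3(2) have "(\<forall>v. v \<in> tm_vars (ts ! i) \<longrightarrow> has_sort L D (\<theta> v) (fst v)) \<longrightarrow>
        has_sort L D (sub_tm \<theta> g (ts ! i)) (ss ! i)"
      by (auto simp: list_all2_conv_all_nth)
    then show "has_sort L D (map (sub_tm \<theta> g) ts ! i) (ss ! i)"
      using 3(3)[of v for v] i nth_mem[of i ts] by fastforce
  qed
  then show ?case using 3(1) by (auto intro: has_sort.intros)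
qed (use assms(3) in auto)

lemma well_sorted_sub:
  assumes "well_sorted L C \<phi>" "\<And>v. v \<in> fv \<phi> \<Longrightarrow> has_sort L D (\<theta> v) (fst v)"
    "\<And>s c. s \<in> sorts L \<Longrightarrow> c \<in> C s \<Longrightarrow> has_sort L D (g c) s"
  shows "well_sorted L D (sub K \<theta> g \<phi>)"
  using assms(1,2)
proof (induction \<phi> arbitrary: \<theta>)
  case (Equal t u)
  then obtain s where "has_sort L C t s" "has_sort L C u s" by auto
  then have "has_sort L D (sub_tm \<theta> g t) s" "has_sort L D (sub_tm \<theta> g u) s"
    using Equal(2) assms(3) by (auto intro!: has_sort_sub_tm)
  then show ?case by auto
next
  case (Rel r ts)
  then obtain ss where ss: "rsig L r = Some ss" "list_all2 (has_sort L C) ts ss" by auto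
  have "list_all2 (has_sort L D) (map (sub_tm \<theta> g) ts) ss"
    unfolding list_all2_conv_all_nth
  proof (intro conjI allI impI)
    show "length (map (sub_tm \<theta> g) ts) = length ss" using ss by (auto dest: list_all2_lengthD)
    fix i assume i: "i < length (map (sub_tm \<theta> g) ts)"
    then have "has_sort L D (sub_tm \<theta> g (ts ! i)) (ss ! i)"
      using ss(2) Rel(2)[of v for v] assms(3) nth_mem[of i ts]
      by (intro has_sort_sub_tm[of L C]) (fastforce simp: list_all2_conv_all_nth)+
    then show "has_sort L D (map (sub_tm \<theta> g) ts ! i) (ss ! i)" using i by simp
  qed
  with ss(1) show ?case by simp
next
  case (Exists v \<phi>)
  have "well_sorted L D (sub K (\<theta>(v := Var (fst v, snd v + K))) g \<phi>)"
    by (rule Exists.IH) (use Exists.prems in \<open>auto intro: has_sort.intros\<close>)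
  then show ?case using Exists.prems by simp
qed auto

lemma vars_sub_tm: "tm_vars (sub_tm \<theta> g t) \<subseteq> (\<Union>v\<in>tm_vars t. tm_vars (\<theta> v)) \<union> (\<Union>c. tm_vars (g c))"
  by (induction t) auto

lemma fv_sub: "fv (sub K \<theta> g \<phi>) \<subseteq> (\<Union>v\<in>fv \<phi>. tm_vars (\<theta> v)) \<union> (\<Union>c. tm_vars (g c))"
proof (induction \<phi> arbitrary: \<theta>)
  case (Equal t u) then show ?case using vars_sub_tm[of \<theta> g t] vars_sub_tm[of \<theta> g u] by auto
next
  case (Rel r ts)
  have "tm_vars (sub_tm \<theta> g t) \<subseteq> (\<Union>v\<in>fv (Rel r ts). tm_vars (\<theta> v)) \<union> (\<Union>c. tm_vars (g c))"
    if "t \<in> set ts" for t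
    using vars_sub_tm[of \<theta> g t] that by auto
  then show ?case by (simp add: UN_subset_iff)
next
  case (Conj \<phi> \<psi>)
  show ?case using Conj.IH[of \<theta>] unfolding fv.simps sub.simps by blast
next
  case (Exists v \<phi>)
  let ?v = "(fst v, snd v + K)"
  have diff: "A - {x} \<subseteq> C \<union> G" if "A \<subseteq> B \<union> G" "B \<subseteq> insert x C" for A B C G x
    using that by blast
  have 1: "(\<Union>u\<in>fv \<phi>. tm_vars ((\<theta>(v := Var ?v)) u)) \<subseteq> insert ?v (\<Union>u\<in>fv \<phi> - {v}. tm_vars (\<theta> u))"
    by (auto split: if_splits)
  show ?case unfolding fv.simps sub.simps by (rule diff[OF Exists.IH 1])
qed auto

text \<open>The terms \<open>ts\<close> replace the variables of a formula in
  \<open>fmlas L C ss\<close>. Positions beyond \<open>ts\<close> are not free in such a formula;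
  they are sent to their raised copies because \<open>sat_sub\<close> asks for a condition on all
  variables.\<close>

definition tsub ::
    "nat \<Rightarrow> ('s \<times> nat, 'f, 'd) tm list \<Rightarrow> ('c \<Rightarrow> ('s \<times> nat, 'f, 'd) tm) \<Rightarrow>
     ('s, 'f, 'r, 'c) sfm \<Rightarrow> ('s, 'f, 'r, 'd) sfm" where
  "tsub K ts = sub K (\<lambda>(s, i). if i < length ts then ts ! i else Var (s, i + K))"

lemma sat_tsub:
  assumes "\<phi> \<in> fmlas L C ss" "length ts = length ss"
    and "\<And>t w. t \<in> set ts \<Longrightarrow> w \<in> tm_vars t \<Longrightarrow> snd w < K" "\<And>c w. w \<in> tm_vars (g c) \<Longrightarrow> snd w < K"
  shows "sat M j e (tsub K ts g \<phi>) \<longleftrightarrow> holds M (\<lambda>c. eval M j e (g c)) (map (eval M j e) ts) \<phi>"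
proof -
  let ?\<theta> = "\<lambda>(s, i). if i < length ts then ts ! i else Var (s, i + K)"
  have 1: "snd w < K \<or> w = (fst v, snd v + K)" if w: "w \<in> tm_vars (?\<theta> v)" for v w
  proof (cases "snd v < length ts")
    case True
    with w have "w \<in> tm_vars (ts ! snd v)" by (simp add: case_prod_beta)
    with assms(3) True show ?thesis using nth_mem by blast
  next
    case False
    with w show ?thesis by (simp add: case_prod_beta)
  qed
  have "sat M j e (tsub K ts g \<phi>) \<longleftrightarrow>
      sat M (\<lambda>c. eval M j e (g c)) (\<lambda>v. eval M j e (?\<theta> v)) \<phi>"
    unfolding tsub_def by (rule sat_sub[OF 1 assms(4)])
  also have "\<dots> \<longleftrightarrow> holds M (\<lambda>c. eval M j e (g c)) (map (eval M j e) ts) \<phi>"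
    unfolding holds_val by (rule sat_cong) (use assms(1,2) in \<open>auto simp: fmlas_iff vars_of_def subset_iff\<close>)
  finally show ?thesis .
qed

lemma tsub_fv:
  assumes "\<phi> \<in> fmlas L C ss" "length ts = length ss" "\<And>c. tm_vars (g c) = {}"
  shows "fv (tsub K ts g \<phi>) \<subseteq> (\<Union>t\<in>set ts. tm_vars t)"
proof
  fix w assume "w \<in> fv (tsub K ts g \<phi>)"
  then have "w \<in> (\<Union>v\<in>fv \<phi>. tm_vars (case v of (s, i) \<Rightarrow> if i < length ts then ts ! i else Var (s, i + K)))
      \<union> (\<Union>c. tm_vars (g c))"
    unfolding tsub_def by (rule subsetD[OF fv_sub])
  then obtain v where v: "v \<in> fv \<phi>"
    and w: "w \<in> tm_vars (case v of (s, i) \<Rightarrow> if i < length ts then ts ! i else Var (s, i + K))"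
    unfolding assms(3) by (elim UnE UN_E) simp_all
  from fmlas_fv[OF assms(1) v] obtain i where i: "v = (ss ! i, i)" "i < length ss" by (rule vars_ofE)
  then have "ts ! i \<in> set ts" "w \<in> tm_vars (ts ! i)" using w assms(2) by auto
  then show "w \<in> (\<Union>t\<in>set ts. tm_vars t)" by blast
qed

lemma well_sorted_tsub:
  assumes "\<phi> \<in> fmlas L C ss" "list_all2 (has_sort L D) ts ss"
    "\<And>s c. s \<in> sorts L \<Longrightarrow> c \<in> C s \<Longrightarrow> has_sort L D (g c) s"
  shows "well_sorted L D (tsub K ts g \<phi>)"
  unfolding tsub_def
proof (rule well_sorted_sub[OF _ _ assms(3)])
  show "well_sorted L C \<phi>" using assms(1) by (simp add: fmlas_iff)
  fix v assume "v \<in> fv \<phi>"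
  from fmlas_fv[OF assms(1) this] obtain i where "v = (ss ! i, i)" "i < length ss" by (rule vars_ofE)
  then show "has_sort L D (case v of (s, i) \<Rightarrow> if i < length ts then ts ! i else Var (s, i + K)) (fst v)"
    using assms(2) by (auto simp: list_all2_conv_all_nth)
qed

lemma tsub_fmlas:
  assumes "\<phi> \<in> fmlas L C ss" "list_all2 (has_sort L D) ts ss"
    "\<And>t. t \<in> set ts \<Longrightarrow> tm_vars t \<subseteq> vars_of us" "\<And>c. tm_vars (g c) \<subseteq> vars_of us"
    "\<And>s c. s \<in> sorts L \<Longrightarrow> c \<in> C s \<Longrightarrow> has_sort L D (g c) s"
  shows "tsub K ts g \<phi> \<in> fmlas L D us"
proof -
  let ?\<theta> = "\<lambda>(s, i). if i < length ts then ts ! i else Var (s, i + K)"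
  have *: "has_sort L D (?\<theta> v) (fst v)" "tm_vars (?\<theta> v) \<subseteq> vars_of us" if vin: "v \<in> fv \<phi>" for v
    proof -
      obtain i where v: "v = (ss ! i, i)" "i < length ss"
        using vars_ofE fmlas_fv assms(1) vin by metis
      then show "has_sort L D (?\<theta> v) (fst v)" using assms(2) by (auto simp: list_all2_conv_all_nth)
      show "tm_vars (?\<theta> v) \<subseteq> vars_of us"
        using v assms(2) assms(3)[of "ts ! i"] by (auto simp: list_all2_conv_all_nth)
    qed
  have "fv (sub K ?\<theta> g \<phi>) \<subseteq> vars_of us" using fv_sub[of K ?\<theta> g \<phi>] *(2) assms(4) by blast
  then show ?thesis using well_sorted_tsub[OF assms(1,2,5)] by (simp add: fmlas_iff tsub_def)
qed

section \<open>Tuples of prescribed sorts\<close>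

lemma tuples_Nil [simp]: "xs \<in> tuples M [] \<longleftrightarrow> xs = []"
  by (simp add: tuples_def)

lemma tuples_Cons: "xs \<in> tuples M (s # ss) \<longleftrightarrow> (\<exists>y ys. xs = y # ys \<and> y \<in> car M s \<and> ys \<in> tuples M ss)"
  by (auto simp: tuples_def list_all2_Cons2)

lemma Cons_tuples [simp]: "x # xs \<in> tuples M (s # ss) \<longleftrightarrow> x \<in> car M s \<and> xs \<in> tuples M ss"
  by (simp add: tuples_def)

lemma bex_tuples_Cons:
  "(\<exists>xs\<in>tuples M (s # ss). P xs) \<longleftrightarrow> (\<exists>x\<in>car M s. \<exists>xs\<in>tuples M ss. P (x # xs))"
  unfolding Bex_def tuples_Cons by blast

lemma tuples_length: "xs \<in> tuples M ss \<Longrightarrow> length xs = length ss"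
  by (auto simp: tuples_def dest: list_all2_lengthD)

lemma tuples_nth: "xs \<in> tuples M ss \<Longrightarrow> i < length ss \<Longrightarrow> xs ! i \<in> car M (ss ! i)"
  by (auto simp: tuples_def list_all2_conv_all_nth)

lemma tuples_append: "length xs = length ss \<Longrightarrow>
    xs @ ys \<in> tuples M (ss @ ts) \<longleftrightarrow> xs \<in> tuples M ss \<and> ys \<in> tuples M ts"
  by (simp add: tuples_def list_all2_append)

lemma tuples_appendI: "xs \<in> tuples M ss \<Longrightarrow> ys \<in> tuples M ts \<Longrightarrow> xs @ ys \<in> tuples M (ss @ ts)"
  by (simp add: tuples_append tuples_length)

lemma tuples_appendE:
  assumes "zs \<in> tuples M (ss @ ts)"
  obtains xs ys where "zs = xs @ ys" "xs \<in> tuples M ss" "ys \<in> tuples M ts"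
  using assms by (auto simp: tuples_def list_all2_append2)

lemma tuples_replicate: "xs \<in> tuples M (replicate n s) \<longleftrightarrow> length xs = n \<and> set xs \<subseteq> car M s"
  by (auto simp: tuples_def list_all2_conv_all_nth in_set_conv_nth subset_iff)

lemma tuples_univ: "xs \<in> tuples M ss \<Longrightarrow> set ss \<subseteq> sorts L \<Longrightarrow> set xs \<subseteq> univ L M"
  by (fastforce simp: tuples_def list_all2_conv_all_nth in_set_conv_nth subset_iff univ_def)

subsection \<open>Plugging in parameters and shifting variables\<close>

lemma eval_inst_tm:
  "eval M j e (inst_tm \<sigma> t) = eval M j (\<lambda>v. case \<sigma> v of None \<Rightarrow> e v | Some c \<Rightarrow> j c) t"
  by (induction t) (auto split: option.split cong: map_cong)

lemma sat_inst:
  "sat M j e (inst \<sigma> \<phi>) \<longleftrightarrow> sat M j (\<lambda>v. case \<sigma> v of None \<Rightarrow> e v | Some c \<Rightarrow> j c) \<phi>"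
proof (induction \<phi> arbitrary: \<sigma> e)
  case (Exists v \<phi>)
  have "(\<lambda>u. case (\<sigma>(v := None)) u of None \<Rightarrow> (e(v := a)) u | Some c \<Rightarrow> j c) =
      (\<lambda>u. case \<sigma> u of None \<Rightarrow> e u | Some c \<Rightarrow> j c)(v := a)" for a
    by (auto split: option.split)
  then show ?case by (simp add: Exists.IH)
qed (auto simp: eval_inst_tm cong: map_cong)

lemma has_sort_inst_tm:
  assumes "has_sort L C t s" "\<And>s. s \<in> sorts L \<Longrightarrow> C s \<subseteq> D s"
    "\<And>v c. v \<in> tm_vars t \<Longrightarrow> \<sigma> v = Some c \<Longrightarrow> c \<in> D (fst v)"
  shows "has_sort L D (inst_tm \<sigma> t) s"
  using assms(1,3)
proof (induction rule: has_sort.induct)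
  case (1 s n)
  then show ?case by (cases "\<sigma> (s, n)") (auto intro!: has_sort.intros)
next
  case (2 s c)
  then show ?case using assms(2) by (auto intro!: has_sort.intros)
next
  case (3 f ss s ts)
  have "list_all2 (has_sort L D) (map (inst_tm \<sigma>) ts) ss"
    unfolding list_all2_conv_all_nth
  proof (intro conjI allI impI)
    show "length (map (inst_tm \<sigma>) ts) = length ss" using 3(2) by (auto dest: list_all2_lengthD)
    fix i assume i: "i < length (map (inst_tm \<sigma>) ts)"
    have "c \<in> D (fst v)" if "v \<in> tm_vars (ts ! i)" "\<sigma> v = Some c" for v c
    proof (rule 3(3)[OF _ that(2)])
      show "v \<in> tm_vars (Fun f ts)" using that(1) i by (auto intro!: bexI[of _ "ts ! i"])
    qed
    then show "has_sort L D (map (inst_tm \<sigma>) ts ! i) (ss ! i)"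
      using 3(2) i by (auto simp: list_all2_conv_all_nth)
  qed
  then show ?case using 3(1) by (auto intro: has_sort.intros)
qed

lemma well_sorted_inst:
  assumes "well_sorted L C \<phi>" "\<And>s. s \<in> sorts L \<Longrightarrow> C s \<subseteq> D s"
    "\<And>v c. v \<in> fv \<phi> \<Longrightarrow> \<sigma> v = Some c \<Longrightarrow> c \<in> D (fst v)"
  shows "well_sorted L D (inst \<sigma> \<phi>)"
  using assms(1,3)
proof (induction \<phi> arbitrary: \<sigma>)
  case (Equal t u)
  then obtain s where "has_sort L C t s" "has_sort L C u s" by auto
  moreover have "c \<in> D (fst v)" if "v \<in> tm_vars t \<union> tm_vars u" "\<sigma> v = Some c" for v c
    using Equal(2)[of v c] that by auto
  ultimately have "has_sort L D (inst_tm \<sigma> t) s" "has_sort L D (inst_tm \<sigma> u) s"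
    using assms(2) by (blast intro: has_sort_inst_tm)+
  then show ?case by auto
next
  case (Rel r ts)
  then obtain ss where ss: "rsig L r = Some ss" "list_all2 (has_sort L C) ts ss" by auto
  have "list_all2 (has_sort L D) (map (inst_tm \<sigma>) ts) ss"
    unfolding list_all2_conv_all_nth
  proof (intro conjI allI impI)
    show "length (map (inst_tm \<sigma>) ts) = length ss" using ss by (auto dest: list_all2_lengthD)
    fix i assume i: "i < length (map (inst_tm \<sigma>) ts)"
    have "c \<in> D (fst v)" if "v \<in> tm_vars (ts ! i)" "\<sigma> v = Some c" for v c
    proof (rule Rel(2)[OF _ that(2)])
      show "v \<in> fv (Rel r ts)" using that(1) i by (auto intro!: bexI[of _ "ts ! i"])
    qed
    moreover have "has_sort L C (ts ! i) (ss ! i)" using i ss(2) by (auto simp: list_all2_conv_all_nth)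
    ultimately have "has_sort L D (inst_tm \<sigma> (ts ! i)) (ss ! i)"
      using assms(2) by (blast intro: has_sort_inst_tm)
    then show "has_sort L D (map (inst_tm \<sigma>) ts ! i) (ss ! i)" using i by simp
  qed
  with ss(1) show ?case by simp
next
  case (Exists v \<phi>)
  have "well_sorted L D (inst (\<sigma>(v := None)) \<phi>)"
    by (rule Exists.IH) (use Exists.prems in \<open>auto split: if_splits\<close>)
  then show ?case using Exists.prems by simp
qed auto

lemma vars_inst_tm: "tm_vars (inst_tm \<sigma> t) = tm_vars t - dom \<sigma>"
  by (induction t) (auto split: option.splits)

lemma fv_inst: "fv (inst \<sigma> \<phi>) = fv \<phi> - dom \<sigma>"
  by (induction \<phi> arbitrary: \<sigma>) (auto simp: vars_inst_tm)

lemma plug_fmlas: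
  assumes "\<phi> \<in> fmlas L C (ss @ ts)" "\<And>s. s \<in> sorts L \<Longrightarrow> C s \<subseteq> D s"
    "list_all2 (\<lambda>b t. b \<in> D t) bs ts"
  shows "plug (length ss) bs \<phi> \<in> fmlas L D ss"
proof -
  let ?\<sigma> = "\<lambda>(s :: 'a, i). if length ss \<le> i \<and> i < length ss + length bs
    then Some (bs ! (i - length ss)) else None"
  have len: "length bs = length ts" using assms(3) by (rule list_all2_lengthD)
  have "c \<in> D (fst v)" if vc: "v \<in> fv \<phi>" "?\<sigma> v = Some c" for v c
  proof -
    obtain i where "v = ((ss @ ts) ! i, i)" "i < length (ss @ ts)"
      using fmlas_fv[OF assms(1) vc(1)] by (rule vars_ofE)
    with vc(2) assms(3) show ?thesis
      by (auto simp: list_all2_conv_all_nth nth_append split: if_splits)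
  qed
  then have 1: "well_sorted L D (inst ?\<sigma> \<phi>)"
    using assms(1,2) by (intro well_sorted_inst[of L C]) (auto simp: fmlas_iff)
  have 2: "fv (inst ?\<sigma> \<phi>) \<subseteq> vars_of ss"
  proof
    fix v assume v: "v \<in> fv (inst ?\<sigma> \<phi>)"
    then obtain i where "v = ((ss @ ts) ! i, i)" "i < length (ss @ ts)"
      using fmlas_fv[OF assms(1), of v] unfolding fv_inst by (blast elim: vars_ofE)
    with v len show "v \<in> vars_of ss"
      by (auto simp: fv_inst dom_def vars_of_def nth_append split: if_splits)
  qed
  from 1 2 show ?thesis by (simp add: fmlas_iff plug_def)
qed

lemma holds_plug:
  assumes "\<phi> \<in> fmlas L C (ss @ ts)" "length bs = length ts" "length xs = length ss"
  shows "holds M j xs (plug (length ss) bs \<phi>) \<longleftrightarrow> holds M j (xs @ map j bs) \<phi>"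
  unfolding plug_def holds_val sat_inst
proof (rule sat_cong)
  show "well_sorted L C \<phi>" using assms(1) by (simp add: fmlas_iff)
  fix v assume "v \<in> fv \<phi>"
  then obtain i where "v = ((ss @ ts) ! i, i)" "i < length (ss @ ts)"
    using fmlas_fv[OF assms(1)] by (blast elim: vars_ofE)
  then show "(case case v of (s, i) \<Rightarrow> if length ss \<le> i \<and> i < length ss + length bs
      then Some (bs ! (i - length ss)) else None of None \<Rightarrow> val xs v | Some c \<Rightarrow> j c) =
    val (xs @ map j bs) v"
    using assms(2,3) by (auto simp: nth_append)
qed auto

lemma eval_map_tm: "eval M j e (map_tm f id id t) = eval M j (\<lambda>v. e (f v)) t"
  by (induction t) (auto cong: map_cong)

lemma sat_map_fm:
  assumes "inj f" "\<And>v. fst (f v) = fst v"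
  shows "sat M j e (map_fm f id id id \<phi>) \<longleftrightarrow> sat M j (\<lambda>v. e (f v)) \<phi>"
proof (induction \<phi> arbitrary: e)
  case (Exists v \<phi>)
  have "(\<lambda>u. (e(f v := a)) (f u)) = (\<lambda>u. e (f u))(v := a)" for a
    by (simp add: fun_eq_iff inj_eq[OF assms(1)])
  then show ?case unfolding fm.map sat.simps Exists.IH assms(2) by (simp only:)
qed (auto simp: eval_map_tm cong: map_cong)

lemma has_sort_map_tm:
  assumes "has_sort L C t s" "\<And>v. fst (f v) = fst v"
  shows "has_sort L C (map_tm f id id t) s"
  using assms(1)
proof (induction rule: has_sort.induct)
  case (1 s n)
  with assms(2)[of "(s, n)"] show ?case by (cases "f (s, n)") (auto intro: has_sort.intros)
next
  case (3 f ss s ts)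
  then show ?case by (auto intro!: has_sort.intros simp: list_all2_conv_all_nth)
qed (auto intro: has_sort.intros)

lemma well_sorted_map_fm:
  assumes "\<And>v. fst (f v) = fst v"
  shows "well_sorted L C \<phi> \<Longrightarrow> well_sorted L C (map_fm f id id id \<phi>)"
proof (induction \<phi>)
  case (Equal t u)
  then obtain s where "has_sort L C t s" "has_sort L C u s" by auto
  then have "has_sort L C (map_tm f id id t) s" "has_sort L C (map_tm f id id u) s"
    by (auto intro!: has_sort_map_tm assms)
  then show ?case unfolding fm.map well_sorted.simps by blast
next
  case (Rel r ts)
  then show ?case using has_sort_map_tm[of L C _ _ f, OF _ assms]
    unfolding fm.map well_sorted.simps by (auto simp: list_all2_conv_all_nth)
qed (auto simp: assms)

lemma fv_map_fm: "inj f \<Longrightarrow> fv (map_fm f id id id \<phi>) = f ` fv \<phi>"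
  by (induction \<phi>) (auto simp: tm.set_map inj_eq image_iff)

lemma shift_fmlas:
  assumes "\<phi> \<in> fmlas L C ts"
  shows "shift (length ss) \<phi> \<in> fmlas L C (ss @ ts)"
proof -
  let ?f = "\<lambda>(s :: 'a, i). (s, length ss + i)"
  have "inj ?f" by (auto simp: inj_on_def)
  then have "fv (shift (length ss) \<phi>) = ?f ` fv \<phi>" unfolding shift_def by (rule fv_map_fm)
  also have "\<dots> \<subseteq> vars_of (ss @ ts)"
  proof (rule image_subsetI)
    fix v assume "v \<in> fv \<phi>"
    then obtain i where "v = (ts ! i, i)" "i < length ts"
      using fmlas_fv[OF assms] by (blast elim: vars_ofE)
    then show "?f v \<in> vars_of (ss @ ts)"
      by (auto simp: vars_of_def nth_append intro!: exI[of _ "length ss + i"])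
  qed
  finally show ?thesis using assms by (auto simp: fmlas_iff shift_def intro!: well_sorted_map_fm)
qed

lemma holds_shift:
  assumes "\<phi> \<in> fmlas L C ts" "length xs = n"
  shows "holds M j (xs @ ys) (shift n \<phi>) \<longleftrightarrow> holds M j ys \<phi>"
proof -
  have "holds M j (xs @ ys) (shift n \<phi>) \<longleftrightarrow> sat M j (\<lambda>v. val (xs @ ys) (case v of (s, i) \<Rightarrow> (s, n + i))) \<phi>"
    unfolding shift_def holds_val by (rule sat_map_fm) (auto simp: inj_on_def)
  also have "(\<lambda>v. val (xs @ ys) (case v of (s, i) \<Rightarrow> (s, n + i))) = val ys"
    using assms(2) by (auto simp: fun_eq_iff)
  finally show ?thesis by (simp add: holds_val)
qed

subsection \<open>Operations on formulas\<close>

lemma holds_Neg [simp]: "holds M j xs (Neg \<phi>) \<longleftrightarrow> \<not> holds M j xs \<phi>"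
  by (simp add: holds_def)

lemma holds_Conj [simp]: "holds M j xs (Conj \<phi> \<psi>) \<longleftrightarrow> holds M j xs \<phi> \<and> holds M j xs \<psi>"
  by (simp add: holds_def)

lemma fmlas_Neg [simp]: "Neg \<phi> \<in> fmlas L C ss \<longleftrightarrow> \<phi> \<in> fmlas L C ss"
  by (simp add: fmlas_iff)

lemma fmlas_Conj [simp]: "Conj \<phi> \<psi> \<in> fmlas L C ss \<longleftrightarrow> \<phi> \<in> fmlas L C ss \<and> \<psi> \<in> fmlas L C ss"
  by (auto simp: fmlas_iff)

text \<open>Formulas have no constant for truth. The empty conjunction is the valid sentence
  \<forall>x. x = x, and \<open>s\<close> is the sort of its variable.\<close>

definition conjs :: "'s \<Rightarrow> ('s, 'f, 'r, 'c) sfm list \<Rightarrow> ('s, 'f, 'r, 'c) sfm" where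
  "conjs s \<phi>s = foldr Conj \<phi>s (Neg (Exists (s, 0) (Neg (Equal (Var (s, 0)) (Var (s, 0))))))"

definition disjs :: "'s \<Rightarrow> ('s, 'f, 'r, 'c) sfm list \<Rightarrow> ('s, 'f, 'r, 'c) sfm" where
  "disjs s \<phi>s = Neg (conjs s (map Neg \<phi>s))"

lemma sat_conjs: "sat M j e (conjs s \<phi>s) \<longleftrightarrow> (\<forall>\<phi>\<in>set \<phi>s. sat M j e \<phi>)"
  by (induction \<phi>s) (auto simp: conjs_def)

lemma holds_conjs [simp]: "holds M j xs (conjs s \<phi>s) \<longleftrightarrow> (\<forall>\<phi>\<in>set \<phi>s. holds M j xs \<phi>)"
  by (simp add: holds_def sat_conjs)

lemma holds_disjs [simp]: "holds M j xs (disjs s \<phi>s) \<longleftrightarrow> (\<exists>\<phi>\<in>set \<phi>s. holds M j xs \<phi>)"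
  by (simp add: disjs_def)

lemma conjs_fmlas: "s \<in> sorts L \<Longrightarrow> set \<phi>s \<subseteq> fmlas L C ss \<Longrightarrow> conjs s \<phi>s \<in> fmlas L C ss"
  by (induction \<phi>s) (auto simp: conjs_def fmlas_iff intro!: exI[of _ s] has_sort.intros)

lemma disjs_fmlas: "s \<in> sorts L \<Longrightarrow> set \<phi>s \<subseteq> fmlas L C ss \<Longrightarrow> disjs s \<phi>s \<in> fmlas L C ss"
  unfolding disjs_def fmlas_Neg by (rule conjs_fmlas) auto

text \<open>The variable at position \<open>i\<close> moves to position \<open>\<pi> i\<close>. The
  number \<open>n\<close> has to exceed the values of \<pi>, since bound variables are raised by
  \<open>n\<close>.\<close>

definition reix :: "'s list \<Rightarrow> nat \<Rightarrow> (nat \<Rightarrow> nat) \<Rightarrow> ('s, 'f, 'r, 'c) sfm \<Rightarrow> ('s, 'f, 'r, 'c) sfm" where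
  "reix ss n \<pi> = tsub n (map (\<lambda>i. Var (ss ! i, \<pi> i)) [0..<length ss]) Par"

lemma reix_fmlas:
  assumes "\<phi> \<in> fmlas L C ss" "set us \<subseteq> sorts L"
    "\<And>i. i < length ss \<Longrightarrow> \<pi> i < length us \<and> us ! \<pi> i = ss ! i"
  shows "reix ss n \<pi> \<phi> \<in> fmlas L C us"
  unfolding reix_def
proof (rule tsub_fmlas[OF assms(1)])
  show "list_all2 (has_sort L C) (map (\<lambda>i. Var (ss ! i, \<pi> i)) [0..<length ss]) ss"
    using assms(2,3) by (auto simp: list_all2_conv_all_nth subset_iff intro!: has_sort.intros) (metis nth_mem)
  fix t assume "t \<in> set (map (\<lambda>i. Var (ss ! i, \<pi> i)) [0..<length ss])"
  then obtain i where "i < length ss" "t = Var (us ! \<pi> i, \<pi> i)" using assms(3) by auto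
  with assms(3) show "tm_vars t \<subseteq> vars_of us" by (auto simp: vars_of_def)
qed (auto intro: has_sort.intros)

lemma sat_reix:
  assumes "\<phi> \<in> fmlas L C ss" "\<And>i. i < length ss \<Longrightarrow> \<pi> i < n"
  shows "sat M j e (reix ss n \<pi> \<phi>) \<longleftrightarrow> holds M j (map (\<lambda>i. e (ss ! i, \<pi> i)) [0..<length ss]) \<phi>"
  unfolding reix_def
  by (subst sat_tsub[OF assms(1)]) (use assms(2) in \<open>auto simp: o_def\<close>)

lemma holds_reix:
  assumes "\<phi> \<in> fmlas L C ss" "\<And>i. i < length ss \<Longrightarrow> \<pi> i < n"
  shows "holds M j xs (reix ss n \<pi> \<phi>) \<longleftrightarrow> holds M j (map (\<lambda>i. xs ! \<pi> i) [0..<length ss]) \<phi>"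
  using sat_reix[where e = "val xs", OF assms] by (simp add: holds_val)

text \<open>Quantification over the first position; the remaining positions move down by one.\<close>

definition exh :: "'s \<Rightarrow> 's list \<Rightarrow> ('s, 'f, 'r, 'c) sfm \<Rightarrow> ('s, 'f, 'r, 'c) sfm" where
  "exh s ts \<phi> = Exists (s, length ts)
     (reix (s # ts) (Suc (length ts)) (\<lambda>i. if i = 0 then length ts else i - 1) \<phi>)"

lemma exh_fmlas:
  assumes "\<phi> \<in> fmlas L C (s # ts)" "set (s # ts) \<subseteq> sorts L"
  shows "exh s ts \<phi> \<in> fmlas L C ts"
proof -
  have "reix (s # ts) (Suc (length ts)) (\<lambda>i. if i = 0 then length ts else i - 1) \<phi> \<in> fmlas L C (ts @ [s])"
    by (rule reix_fmlas[OF assms(1)]) (use assms(2) in \<open>auto simp: nth_append nth_Cons'\<close>)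
  moreover have "vars_of (ts @ [s]) - {(s, length ts)} \<subseteq> vars_of ts"
    by (auto simp: vars_of_def nth_append)
  ultimately show ?thesis using assms(2) by (auto simp: fmlas_iff exh_def)
qed

lemma holds_exh:
  assumes "\<phi> \<in> fmlas L C (s # ts)" "length ys = length ts"
  shows "holds M j ys (exh s ts \<phi>) \<longleftrightarrow> (\<exists>x\<in>car M s. holds M j (x # ys) \<phi>)"
proof -
  let ?\<pi> = "\<lambda>i. if i = 0 then length ts else i - 1"
  have "sat M j ((val ys)((s, length ts) := x)) (reix (s # ts) (Suc (length ts)) ?\<pi> \<phi>) \<longleftrightarrow>
      holds M j (x # ys) \<phi>" for x
  proof -
    have "map (\<lambda>i. ((val ys)((s, length ts) := x)) ((s # ts) ! i, ?\<pi> i)) [0..<length (s # ts)] = x # ys"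
      using assms(2) by (auto simp: list_eq_iff_nth_eq nth_Cons' simp del: upt_Suc)
    then show ?thesis by (subst sat_reix[OF assms(1)]) (auto simp del: upt_Suc)
  qed
  then show ?thesis by (simp add: exh_def holds_val)
qed

primrec exhs :: "'s list \<Rightarrow> 's list \<Rightarrow> ('s, 'f, 'r, 'c) sfm \<Rightarrow> ('s, 'f, 'r, 'c) sfm" where
  "exhs [] us \<phi> = \<phi>"
| "exhs (t # ts) us \<phi> = exhs ts us (exh t (ts @ us) \<phi>)"

lemma exhs_fmlas:
  "\<phi> \<in> fmlas L C (ts @ us) \<Longrightarrow> set (ts @ us) \<subseteq> sorts L \<Longrightarrow> exhs ts us \<phi> \<in> fmlas L C us"
proof (induction ts arbitrary: \<phi>)
  case (Cons t ts)
  have "exh t (ts @ us) \<phi> \<in> fmlas L C (ts @ us)" by (rule exh_fmlas) (use Cons.prems in auto)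
  then show ?case using Cons by simp
qed simp

lemma holds_exhs:
  assumes "\<phi> \<in> fmlas L C (ts @ us)" "set (ts @ us) \<subseteq> sorts L" "length ys = length us"
  shows "holds M j ys (exhs ts us \<phi>) \<longleftrightarrow> (\<exists>xs\<in>tuples M ts. holds M j (xs @ ys) \<phi>)"
  using assms
proof (induction ts arbitrary: \<phi>)
  case (Cons t ts)
  have "holds M j ys (exhs (t # ts) us \<phi>) \<longleftrightarrow> (\<exists>xs\<in>tuples M ts. holds M j (xs @ ys) (exh t (ts @ us) \<phi>))"
    using Cons.prems by (simp add: Cons.IH exh_fmlas)
  also have "\<dots> \<longleftrightarrow> (\<exists>xs\<in>tuples M ts. \<exists>x\<in>car M t. holds M j (x # xs @ ys) \<phi>)"
    using Cons.prems by (auto simp: holds_exh tuples_length)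
  also have "\<dots> \<longleftrightarrow> (\<exists>xs\<in>tuples M (t # ts). holds M j (xs @ ys) \<phi>)"
    unfolding bex_tuples_Cons append_Cons by blast
  finally show ?case .
qed auto

text \<open>The formula \<open>\<phi>(c, y)\<close> in the variables \<open>y\<close>.\<close>

definition phd :: "'s list \<Rightarrow> 'c \<Rightarrow> ('s, 'f, 'r, 'c) sfm \<Rightarrow> ('s, 'f, 'r, 'c) sfm" where
  "phd ts c = tsub (length ts) (Par c # map (\<lambda>i. Var (ts ! i, i)) [0..<length ts]) Par"

lemma phd_fmlas:
  assumes "\<phi> \<in> fmlas L C (s # ts)" "set (s # ts) \<subseteq> sorts L" "\<And>s. s \<in> sorts L \<Longrightarrow> C s \<subseteq> D s" "c \<in> D s"
  shows "phd ts c \<phi> \<in> fmlas L D ts"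
proof -
  have "list_all2 (has_sort L D) (Par c # map (\<lambda>i. Var (ts ! i, i)) [0..<length ts]) (s # ts)"
    using assms(2,4) by (auto simp: list_all2_conv_all_nth subset_iff intro!: has_sort.intros)
      (auto simp: nth_Cons' intro!: has_sort.intros)
  then show ?thesis unfolding phd_def
    by (rule tsub_fmlas[OF assms(1)]) (use assms(3) in \<open>auto simp: vars_of_def intro!: has_sort.intros\<close>)
qed

lemma holds_phd:
  assumes "\<phi> \<in> fmlas L C (s # ts)" "length ys = length ts"
  shows "holds M j ys (phd ts c \<phi>) \<longleftrightarrow> holds M j (j c # ys) \<phi>"
proof -
  have "map (\<lambda>i. ys ! i) [0..<length ts] = ys" using assms(2) by (metis map_nth)
  then show ?thesis unfolding holds_val[of _ _ ys] phd_def
    by (subst sat_tsub[OF assms(1)]) (auto simp: o_def)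
qed

text \<open>Replacing the parameters \<open>cs\<close>, of sorts \<open>us\<close>, by new variables at the end, and any other
  parameter \<open>c\<close> by \<open>f c\<close>.\<close>

definition index_of :: "'c list \<Rightarrow> 'c \<Rightarrow> nat" where
  "index_of cs c = (LEAST k. k < length cs \<and> cs ! k = c)"

lemma index_of:
  assumes "c \<in> set cs"
  shows "index_of cs c < length cs" "cs ! index_of cs c = c"
proof -
  obtain k where "k < length cs \<and> cs ! k = c" using assms by (auto simp: in_set_conv_nth)
  then have "index_of cs c < length cs \<and> cs ! index_of cs c = c"
    unfolding index_of_def by (rule LeastI)
  then show "index_of cs c < length cs" "cs ! index_of cs c = c" by auto
qed

definition abst ::
    "'s list \<Rightarrow> 's list \<Rightarrow> 'c list \<Rightarrow> ('c \<Rightarrow> 'd) \<Rightarrow> ('s, 'f, 'r, 'c) sfm \<Rightarrow> ('s, 'f, 'r, 'd) sfm" where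
  "abst ss us cs f = tsub (length ss + length us) (map (\<lambda>i. Var (ss ! i, i)) [0..<length ss])
     (\<lambda>c. if c \<in> set cs then Var (us ! index_of cs c, length ss + index_of cs c) else Par (f c))"

lemma abst_fmlas:
  assumes "\<phi> \<in> fmlas L C ss" "set (ss @ us) \<subseteq> sorts L" "length us = length cs"
    and "\<And>s c. s \<in> sorts L \<Longrightarrow> c \<in> C s \<Longrightarrow> c \<in> set cs \<Longrightarrow> us ! index_of cs c = s"
    and "\<And>s c. s \<in> sorts L \<Longrightarrow> c \<in> C s \<Longrightarrow> c \<notin> set cs \<Longrightarrow> f c \<in> D s"
  shows "abst ss us cs f \<phi> \<in> fmlas L D (ss @ us)"
  unfolding abst_def
proof (rule tsub_fmlas[OF assms(1)])
  show "list_all2 (has_sort L D) (map (\<lambda>i. Var (ss ! i, i)) [0..<length ss]) ss"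
    using assms(2) by (auto simp: list_all2_conv_all_nth subset_iff intro!: has_sort.intros)
  fix t assume "t \<in> set (map (\<lambda>i. Var (ss ! i, i)) [0..<length ss])"
  then show "tm_vars t \<subseteq> vars_of (ss @ us)" by (force simp: vars_of_def nth_append)
next
  fix c
  show "tm_vars (if c \<in> set cs then Var (us ! index_of cs c, length ss + index_of cs c) else Par (f c))
      \<subseteq> vars_of (ss @ us)"
    using index_of[of c cs] assms(3) by (auto simp: vars_of_def nth_append intro!: exI[of _ "length ss + index_of cs c"])
next
  fix s c assume "s \<in> sorts L" "c \<in> C s"
  then show "has_sort L D
      (if c \<in> set cs then Var (us ! index_of cs c, length ss + index_of cs c) else Par (f c)) s"
    using assms(4,5) by (auto intro: has_sort.intros)
qed

lemma holds_abst:
  assumes "\<phi> \<in> fmlas L C ss" "length us = length cs" "length xs = length ss"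
  shows "holds M j (xs @ zs) (abst ss us cs f \<phi>) \<longleftrightarrow>
    holds M (\<lambda>c. if c \<in> set cs then zs ! index_of cs c else j (f c)) xs \<phi>"
proof -
  have *: "eval M j (val (xs @ zs))
      (if c \<in> set cs then Var (us ! index_of cs c, length ss + index_of cs c) else Par (f c)) =
    (if c \<in> set cs then zs ! index_of cs c else j (f c))" for c
    using assms(3) by (simp add: nth_append)
  have "map (\<lambda>i. (xs @ zs) ! i) [0..<length ss] = xs"
    unfolding assms(3)[symmetric] by (rule nth_equalityI) (simp_all add: nth_append)
  then have **: "map (eval M j (val (xs @ zs))) (map (\<lambda>i. Var (ss ! i, i)) [0..<length ss]) = xs"
    by (simp add: o_def)
  show ?thesis unfolding holds_val[of _ _ "xs @ zs"] abst_def
    by (subst sat_tsub[OF assms(1)], unfold * **)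
      (use assms(2) index_of(1) in \<open>auto split: if_splits\<close>)
qed

text \<open>The formula \<open>\<psi>(z\<^sub>i, y)\<close> in the variables \<open>y\<close>, followed by \<open>z\<^sub>0, \<dots>, z\<^sub>n\<^sub>-\<^sub>1\<close> of sort \<open>s\<close>.\<close>

definition sel :: "'s \<Rightarrow> 's list \<Rightarrow> nat \<Rightarrow> nat \<Rightarrow> ('s, 'f, 'r, 'c) sfm \<Rightarrow> ('s, 'f, 'r, 'c) sfm" where
  "sel s ts n i = reix (s # ts) (length ts + n) (\<lambda>k. if k = 0 then length ts + i else k - 1)"

lemma sel_fmlas:
  assumes "\<psi> \<in> fmlas L C (s # ts)" "set (s # ts) \<subseteq> sorts L" "i < n"
  shows "sel s ts n i \<psi> \<in> fmlas L C (ts @ replicate n s)"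
  using assms unfolding sel_def by (intro reix_fmlas) (auto simp: nth_append nth_Cons')

lemma holds_sel:
  assumes "\<psi> \<in> fmlas L C (s # ts)" "length ys = length ts" "length zs = n" "i < n"
  shows "holds M j (ys @ zs) (sel s ts n i \<psi>) \<longleftrightarrow> holds M j (zs ! i # ys) \<psi>"
proof -
  have "map (\<lambda>k. (ys @ zs) ! (if k = 0 then length ts + i else k - 1)) [0..<length (s # ts)] = zs ! i # ys"
    using assms(2,3,4) by (auto simp: list_eq_iff_nth_eq nth_append nth_Cons' simp del: upt_Suc)
  then show ?thesis
    using assms unfolding sel_def by (subst holds_reix) auto
qed

definition every :: "'s \<Rightarrow> 's list \<Rightarrow> nat \<Rightarrow> ('s, 'f, 'r, 'c) sfm \<Rightarrow> ('s, 'f, 'r, 'c) sfm" where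
  "every s ts n \<psi> = conjs s (map (\<lambda>i. sel s ts n i \<psi>) [0..<n])"

lemma every_fmlas:
  assumes "\<psi> \<in> fmlas L C (s # ts)" "set (s # ts) \<subseteq> sorts L"
  shows "every s ts n \<psi> \<in> fmlas L C (ts @ replicate n s)"
  unfolding every_def by (rule conjs_fmlas) (use assms sel_fmlas[OF assms] in auto)

lemma holds_every:
  assumes "\<psi> \<in> fmlas L C (s # ts)" "length ys = length ts" "length zs = n"
  shows "holds M j (ys @ zs) (every s ts n \<psi>) \<longleftrightarrow> (\<forall>z\<in>set zs. holds M j (z # ys) \<psi>)"
proof -
  have "holds M j (ys @ zs) (every s ts n \<psi>) \<longleftrightarrow> (\<forall>i<n. holds M j (ys @ zs) (sel s ts n i \<psi>))"
    unfolding every_def holds_conjs set_map set_upt ball_simps by (simp add: Ball_def)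
  also have "\<dots> \<longleftrightarrow> (\<forall>i<n. holds M j (zs ! i # ys) \<psi>)"
    by (intro all_cong) (simp add: holds_sel[OF assms])
  finally show ?thesis by (simp add: all_set_conv_all_nth assms(3))
qed

lemma holds_append:
  assumes "\<phi> \<in> fmlas L C ss" "length xs = length ss"
  shows "holds M j (xs @ ys) \<phi> \<longleftrightarrow> holds M j xs \<phi>"
  by (rule holds_cong[OF assms(1)]) (simp_all add: assms(2) nth_append)

section \<open>Saturated structures\<close>

text \<open>Disjoint carriers give each parameter a unique sort, which is needed when it is replaced
  by a variable. The home structure, its structure of imaginaries and the larger model all become
  instances.\<close>

locale sat_structure =
  fixes L :: "('s, 'f, 'r) lang" and \<kappa> :: "'k rel" and M :: "('s, 'f, 'r, 'a) struc"
  assumes disj: "s \<in> sorts L \<Longrightarrow> t \<in> sorts L \<Longrightarrow> x \<in> car M s \<Longrightarrow> x \<in> car M t \<Longrightarrow> s = t"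
    and card: "Card_order \<kappa>" "natLeq <o \<kappa>"
    and sat: "saturated L \<kappa> M"
begin

abbreviation "U \<equiv> univ L M"
abbreviation "FO A ss \<equiv> fmlas_over L M A ss"

lemma carU: "s \<in> sorts L \<Longrightarrow> car M s \<subseteq> U"
  by (auto simp: univ_def)

lemma tuplesU: "xs \<in> tuples M ss \<Longrightarrow> set ss \<subseteq> sorts L \<Longrightarrow> set xs \<subseteq> U"
  by (rule tuples_univ)

lemma infinite_Field: "\<not> finite (Field \<kappa>)"
proof -
  have "natLeq \<le>o |Field \<kappa>|"
    using ordLess_imp_ordLeq[OF card(2)] ordIso_symmetric[OF card_of_Field_ordIso[OF card(1)]]
    by (rule ordLeq_ordIso_trans)
  then show ?thesis using infinite_iff_natLeq_ordLeq by blast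
qed

text \<open>As \<kappa> is uncountable, a whole Morley sequence of length \<omega> may serve as a
  set of parameters.\<close>

lemma small_nat: "small \<kappa> (f ` (X :: nat set))"
proof -
  have "|f ` X| \<le>o |X|" by (rule card_of_image)
  moreover have "|X| \<le>o |UNIV :: nat set|" by (rule card_of_mono1) simp
  ultimately have "|f ` X| \<le>o natLeq"
    using card_of_nat ordLeq_transitive ordLeq_ordIso_trans by blast
  then show ?thesis unfolding small_def using card(2) by (rule ordLeq_ordLess_trans)
qed

lemma small_finite: "finite A \<Longrightarrow> small \<kappa> A"
proof -
  assume "finite A"
  then obtain f :: "nat \<Rightarrow> 'b" and n where "A = f ` {i. i < n}"
    using finite_imp_nat_seg_image_inj_on by blast
  then show ?thesis using small_nat by simp
qed

lemma small_Un: "small \<kappa> A \<Longrightarrow> small \<kappa> B \<Longrightarrow> small \<kappa> (A \<union> B)"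
  unfolding small_def using card_of_Un_ordLess_infinite_Field infinite_Field card(1) by blast

lemma FO_mono: "\<phi> \<in> FO A ss \<Longrightarrow> A \<subseteq> B \<Longrightarrow> \<phi> \<in> FO B ss"
  unfolding fmlas_over_def by (erule fmlas_mono) blast

lemma FO_U: "\<phi> \<in> FO A ss \<Longrightarrow> \<phi> \<in> FO U ss"
  unfolding fmlas_over_def by (erule fmlas_mono) (use carU in blast)

lemma FO_append: "\<phi> \<in> FO A ss \<Longrightarrow> \<phi> \<in> FO A (ss @ ts)"
  unfolding fmlas_over_def by (rule fmlas_append)

lemma FO_Neg [simp]: "Neg \<phi> \<in> FO A ss \<longleftrightarrow> \<phi> \<in> FO A ss"
  by (simp add: fmlas_over_def)

lemma FO_Conj [simp]: "Conj \<phi> \<psi> \<in> FO A ss \<longleftrightarrow> \<phi> \<in> FO A ss \<and> \<psi> \<in> FO A ss"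
  by (simp add: fmlas_over_def)

lemma FO_conjs: "s \<in> sorts L \<Longrightarrow> set \<phi>s \<subseteq> FO A ss \<Longrightarrow> conjs s \<phi>s \<in> FO A ss"
  unfolding fmlas_over_def by (rule conjs_fmlas)

lemma FO_disjs: "s \<in> sorts L \<Longrightarrow> set \<phi>s \<subseteq> FO A ss \<Longrightarrow> disjs s \<phi>s \<in> FO A ss"
  unfolding fmlas_over_def by (rule disjs_fmlas)

text \<open>A formula over the whole model thereby becomes a formula over a small set, where
  saturation and strong regularity apply.\<close>

lemma FO_finite:
  assumes "\<phi> \<in> FO B ss"
  obtains P where "finite P" "P \<subseteq> B" "P \<subseteq> U" "\<phi> \<in> FO P ss"
proof -
  obtain P where P: "finite P" "\<phi> \<in> fmlas L (\<lambda>s. (car M s \<inter> B) \<inter> P) ss"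
    using assms fmlas_finite_params unfolding fmlas_over_def by blast
  have "\<phi> \<in> fmlas L (\<lambda>s. car M s \<inter> (P \<inter> B \<inter> U)) ss"
    using P(2) by (rule fmlas_mono) (use carU in blast)
  with P(1) show ?thesis by (intro that[of "P \<inter> B \<inter> U"]) (auto simp: fmlas_over_def)
qed

lemma FO_plug:
  assumes "\<phi> \<in> FO B (ss @ ts)" "bs \<in> tuples M ts"
  shows "plug (length ss) bs \<phi> \<in> FO (B \<union> set bs) ss"
  unfolding fmlas_over_def
proof (rule plug_fmlas)
  show "\<phi> \<in> fmlas L (\<lambda>s. car M s \<inter> B) (ss @ ts)" using assms(1) by (simp add: fmlas_over_def)
  show "list_all2 (\<lambda>b t. b \<in> car M t \<inter> (B \<union> set bs)) bs ts"
    using assms(2) by (auto simp: tuples_def list_all2_conv_all_nth)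
qed auto

lemma holds_plug_id:
  assumes "\<phi> \<in> FO B (ss @ ts)" "bs \<in> tuples M ts" "length xs = length ss"
  shows "holds M id xs (plug (length ss) bs \<phi>) \<longleftrightarrow> holds M id (xs @ bs) \<phi>"
  using holds_plug[of \<phi> L _ ss ts bs xs M id] assms by (simp add: fmlas_over_def tuples_length)

text \<open>The indices remember how each formula arose, which a bare set of formulas does not; the
  uses index by pairs or by an option type.\<close>

lemma realize_family:
  assumes "A \<subseteq> U" "small \<kappa> A" "set ss \<subseteq> sorts L" "\<And>i. i \<in> I \<Longrightarrow> \<Phi> i \<in> FO A ss"
    and "\<And>F. finite F \<Longrightarrow> F \<subseteq> I \<Longrightarrow> \<exists>xs\<in>tuples M ss. \<forall>i\<in>F. holds M id xs (\<Phi> i)"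
  shows "\<exists>xs\<in>tuples M ss. \<forall>i\<in>I. holds M id xs (\<Phi> i)"
proof -
  have "finitely_satisfiable M ss (\<Phi> ` I)"
    unfolding finitely_satisfiable_def
  proof (intro allI impI)
    fix F assume "finite F \<and> F \<subseteq> \<Phi> ` I"
    then obtain J where "J \<subseteq> I" "finite J" "F = \<Phi> ` J" using finite_subset_image by metis
    then show "\<exists>xs\<in>tuples M ss. realizes M id xs F"
      using assms(5) by (fastforce simp: realizes_def)
  qed
  moreover have "\<Phi> ` I \<subseteq> FO A ss" using assms(4) by blast
  ultimately have "\<exists>xs\<in>tuples M ss. realizes M id xs (\<Phi> ` I)"
    using sat assms(1,2,3) unfolding saturated_def by blast
  then show ?thesis by (simp add: realizes_def)
qed

text \<open>Invariance over \<open>A\<close> controls only formulas over \<open>A\<close>.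
  Parameters from elsewhere are moved into the tuple of variables, where they are treated like any
  other tuple.\<close>

lemma abstract_params:
  assumes "\<phi> \<in> FO U ss" "set ss \<subseteq> sorts L"
  obtains us cs \<phi>' where "set us \<subseteq> sorts L" "cs \<in> tuples M us" "\<phi>' \<in> FO {} (ss @ us)"
    "\<And>xs. length xs = length ss \<Longrightarrow> holds M id (xs @ cs) \<phi>' \<longleftrightarrow> holds M id xs \<phi>"
proof -
  obtain P where P: "finite P" "P \<subseteq> U" "\<phi> \<in> FO P ss" using FO_finite[OF assms(1)] by metis
  obtain cs where cs: "set cs = P" using finite_list[OF P(1)] by blast
  have "\<forall>c\<in>set cs. \<exists>u. u \<in> sorts L \<and> c \<in> car M u" using cs P(2) by (auto simp: univ_def)
  then obtain u where u: "\<And>c. c \<in> set cs \<Longrightarrow> u c \<in> sorts L \<and> c \<in> car M (u c)" by metis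
  let ?us = "map u cs"
  have \<phi>: "\<phi> \<in> fmlas L (\<lambda>s. car M s \<inter> P) ss" using P(3) by (simp add: fmlas_over_def)
  show ?thesis
  proof (rule that[of ?us cs "abst ss ?us cs id \<phi>"])
    show "set ?us \<subseteq> sorts L" using u by auto
    show "cs \<in> tuples M ?us" using u by (auto simp: tuples_def list_all2_conv_all_nth)
    show "abst ss ?us cs id \<phi> \<in> FO {} (ss @ ?us)"
      unfolding fmlas_over_def
    proof (rule abst_fmlas[OF \<phi>])
      fix s c assume "s \<in> sorts L" "c \<in> car M s \<inter> P" "c \<in> set cs"
      \<comment> \<open>\<open>u c\<close> is some sort containing \<open>c\<close>; disjointness of
        the carriers makes it the sort at which \<open>c\<close> is used.\<close>
      then show "?us ! index_of cs c = s" using index_of[of c cs] u[of c] disj by auto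
    qed (use assms(2) u cs in auto)
    fix xs :: "'a list" assume "length xs = length ss"
    then have "holds M id (xs @ cs) (abst ss ?us cs id \<phi>) \<longleftrightarrow>
        holds M (\<lambda>c. if c \<in> set cs then cs ! index_of cs c else id (id c)) xs \<phi>"
      by (intro holds_abst[OF \<phi>]) auto
    also have "(\<lambda>c. if c \<in> set cs then cs ! index_of cs c else id (id c)) = id"
      using index_of(2) by fastforce
    finally show "holds M id (xs @ cs) (abst ss ?us cs id \<phi>) \<longleftrightarrow> holds M id xs \<phi>" .
  qed
qed

lemma sel_FO:
  assumes "\<psi> \<in> FO A (s # ts)" "set (s # ts) \<subseteq> sorts L" "i < n"
  shows "sel s ts n i \<psi> \<in> FO A (ts @ replicate n s)"
  using assms unfolding fmlas_over_def by (rule sel_fmlas)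

lemma every_FO:
  assumes "\<psi> \<in> FO A (s # ts)" "set (s # ts) \<subseteq> sorts L"
  shows "every s ts n \<psi> \<in> FO A (ts @ replicate n s)"
  using assms unfolding fmlas_over_def by (rule every_fmlas)

subsection \<open>Global types\<close>

context
  fixes ss p
  assumes gt: "global_type L M ss p"
begin

lemma gt_sorts: "set ss \<subseteq> sorts L"
  using gt by (simp add: global_type_def)

lemma gt_FO: "\<phi> \<in> p \<Longrightarrow> \<phi> \<in> FO U ss"
  using gt by (auto simp: global_type_def)

lemma gt_realize: "finite F \<Longrightarrow> F \<subseteq> p \<Longrightarrow> \<exists>xs\<in>tuples M ss. \<forall>\<phi>\<in>F. holds M id xs \<phi>"
  using gt unfolding global_type_def finitely_satisfiable_def realizes_def by blast

lemma gt_closed: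
  assumes "finite F" "F \<subseteq> p" "\<phi> \<in> FO U ss"
    "\<And>xs. xs \<in> tuples M ss \<Longrightarrow> \<forall>\<phi>\<in>F. holds M id xs \<phi> \<Longrightarrow> holds M id xs \<phi>"
  shows "\<phi> \<in> p"
proof (rule ccontr)
  assume "\<phi> \<notin> p"
  with gt assms(3) have "Neg \<phi> \<in> p" by (auto simp: global_type_def)
  with gt_realize[of "insert (Neg \<phi>) F"] assms(1,2,4) show False by fastforce
qed

lemma gt_Neg: "\<phi> \<in> FO U ss \<Longrightarrow> Neg \<phi> \<in> p \<longleftrightarrow> \<phi> \<notin> p"
  using gt gt_realize[of "{\<phi>, Neg \<phi>}"] by (auto simp: global_type_def)

lemma gt_mono:
  assumes "\<psi> \<in> p" "\<phi> \<in> FO U ss" "\<And>xs. xs \<in> tuples M ss \<Longrightarrow> holds M id xs \<psi> \<Longrightarrow> holds M id xs \<phi>"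
  shows "\<phi> \<in> p"
  by (rule gt_closed[of "{\<psi>}"]) (use assms in auto)

lemma gt_conjs: "s \<in> sorts L \<Longrightarrow> set \<phi>s \<subseteq> p \<Longrightarrow> conjs s \<phi>s \<in> p"
  by (rule gt_closed[of "set \<phi>s"]) (auto intro!: FO_conjs intro: gt_FO)

lemma gt_equiv:
  assumes "\<phi> \<in> FO U ss" "\<psi> \<in> FO U ss" "\<And>xs. xs \<in> tuples M ss \<Longrightarrow> holds M id xs \<phi> \<longleftrightarrow> holds M id xs \<psi>"
  shows "\<phi> \<in> p \<longleftrightarrow> \<psi> \<in> p"
  using gt_mono assms by meson

lemma gt_realize_small:
  assumes "B \<subseteq> U" "small \<kappa> B"
  shows "\<exists>xs\<in>tuples M ss. realizes M id xs (restrict_type L M ss p B)"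
proof -
  have "\<exists>xs\<in>tuples M ss. \<forall>\<phi>\<in>restrict_type L M ss p B. holds M id xs \<phi>"
    by (rule realize_family[OF assms gt_sorts]) (use gt_realize in \<open>auto simp: restrict_type_def\<close>)
  then show ?thesis by (simp add: realizes_def)
qed

end

end

lemma sat_structureI:
  assumes "is_structure L M" "Card_order \<kappa>" "natLeq <o \<kappa>" "saturated L \<kappa> M"
  shows "sat_structure L \<kappa> M"
  using assms by unfold_locales (auto simp: is_structure_def)

section \<open>Generically stable types\<close>

text \<open>This is the order type \<omega> + \<omega>, with the copy tagged \<open>False\<close>
  first. It is the length of a Morley sequence on whose first half a formula holds and on whose
  second half it fails.\<close>

lemma Well_order_bool_nat: "Well_order {((b, i), (c, k)). (b :: bool) < c \<or> b = c \<and> (i :: nat) \<le> k}"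
  (is "Well_order ?W")
proof -
  have F: "Field ?W = UNIV" by (auto simp: Field_def)
  have "?W - Id \<subseteq> inv_image (less_than <*lex*> less_than) (\<lambda>(b, i). (of_bool b, i))"
    by auto
  then have "wf (?W - Id)" by (rule wf_subset[rotated]) auto
  moreover have "Linear_order ?W"
    unfolding F by (auto simp: order_on_defs refl_on_def trans_def antisym_def total_on_def)
  ultimately show ?thesis by (simp add: well_order_on_def)
qed

locale gs_type = sat_structure L \<kappa> M
  for L :: "('s, 'f, 'r) lang" and \<kappa> :: "'k rel" and M :: "('s, 'f, 'r, 'a) struc" +
  fixes s :: 's and p :: "('s, 'f, 'r, 'a) sfm set" and A :: "'a set"
  assumes gt: "global_type L M [s] p"
    and nonalg: "\<not> algebraic M [s] p"
    and A: "A \<subseteq> univ L M" "small \<kappa> A"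
    and inv: "invariant_over L M [s] p A"
    and stable: "\<And>(r :: 'a list rel) a \<phi>. Well_order r \<Longrightarrow> infinite (Field r) \<Longrightarrow>
      morley_sequence L M [s] p A r a \<Longrightarrow> \<phi> \<in> fmlas_over L M (univ L M) [s] \<Longrightarrow>
      finite {i \<in> Field r. holds M id (a i) \<phi>} \<or> finite {i \<in> Field r. \<not> holds M id (a i) \<phi>}"
begin

lemma s_sort: "s \<in> sorts L"
  using gt_sorts[OF gt] by simp

definition rlz :: "'a set \<Rightarrow> 'a \<Rightarrow> bool" where
  "rlz B x \<longleftrightarrow> x \<in> car M s \<and> realizes M id [x] (restrict_type L M [s] p B)"

lemma rlz_car: "rlz B x \<Longrightarrow> x \<in> car M s"
  by (simp add: rlz_def)

lemma rlz_ex: "B \<subseteq> U \<Longrightarrow> small \<kappa> B \<Longrightarrow> \<exists>x. rlz B x"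
  using gt_realize_small[OF gt, of B] by (auto simp: rlz_def tuples_Cons)

lemma rlz_mono: "rlz C x \<Longrightarrow> B \<subseteq> C \<Longrightarrow> rlz B x"
  using FO_mono by (auto simp: rlz_def realizes_def restrict_type_def)

lemma rlz_iff:
  assumes "rlz B x" "\<phi> \<in> FO B [s]"
  shows "holds M id [x] \<phi> \<longleftrightarrow> \<phi> \<in> p"
proof -
  have *: "holds M id [x] \<psi>" if "\<psi> \<in> p" "\<psi> \<in> FO B [s]" for \<psi>
    using assms(1) that by (auto simp: rlz_def realizes_def restrict_type_def)
  show ?thesis using *[of \<phi>] *[of "Neg \<phi>"] assms(2) gt_Neg[OF gt FO_U[OF assms(2)]] by auto
qed

lemma plug_FO:
  assumes "\<rho> \<in> FO B (s # ts)" "c \<in> tuples M ts"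
  shows "plug (Suc 0) c \<rho> \<in> FO (B \<union> set c) [s]"
  using FO_plug[of \<rho> B "[s]" ts c] assms by simp

lemma holds_plug1:
  assumes "\<rho> \<in> FO B (s # ts)" "c \<in> tuples M ts"
  shows "holds M id [x] (plug (Suc 0) c \<rho>) \<longleftrightarrow> holds M id (x # c) \<rho>"
  using holds_plug_id[of \<rho> B "[s]" ts c "[x]"] assms by simp

lemma rlz_plug:
  assumes "rlz B x" "\<rho> \<in> FO B (s # ts)" "c \<in> tuples M ts" "set c \<subseteq> B"
  shows "holds M id (x # c) \<rho> \<longleftrightarrow> plug (Suc 0) c \<rho> \<in> p"
  using rlz_iff[OF assms(1), of "plug (Suc 0) c \<rho>"] plug_FO[OF assms(2,3)] assms(4)
    holds_plug1[OF assms(2,3)] by (simp add: Un_absorb2)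

lemma plug_Neg_in:
  assumes "\<rho> \<in> FO U (s # ts)" "c \<in> tuples M ts" "set ts \<subseteq> sorts L"
  shows "plug (Suc 0) c (Neg \<rho>) \<in> p \<longleftrightarrow> plug (Suc 0) c \<rho> \<notin> p"
proof -
  have "plug (Suc 0) c \<rho> \<in> FO U [s]"
    using FO_U[OF plug_FO[OF assms(1,2)]] .
  then show ?thesis using gt_Neg[OF gt] by (simp add: plug_def)
qed

text \<open>Otherwise the formula \<open>x = c\<close>, with \<open>c\<close> the element itself,
  would be over \<open>B\<close> and hence in \<open>p\<close>, which would make \<open>p\<close>
  algebraic. It follows that Morley sequences have no repetitions.\<close>

lemma rlz_notin:
  assumes "rlz B x" "B \<subseteq> U"
  shows "x \<notin> B"
proof
  assume "x \<in> B"
  let ?e = "Equal (Var (s, 0)) (Par x)"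
  have "?e \<in> FO B [s]"
    using s_sort rlz_car[OF assms(1)] \<open>x \<in> B\<close>
    by (auto simp: fmlas_over_def fmlas_iff vars_of_def intro!: exI[of _ s] has_sort.intros)
  then have "?e \<in> p" using rlz_iff[OF assms(1), of ?e] by (simp add: holds_def)
  moreover have "{xs \<in> tuples M [s]. holds M id xs ?e} \<subseteq> {[x]}"
    by (auto simp: holds_def tuples_Cons)
  ultimately show False using nonalg finite_subset unfolding algebraic_def by blast
qed

subsection \<open>Morley sequences\<close>

text \<open>Finite Morley sequences are lists whose newest element is the head.\<close>

primrec mor :: "'a set \<Rightarrow> 'a list \<Rightarrow> bool" where
  "mor B [] \<longleftrightarrow> True"
| "mor B (x # es) \<longleftrightarrow> mor B es \<and> rlz (B \<union> set es) x"

lemma mor_tuples: "mor B es \<Longrightarrow> es \<in> tuples M (replicate (length es) s)"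
  by (induction es) (auto dest: rlz_car)

lemma mor_car: "mor B es \<Longrightarrow> set es \<subseteq> car M s"
  by (induction es) (auto dest: rlz_car)

lemma mor_mono: "mor C es \<Longrightarrow> B \<subseteq> C \<Longrightarrow> mor B es"
  by (induction es) (auto elim!: rlz_mono)

lemma mor_append: "mor B (ds @ es) \<longleftrightarrow> mor B es \<and> mor (B \<union> set es) ds"
  by (induction ds) (auto simp: Un_ac)

lemma mor_take: "mor B es \<Longrightarrow> mor B (take n es)"
proof (induction es arbitrary: n)
  case (Cons x es)
  then show ?case by (cases n) (auto elim!: rlz_mono dest: in_set_takeD)
qed simp

lemma mor_subseqs: "mor B es \<Longrightarrow> fs \<in> set (subseqs es) \<Longrightarrow> mor B fs \<and> set fs \<subseteq> set es"
proof (induction es arbitrary: fs)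
  case (Cons x es)
  show ?case
  proof (cases "fs \<in> set (subseqs es)")
    case True
    then show ?thesis using Cons by auto
  next
    case False
    then obtain gs where gs: "fs = x # gs" "gs \<in> set (subseqs es)"
      using Cons.prems(2) by (auto simp: Let_def)
    then have "mor B gs" "set gs \<subseteq> set es" using Cons by auto
    moreover have "rlz (B \<union> set gs) x"
      using Cons.prems(1) \<open>set gs \<subseteq> set es\<close> by (auto elim!: rlz_mono)
    ultimately show ?thesis using gs by auto
  qed
qed simp

lemma mor_sequence:
  assumes "B \<subseteq> U" "small \<kappa> B"
  shows "\<exists>e :: nat \<Rightarrow> 'a. \<forall>i. rlz (B \<union> e ` {..<i}) (e i)"
proof -
  \<comment> \<open>The next element depends on all earlier ones, so the recursion produces the list
    of elements found so far, newest first; \<open>e n\<close> is the head of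
    \<open>f (Suc n)\<close>.\<close>
  define f where "f = rec_nat [] (\<lambda>_ es. (SOME x. rlz (B \<union> set es) x) # es)"
  have f_Suc: "f (Suc n) = (SOME x. rlz (B \<union> set (f n)) x) # f n" for n
    by (simp add: f_def)
  have f: "mor B (f n) \<and> rlz (B \<union> set (f n)) (SOME x. rlz (B \<union> set (f n)) x)" for n
  proof (induction n)
    case 0
    have "\<exists>x. rlz B x" using assms by (rule rlz_ex)
    then show ?case by (simp add: f_def someI_ex)
  next
    case (Suc n)
    then have m: "mor B (f (Suc n))" by (simp add: f_Suc)
    then have "set (f (Suc n)) \<subseteq> U" using mor_car carU[OF s_sort] by blast
    then have "\<exists>x. rlz (B \<union> set (f (Suc n))) x"
      using assms by (intro rlz_ex small_Un small_finite[OF finite_set]) auto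
    then show ?case using m by (simp add: someI_ex)
  qed
  define e where "e n = hd (f (Suc n))" for n
  have e_eq: "e n = (SOME x. rlz (B \<union> set (f n)) x)" for n
    by (simp add: e_def f_Suc)
  have "set (f n) = e ` {..<n}" for n
  proof (induction n)
    case 0
    show ?case by (simp add: f_def)
  next
    case (Suc n)
    have "set (f (Suc n)) = insert (e n) (set (f n))" by (simp add: f_Suc e_eq)
    then show ?case by (simp add: Suc lessThan_Suc)
  qed
  then have "rlz (B \<union> e ` {..<n}) (e n)" for n
    using f[of n] unfolding e_eq[of n] by simp
  then show ?thesis by blast
qed

lemma mor_map_rev:
  assumes "\<And>i. rlz (B \<union> e ` {..<i}) (e i)"
  shows "mor B (map e (rev [0..<n]))"
  by (induction n) (use assms in \<open>auto simp: atLeast0LessThan\<close>)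

lemma mor_ex:
  assumes "B \<subseteq> U" "small \<kappa> B"
  obtains es where "mor B es" "length es = n"
proof -
  obtain e :: "nat \<Rightarrow> 'a" where "\<And>i. rlz (B \<union> e ` {..<i}) (e i)" using mor_sequence[OF assms] by blast
  then have "mor B (map e (rev [0..<n]))" by (rule mor_map_rev)
  then show ?thesis by (rule that) simp
qed

text \<open>The tails have the same type over \<open>A\<close> by induction, so by invariance
  \<open>p\<close> contains \<rho> at one tail iff it does at the other. The heads realize
  \<open>p\<close> over \<open>A\<close> and their tails, so this membership decides \<rho>.\<close>

lemma mor_same_type:
  assumes "mor A es" "mor A fs" "length es = length fs" "\<rho> \<in> FO A (replicate (length es) s)"
  shows "holds M id es \<rho> \<longleftrightarrow> holds M id fs \<rho>"
  using assms
proof (induction es arbitrary: fs \<rho>)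
  case (Cons x es)
  then obtain y gs where fs: "fs = y # gs" by (cases fs) auto
  let ?ts = "replicate (length es) s"
  have \<rho>: "\<rho> \<in> FO A (s # ?ts)" using Cons.prems(4) by (simp only: list.size replicate_Suc add_Suc_right add_0_right)
  have t: "es \<in> tuples M ?ts" "gs \<in> tuples M ?ts"
    using Cons.prems fs mor_tuples[of A es] mor_tuples[of A gs] by auto
  have "same_type L M A ?ts es gs"
    unfolding same_type_def
  proof
    fix \<phi> assume "\<phi> \<in> FO A ?ts"
    with Cons.prems fs show "holds M id es \<phi> \<longleftrightarrow> holds M id gs \<phi>" by (intro Cons.IH) auto
  qed
  then have "plug (length [s]) es \<rho> \<in> p \<longleftrightarrow> plug (length [s]) gs \<rho> \<in> p"
    using inv t \<rho> s_sort unfolding invariant_over_def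
    by (metis append_Cons append_Nil in_set_replicate subsetI)
  moreover have "holds M id (x # es) \<rho> \<longleftrightarrow> plug (Suc 0) es \<rho> \<in> p"
    by (rule rlz_plug[of "A \<union> set es"]) (use Cons.prems t \<rho> in \<open>auto intro: FO_mono\<close>)
  moreover have "holds M id (y # gs) \<rho> \<longleftrightarrow> plug (Suc 0) gs \<rho> \<in> p"
    by (rule rlz_plug[of "A \<union> set gs"]) (use Cons.prems fs t \<rho> in \<open>auto intro: FO_mono\<close>)
  ultimately show ?case using fs by (simp add: id_def)
qed simp

subsection \<open>Definability by majority\<close>

text \<open>In \<open>ds @ es\<close> the elements of \<open>ds\<close> come later. If \<psi>(x, c)
  could hold on arbitrarily long \<open>es\<close> and fail on equally long \<open>ds\<close>,
  compactness would give one \<open>c\<close> for which it holds on \<omega> elements and fails on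
  the next \<omega>, against generic stability.\<close>

lemma no_long_alternation:
  assumes \<psi>: "\<psi> \<in> FO A (s # ts)" and ts: "set ts \<subseteq> sorts L"
  shows "\<exists>n. \<forall>ds es c. mor A (ds @ es) \<longrightarrow> n \<le> length ds \<longrightarrow> n \<le> length es \<longrightarrow> c \<in> tuples M ts \<longrightarrow>
    (\<forall>z\<in>set es. holds M id (z # c) \<psi>) \<longrightarrow> (\<exists>z\<in>set ds. holds M id (z # c) \<psi>)"
proof (rule ccontr)
  assume contra: "\<not> ?thesis"
  \<comment> \<open>\<open>d\<close> is built over all of \<open>e\<close>, so that \<open>e\<close>
    followed by \<open>d\<close> is a Morley sequence of order type \<omega> + \<omega>. It is fixed
    before \<open>c\<close> is known.\<close>
  obtain e :: "nat \<Rightarrow> 'a" where e: "\<And>i. rlz (A \<union> e ` {..<i}) (e i)" using mor_sequence[OF A] by blast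
  have eU: "range e \<subseteq> U" using e rlz_car carU[OF s_sort] by blast
  obtain d :: "nat \<Rightarrow> 'a" where d: "\<And>i. rlz ((A \<union> range e) \<union> d ` {..<i}) (d i)"
    using mor_sequence[of "A \<union> range e"] A eU small_Un[OF A(2) small_nat[of e UNIV]] by blast
  have dU: "range d \<subseteq> U" using d rlz_car carU[OF s_sort] by blast
  have edcar: "e i \<in> car M s" "d i \<in> car M s" for i using e d rlz_car by blast+
  let ?B = "A \<union> range e \<union> range d"
  let ?\<Phi> = "\<lambda>(b, i). if b then Neg (phd ts (d i) \<psi>) else phd ts (e i) \<psi>"
  have \<psi>': "\<psi> \<in> fmlas L (\<lambda>s. car M s \<inter> A) (s # ts)" using \<psi> by (simp add: fmlas_over_def)
  have phd_FO: "phd ts x \<psi> \<in> FO ?B ts" if "x \<in> car M s" "x \<in> ?B" for x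
    unfolding fmlas_over_def by (rule phd_fmlas[OF \<psi>']) (use ts s_sort that in auto)
  have "\<exists>c\<in>tuples M ts. \<forall>k\<in>UNIV. holds M id c (?\<Phi> k)"
  proof (rule realize_family[of ?B])
    show "?B \<subseteq> U" using A eU dU by blast
    show "small \<kappa> ?B" using A by (intro small_Un small_nat)
    show "?\<Phi> k \<in> FO ?B ts" for k
      using phd_FO[of "d (snd k)"] phd_FO[of "e (snd k)"] edcar by (auto simp: case_prod_beta)
    fix F :: "(bool \<times> nat) set" assume "finite F"
    then obtain n where n: "\<And>b i. (b, i) \<in> F \<Longrightarrow> i < n"
      using finite_nat_set_iff_bounded[of "snd ` F"] by force
    let ?ts' = "replicate (n + n) s"
    \<comment> \<open>Lists carry the newest element first: the first \<open>n\<close> places belong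
      to the later half, where \<psi> must fail, and the last \<open>n\<close> to the earlier half,
      where it must hold.\<close>
    let ?\<theta> = "conjs s (map (\<lambda>i. if i < n then Neg (sel s ts (n + n) i \<psi>) else sel s ts (n + n) i \<psi>) [0..<n + n])"
    have \<theta>: "?\<theta> \<in> FO A (ts @ ?ts')"
      using sel_FO[OF \<psi>, of _ "n + n"] ts s_sort by (intro FO_conjs) auto
    have h\<theta>: "holds M id zs (exhs ts ?ts' ?\<theta>) \<longleftrightarrow>
      (\<exists>c\<in>tuples M ts. \<forall>i<n + n. holds M id (zs ! i # c) \<psi> \<longleftrightarrow> n \<le> i)"
      if "length zs = n + n" for zs
    proof -
      have "holds M id zs (exhs ts ?ts' ?\<theta>) \<longleftrightarrow> (\<exists>c\<in>tuples M ts. holds M id (c @ zs) ?\<theta>)"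
        using \<theta> ts s_sort that unfolding fmlas_over_def by (intro holds_exhs) auto
      also have "\<dots> \<longleftrightarrow> (\<exists>c\<in>tuples M ts. \<forall>i<n + n. holds M id (zs ! i # c) \<psi> \<longleftrightarrow> n \<le> i)"
      proof (rule bex_cong[OF refl])
        fix c assume "c \<in> tuples M ts"
        then have sel: "holds M id (c @ zs) (sel s ts (n + n) i \<psi>) \<longleftrightarrow> holds M id (zs ! i # c) \<psi>"
          if "i < n + n" for i
          using holds_sel[OF \<psi>', of c zs "n + n" i M id] \<open>length zs = n + n\<close> that by (simp add: tuples_length)
        have "holds M id (c @ zs) ?\<theta> \<longleftrightarrow> (\<forall>i<n + n. holds M id (c @ zs)
            (if i < n then Neg (sel s ts (n + n) i \<psi>) else sel s ts (n + n) i \<psi>))"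
          unfolding holds_conjs set_map set_upt ball_simps by (simp add: Ball_def)
        also have "\<dots> \<longleftrightarrow> (\<forall>i<n + n. holds M id (zs ! i # c) \<psi> \<longleftrightarrow> n \<le> i)"
          by (intro all_cong) (simp add: sel not_le)
        finally show "holds M id (c @ zs) ?\<theta> \<longleftrightarrow> (\<forall>i<n + n. holds M id (zs ! i # c) \<psi> \<longleftrightarrow> n \<le> i)" .
      qed
      finally show ?thesis .
    qed
    obtain ds es c where c: "mor A (ds @ es)" "n \<le> length ds" "n \<le> length es" "c \<in> tuples M ts"
      "\<forall>z\<in>set es. holds M id (z # c) \<psi>" "\<forall>z\<in>set ds. \<not> holds M id (z # c) \<psi>"
      using contra by blast
    let ?zs = "take n ds @ take n es"
    have "mor (A \<union> set (take n es)) (take n ds)"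
      using c(1) by (auto simp: mor_append dest!: mor_take[of _ ds n] elim!: mor_mono dest: in_set_takeD)
    then have m: "mor A ?zs" using c(1) by (auto simp: mor_append mor_take)
    have "holds M id (?zs ! i # c) \<psi> \<longleftrightarrow> n \<le> i" if "i < n + n" for i
      using c that by (auto simp: nth_append)
    then have "holds M id ?zs (exhs ts ?ts' ?\<theta>)" using h\<theta>[of ?zs] c(2,3,4) by auto
    \<comment> \<open>The counterexample \<open>?zs\<close> need not come from \<open>d\<close> and
      \<open>e\<close>, but it has the same type over \<open>A\<close> as the initial segments in
      \<open>?ws\<close>. That a suitable \<open>c\<close> exists is a formula over
      \<open>A\<close>, so it passes from \<open>?zs\<close> to \<open>?ws\<close>.\<close>
    moreover let ?ws = "map d (rev [0..<n]) @ map e (rev [0..<n])"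
    have "mor A ?ws"
      using mor_map_rev[OF e, of n] mor_map_rev[OF d, of n] by (auto simp: mor_append elim!: mor_mono)
    moreover have "exhs ts ?ts' ?\<theta> \<in> FO A ?ts'"
      using \<theta> ts s_sort unfolding fmlas_over_def by (intro exhs_fmlas) auto
    ultimately have "holds M id ?ws (exhs ts ?ts' ?\<theta>)"
      using mor_same_type[of ?zs ?ws] m c(2,3) by (simp add: min_def)
    then obtain c' where c': "c' \<in> tuples M ts" "\<And>i. i < n + n \<Longrightarrow> holds M id (?ws ! i # c') \<psi> \<longleftrightarrow> n \<le> i"
      using h\<theta>[of ?ws] by auto
    have "\<not> holds M id (d i # c') \<psi>" "holds M id (e i # c') \<psi>" if "i < n" for i
      using c'(2)[of "n - Suc i"] c'(2)[of "n + (n - Suc i)"] that by (auto simp: nth_append rev_nth)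
    then have "holds M id c' (?\<Phi> k)" if "k \<in> F" for k
      using n that c'(1) by (cases k) (auto simp: holds_phd[OF \<psi>'] tuples_length)
    with c'(1) show "\<exists>c\<in>tuples M ts. \<forall>k\<in>F. holds M id c (?\<Phi> k)" by blast
  qed (use ts in auto)
  then obtain c where c: "c \<in> tuples M ts" "\<And>b i. holds M id c (?\<Phi> (b, i))" by blast
  have he: "holds M id (e i # c) \<psi>" and hd: "\<not> holds M id (d i # c) \<psi>" for i
    using c(2)[of False i] c(2)[of True i] c(1) by (auto simp: holds_phd[OF \<psi>'] tuples_length)
  \<comment> \<open>Lengths are well-orders on the type of tuples. The sequence is therefore indexed
    by itself: the order is carried over along the injection \<open>?g\<close>, and the sequence is
    the identity.\<close>
  let ?g = "\<lambda>(b, i). [if b then d i else e i]"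
  have imgU: "e ` X \<subseteq> U" "d ` X \<subseteq> U" for X using eU dU by auto
  have e_ne: "e i \<noteq> e k" if "k < i" for i k
    using rlz_notin[OF e[of i]] A imgU that by auto
  have d_ne: "d i \<noteq> d k" if "k < i" for i k
    using rlz_notin[OF d[of i]] A imgU that by auto
  have de_ne: "d i \<noteq> e k" for i k
    using rlz_notin[OF d[of i]] A imgU by auto
  have g: "inj ?g"
    using e_ne d_ne de_ne by (auto simp: inj_on_def split: if_splits) (metis linorder_neqE_nat)+
  let ?W = "{((b, i), (c, k)). (b :: bool) < c \<or> b = c \<and> (i :: nat) \<le> k}"
  let ?r = "dir_image ?W ?g"
  have FW: "Field ?W = UNIV" by (auto simp: Field_def)
  have wo: "Well_order ?r"
    by (rule Well_order_dir_image[OF Well_order_bool_nat]) (use g inj_on_subset in blast)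
  have Fr: "Field ?r = range ?g" unfolding dir_image_Field FW ..
  have inf: "infinite (range (\<lambda>i. ?g (b, i)))" for b
  proof
    assume "finite (range (\<lambda>i. ?g (b, i)))"
    moreover have "inj (\<lambda>i. ?g (b, i))" using g unfolding inj_on_def by blast
    ultimately show False using finite_imageD infinite_UNIV_nat by blast
  qed
  have "infinite (Field ?r)"
    unfolding Fr using inf[of True] by (rule contrapos_nn) (erule finite_subset[rotated], blast)
  moreover have "morley_sequence L M [s] p A ?r (\<lambda>xs. xs)"
    unfolding morley_sequence_def
  proof
    fix xs assume "xs \<in> Field ?r"
    then obtain w where w: "xs = ?g w" unfolding Fr by blast
    obtain b i where "w = (b, i)" by (cases w)
    with w have xs: "xs = ?g (b, i)" by simp
    let ?P = "\<Union>k\<in>{k. (k, xs) \<in> ?r \<and> k \<noteq> xs}. set k"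
    have "?P \<subseteq> (if b then range e \<union> d ` {..<i} else e ` {..<i})"
    proof
      fix x assume "x \<in> ?P"
      then obtain k where k: "(k, xs) \<in> ?r" "k \<noteq> xs" "x \<in> set k" by blast
      from k(1) obtain u v where uv: "k = ?g u" "xs = ?g v" "(u, v) \<in> ?W"
        unfolding dir_image_def by blast
      have "v = (b, i)" by (rule injD[OF g]) (use uv(2) xs in simp)
      with uv(1,3) show "x \<in> (if b then range e \<union> d ` {..<i} else e ` {..<i})"
        using k(2,3) xs by (cases u) (auto simp: le_less)
    qed
    then have "A \<union> ?P \<subseteq> (if b then A \<union> range e \<union> d ` {..<i} else A \<union> e ` {..<i})" by auto
    moreover have "rlz (if b then A \<union> range e \<union> d ` {..<i} else A \<union> e ` {..<i}) (hd xs)"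
      using xs e d by auto
    ultimately have "rlz (A \<union> ?P) (hd xs)" by (blast intro: rlz_mono)
    then show "xs \<in> tuples M [s] \<and> realizes M id xs (restrict_type L M [s] p (A \<union> ?P))"
      using xs by (simp add: rlz_def)
  qed
  moreover have "plug (Suc 0) c \<psi> \<in> FO U [s]" using FO_U[OF plug_FO[OF \<psi> c(1)]] .
  ultimately have fin: "finite {xs \<in> Field ?r. holds M id xs (plug (Suc 0) c \<psi>)} \<or>
      finite {xs \<in> Field ?r. \<not> holds M id xs (plug (Suc 0) c \<psi>)}"
    using stable[OF wo] by blast
  have gr: "[e i] \<in> range ?g" "[d i] \<in> range ?g" for i
    using rangeI[of ?g "(False, i)"] rangeI[of ?g "(True, i)"] by simp_all
  have "range (\<lambda>i. ?g (False, i)) \<subseteq> {xs \<in> Field ?r. holds M id xs (plug (Suc 0) c \<psi>)}"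
    unfolding Fr using he gr by (auto simp: holds_plug1[OF \<psi> c(1)])
  with inf[of False] have 1: "infinite {xs \<in> Field ?r. holds M id xs (plug (Suc 0) c \<psi>)}"
    using finite_subset by blast
  have "range (\<lambda>i. ?g (True, i)) \<subseteq> {xs \<in> Field ?r. \<not> holds M id xs (plug (Suc 0) c \<psi>)}"
    unfolding Fr using hd gr by (auto simp: holds_plug1[OF \<psi> c(1)])
  with inf[of True] have 2: "infinite {xs \<in> Field ?r. \<not> holds M id xs (plug (Suc 0) c \<psi>)}"
    using finite_subset by blast
  from fin 1 2 show False by blast
qed

text \<open>If \<psi>(x, c) holds on \<open>fs\<close> but is not in \<open>p\<close>, then
  \<open>fs\<close> can be prolonged by \<open>n\<close> realizations of \<open>p\<close> over a
  base containing \<open>c\<close>. On these \<psi>(x, c) fails, and the alternation is too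
  long.\<close>

lemma majority:
  assumes \<psi>: "\<psi> \<in> FO U (s # ts)" and ts: "set ts \<subseteq> sorts L"
  shows "\<exists>n. \<forall>fs c. mor A fs \<longrightarrow> n \<le> length fs \<longrightarrow> c \<in> tuples M ts \<longrightarrow>
    (\<forall>z\<in>set fs. holds M id (z # c) \<psi>) \<longrightarrow> plug (Suc 0) c \<psi> \<in> p"
proof -
  obtain us m \<psi>' where us: "set us \<subseteq> sorts L" and m: "m \<in> tuples M us"
    and \<psi>': "\<psi>' \<in> FO {} ((s # ts) @ us)"
    and h: "\<And>xs. length xs = length (s # ts) \<Longrightarrow> holds M id (xs @ m) \<psi>' \<longleftrightarrow> holds M id xs \<psi>"
    using abstract_params[OF \<psi>] ts s_sort by (auto 4 3)
  have \<psi>'': "\<psi>' \<in> FO B (s # ts @ us)" for B using FO_mono[OF \<psi>'] by simp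
  obtain n where n: "\<And>ds es c. mor A (ds @ es) \<Longrightarrow> n \<le> length ds \<Longrightarrow> n \<le> length es \<Longrightarrow>
      c \<in> tuples M (ts @ us) \<Longrightarrow> \<forall>z\<in>set es. holds M id (z # c) \<psi>' \<Longrightarrow> \<exists>z\<in>set ds. holds M id (z # c) \<psi>'"
    using no_long_alternation[OF \<psi>''] ts us by (metis Un_least set_append)
  have "plug (Suc 0) c \<psi> \<in> p"
    if fs: "mor A fs" "n \<le> length fs" and c: "c \<in> tuples M ts"
      and hfs: "\<forall>z\<in>set fs. holds M id (z # c) \<psi>" for fs c
  proof (rule ccontr)
    assume notin: "plug (Suc 0) c \<psi> \<notin> p"
    have cm: "c @ m \<in> tuples M (ts @ us)" using c m by (rule tuples_appendI)
    have hc: "holds M id (z # c @ m) \<psi>' \<longleftrightarrow> holds M id (z # c) \<psi>" for z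
      using h[of "z # c"] c by (simp add: tuples_length)
    have sU: "set fs \<subseteq> U" "set (c @ m) \<subseteq> U"
      using mor_car[OF fs(1)] carU[OF s_sort] tuplesU[OF cm] ts us by auto
    let ?B = "A \<union> set fs \<union> set (c @ m)"
    \<comment> \<open>The base contains \<open>c\<close> and the parameters \<open>m\<close> of
      \<psi>, so on \<open>ds\<close> the truth of \<psi>(x, c) is decided by
      \<open>p\<close>.\<close>
    obtain ds where ds: "mor ?B ds" "length ds = n"
      by (rule mor_ex[of ?B n]) (use A sU in \<open>auto intro!: small_Un small_finite[OF finite_set] simp del: set_append\<close>)
    have "mor A (ds @ fs)" using fs(1) ds(1) by (auto simp: mor_append elim!: mor_mono)
    then obtain z where z: "z \<in> set ds" "holds M id (z # c @ m) \<psi>'"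
      using n[of ds fs "c @ m"] fs(2) ds(2) cm hfs hc by auto
    have "plug (Suc 0) (c @ m) \<psi>' \<notin> p"
    proof -
      have "plug (Suc 0) (c @ m) \<psi>' \<in> p \<longleftrightarrow> plug (Suc 0) c \<psi> \<in> p"
      proof (rule gt_equiv[OF gt])
        show "plug (Suc 0) (c @ m) \<psi>' \<in> FO U [s]" using FO_U[OF plug_FO[OF \<psi>'' cm]] .
        show "plug (Suc 0) c \<psi> \<in> FO U [s]" using FO_U[OF plug_FO[OF \<psi> c]] .
        fix xs assume "xs \<in> tuples M [s]"
        then show "holds M id xs (plug (Suc 0) (c @ m) \<psi>') \<longleftrightarrow> holds M id xs (plug (Suc 0) c \<psi>)"
          using holds_plug1[OF \<psi>'' cm] holds_plug1[OF \<psi> c] hc by (auto simp: tuples_Cons)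
      qed
      with notin show ?thesis by simp
    qed
    moreover have "rlz ?B z" using ds(1) z(1)
    proof (induction ds)
      case (Cons x ds)
      then show ?case by (auto elim: rlz_mono)
    qed simp
    ultimately show False using rlz_plug[of ?B z \<psi>' "ts @ us" "c @ m"] \<psi>'' cm z(2) by auto
  qed
  then show ?thesis by blast
qed

text \<open>One Morley sequence of length \<open>n1 + n2\<close> decides for every \<open>c\<close>,
  where \<open>n1\<close> and \<open>n2\<close> are the bounds for \<psi> and
  \<open>Neg \<psi>\<close>. If \<psi>(x, c) is in \<open>p\<close>, fewer than \<open>n2\<close> of
  its members violate it, so at least \<open>n1\<close> satisfy it. Conversely \<open>n1\<close>
  members satisfying it form a Morley sequence of their own and force it into
  \<open>p\<close>.\<close>

lemma definable:
  assumes \<psi>: "\<psi> \<in> FO U (s # ts)" and ts: "set ts \<subseteq> sorts L"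
  shows "\<exists>\<delta>\<in>FO U ts. \<forall>c\<in>tuples M ts. holds M id c \<delta> \<longleftrightarrow> plug (Suc 0) c \<psi> \<in> p"
proof -
  obtain n1 where n1: "\<And>fs c. mor A fs \<Longrightarrow> n1 \<le> length fs \<Longrightarrow> c \<in> tuples M ts \<Longrightarrow>
    \<forall>z\<in>set fs. holds M id (z # c) \<psi> \<Longrightarrow> plug (Suc 0) c \<psi> \<in> p" using majority[OF \<psi> ts] by blast
  obtain n2 where n2: "\<And>fs c. mor A fs \<Longrightarrow> n2 \<le> length fs \<Longrightarrow> c \<in> tuples M ts \<Longrightarrow>
    \<forall>z\<in>set fs. holds M id (z # c) (Neg \<psi>) \<Longrightarrow> plug (Suc 0) c (Neg \<psi>) \<in> p"
    using majority[of "Neg \<psi>" ts] \<psi> ts unfolding FO_Neg by blast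
  obtain bs where bs: "mor A bs" "length bs = n1 + n2" by (rule mor_ex[OF A])
  let ?\<delta> = "disjs s (map (\<lambda>fs. conjs s (map (\<lambda>z. phd ts z \<psi>) fs)) [fs\<leftarrow>subseqs bs. n1 \<le> length fs])"
  have \<psi>': "\<psi> \<in> fmlas L (\<lambda>s. car M s \<inter> U) (s # ts)" using \<psi> by (simp add: fmlas_over_def)
  have "?\<delta> \<in> FO U ts"
  proof (intro FO_disjs[OF s_sort] subsetI)
    fix \<phi> assume "\<phi> \<in> set (map (\<lambda>fs. conjs s (map (\<lambda>z. phd ts z \<psi>) fs)) [fs\<leftarrow>subseqs bs. n1 \<le> length fs])"
    then obtain fs where fs: "fs \<in> set (subseqs bs)" "\<phi> = conjs s (map (\<lambda>z. phd ts z \<psi>) fs)" by auto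
    have "set fs \<subseteq> car M s" using mor_subseqs[OF bs(1) fs(1)] mor_car by blast
    then have "phd ts z \<psi> \<in> FO U ts" if "z \<in> set fs" for z
      unfolding fmlas_over_def
      by (intro phd_fmlas[OF \<psi>']) (use that ts s_sort carU[OF s_sort] in auto)
    then show "\<phi> \<in> FO U ts" unfolding fs(2) by (intro FO_conjs[OF s_sort]) auto
  qed
  moreover have "holds M id c ?\<delta> \<longleftrightarrow> plug (Suc 0) c \<psi> \<in> p" if c: "c \<in> tuples M ts" for c
  proof -
    have "holds M id c ?\<delta> \<longleftrightarrow> (\<exists>fs\<in>set (subseqs bs). n1 \<le> length fs \<and> (\<forall>z\<in>set fs. holds M id (z # c) \<psi>))"
      using c by (auto simp: holds_phd[OF \<psi>'] tuples_length)
    also have "\<dots> \<longleftrightarrow> plug (Suc 0) c \<psi> \<in> p"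
    proof
      assume "\<exists>fs\<in>set (subseqs bs). n1 \<le> length fs \<and> (\<forall>z\<in>set fs. holds M id (z # c) \<psi>)"
      then show "plug (Suc 0) c \<psi> \<in> p" using n1 c mor_subseqs[OF bs(1)] by blast
    next
      assume in_p: "plug (Suc 0) c \<psi> \<in> p"
      let ?P = "\<lambda>z. holds M id (z # c) \<psi>"
      have sub: "filter Q bs \<in> set (subseqs bs)" for Q
        by (induction bs) (auto simp: Let_def)
      have "\<not> n2 \<le> length (filter (\<lambda>z. \<not> ?P z) bs)"
        using n2[of "filter (\<lambda>z. \<not> ?P z) bs" c] mor_subseqs[OF bs(1) sub] c in_p
          plug_Neg_in[OF \<psi> c ts] by auto
      moreover have "length (filter ?P bs) + length (filter (\<lambda>z. \<not> ?P z) bs) = n1 + n2"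
        using sum_length_filter_compl[of ?P bs] bs(2) by simp
      ultimately have "n1 \<le> length (filter ?P bs)" by linarith
      with sub show "\<exists>fs\<in>set (subseqs bs). n1 \<le> length fs \<and> (\<forall>z\<in>set fs. holds M id (z # c) \<psi>)"
        by (intro bexI[of _ "filter ?P bs"]) auto
    qed
    finally show ?thesis .
  qed
  ultimately show ?thesis by blast
qed

end

section \<open>Strongly regular types\<close>

lemma entails_refl: "\<Delta> \<subseteq> \<Gamma> \<Longrightarrow> entails M ss \<Gamma> \<Delta>"
  unfolding entails_def realizes_def by (intro ballI exI[of _ "{_}"]) auto

lemma entails_trans:
  assumes "entails M ss \<Gamma> \<Delta>" "entails M ss \<Delta> \<Theta>"
  shows "entails M ss \<Gamma> \<Theta>"
  unfolding entails_def
proof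
  fix \<theta> assume "\<theta> \<in> \<Theta>"
  then obtain F where F: "finite F" "F \<subseteq> \<Delta>" "\<forall>xs\<in>tuples M ss. realizes M id xs F \<longrightarrow> holds M id xs \<theta>"
    using assms(2) unfolding entails_def by blast
  have "\<forall>\<delta>\<in>F. \<exists>G. finite G \<and> G \<subseteq> \<Gamma> \<and> (\<forall>xs\<in>tuples M ss. realizes M id xs G \<longrightarrow> holds M id xs \<delta>)"
    using assms(1) F(2) unfolding entails_def by blast
  then obtain G where G: "\<And>\<delta>. \<delta> \<in> F \<Longrightarrow>
      finite (G \<delta>) \<and> G \<delta> \<subseteq> \<Gamma> \<and> (\<forall>xs\<in>tuples M ss. realizes M id xs (G \<delta>) \<longrightarrow> holds M id xs \<delta>)"
    by metis
  then have "finite (\<Union>(G ` F))" "\<Union>(G ` F) \<subseteq> \<Gamma>" using F(1) by auto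
  moreover have "holds M id xs \<theta>" if "xs \<in> tuples M ss" "realizes M id xs (\<Union>(G ` F))" for xs
  proof -
    have "realizes M id xs F" unfolding realizes_def
      using G that by (auto simp: realizes_def)
    then show ?thesis using F(3) that(1) by blast
  qed
  ultimately show "\<exists>F. finite F \<and> F \<subseteq> \<Gamma> \<and> (\<forall>xs\<in>tuples M ss. realizes M id xs F \<longrightarrow> holds M id xs \<theta>)"
    by blast
qed

text \<open>\<open>A\<close> witnesses generic stability and \<open>A'\<close> strong regularity.
  They stay separate, and each argument passes to a base containing the one it uses.\<close>

locale sr_type = gs_type L \<kappa> M s p A
  for L :: "('s, 'f, 'r) lang" and \<kappa> :: "'k rel" and M :: "('s, 'f, 'r, 'a) struc" and s p A +
  fixes \<phi> :: "('s, 'f, 'r, 'a) sfm" and A' :: "'a set"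
  assumes A': "A' \<subseteq> univ L M" "small \<kappa> A'"
    and \<phi>: "\<phi> \<in> restrict_type L M [s] p A'"
    and regular: "\<And>B a. A' \<subseteq> B \<Longrightarrow> B \<subseteq> univ L M \<Longrightarrow> small \<kappa> B \<Longrightarrow> a \<in> car M s \<Longrightarrow>
      holds M id [a] \<phi> \<Longrightarrow> realizes M id [a] (restrict_type L M [s] p B) \<or>
      entails M [s] (restrict_type L M [s] p B) (restrict_type L M [s] p (insert a B))"
begin

lemma \<phi>_p: "\<phi> \<in> p"
  using \<phi> by (simp add: restrict_type_def)

text \<open>Realizations of \<open>\<phi>\<close> that omit \<open>p\<close> can be added to the base one after the other.\<close>

lemma entails_tuple:
  assumes B: "A' \<subseteq> B" "B \<subseteq> U" "small \<kappa> B" and \<sigma>: "\<sigma> \<in> p" "\<sigma> \<in> FO B [s]"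
    and zs: "\<And>z. z \<in> set zs \<Longrightarrow> z \<in> car M s \<and> holds M id [z] \<phi> \<and> \<not> holds M id [z] \<sigma>"
  shows "entails M [s] (restrict_type L M [s] p B) (restrict_type L M [s] p (B \<union> set zs))"
  using zs
proof (induction zs)
  case Nil
  show ?case by (rule entails_refl) simp
next
  case (Cons z zs)
  let ?B = "B \<union> set zs"
  have "?B \<subseteq> U" using B(2) Cons.prems carU[OF s_sort] by auto
  moreover have "\<sigma> \<in> restrict_type L M [s] p ?B"
    using \<sigma> FO_mono by (auto simp: restrict_type_def)
  \<comment> \<open>\<sigma> is a formula of \<open>p\<close> over \<open>B\<close>, so an element
    violating it excludes the first alternative of \<open>regular\<close> over every base that
    contains \<open>B\<close>.\<close>
  then have "\<not> realizes M id [z] (restrict_type L M [s] p ?B)"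
    using Cons.prems[of z] by (auto simp: realizes_def id_def)
  ultimately have "entails M [s] (restrict_type L M [s] p ?B) (restrict_type L M [s] p (insert z ?B))"
    using regular[of ?B z] B Cons.prems[of z] small_Un[OF B(3) small_finite[of "set zs"]]
    by (auto simp: id_def)
  moreover have "entails M [s] (restrict_type L M [s] p B) (restrict_type L M [s] p ?B)"
    using Cons by auto
  ultimately show ?case using entails_trans by fastforce
qed

text \<open>For a single tuple, \<open>entails_tuple\<close> yields such a \<pi> that may depend on
  \<open>zs\<close>. If none worked for all tuples, saturation would produce one tuple defeating
  every \<pi> of \<open>p\<close> over a small base. The definition \<delta> of \<rho> is what makes
  the conditions on \<open>zs\<close> first-order. A uniform \<pi> can be carried over to
  \<open>N\<close>.\<close>

lemma uniform_entailment:
  assumes \<sigma>: "\<sigma> \<in> p" and \<rho>: "\<rho> \<in> FO U (s # replicate n s)"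
  shows "\<exists>\<pi>\<in>p. \<forall>zs\<in>tuples M (replicate n s). (\<forall>z\<in>set zs. holds M id [z] \<phi> \<and> \<not> holds M id [z] \<sigma>) \<longrightarrow>
    plug (Suc 0) zs \<rho> \<in> p \<longrightarrow> (\<forall>x\<in>car M s. holds M id [x] \<pi> \<longrightarrow> holds M id (x # zs) \<rho>)"
proof (rule ccontr)
  assume contra: "\<not> ?thesis"
  let ?ts = "replicate n s"
  have ts: "set ?ts \<subseteq> sorts L" using s_sort by auto
  obtain \<delta> where \<delta>: "\<delta> \<in> FO U ?ts" "\<And>c. c \<in> tuples M ?ts \<Longrightarrow> holds M id c \<delta> \<longleftrightarrow> plug (Suc 0) c \<rho> \<in> p"
    using definable[OF \<rho> ts] by blast
  obtain P where P: "finite P" "P \<subseteq> U" "\<sigma> \<in> FO P [s]" using FO_finite[OF gt_FO[OF gt \<sigma>]] by metis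
  obtain Q where Q: "finite Q" "Q \<subseteq> U" "\<rho> \<in> FO Q (s # ?ts)" using FO_finite[OF \<rho>] by metis
  obtain R where R: "finite R" "R \<subseteq> U" "\<delta> \<in> FO R ?ts" using FO_finite[OF \<delta>(1)] by metis
  let ?B = "A' \<union> (P \<union> Q \<union> R)"
  have B: "A' \<subseteq> ?B" "?B \<subseteq> U" "small \<kappa> ?B"
    using A' P Q R small_Un[OF A'(2) small_finite[of "P \<union> Q \<union> R"]] by auto
  have FB: "\<sigma> \<in> FO ?B [s]" "\<rho> \<in> FO ?B (s # ?ts)" "\<delta> \<in> FO ?B ?ts" "\<phi> \<in> FO ?B [s]"
    using P Q R \<phi> by (auto elim!: FO_mono simp: restrict_type_def)
  let ?D = "Conj (every s [] n (Conj \<phi> (Neg \<sigma>))) \<delta>"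
  let ?E = "\<lambda>\<pi>. exh s ?ts (Conj \<pi> (Neg \<rho>))"
  \<comment> \<open>\<open>None\<close> stands for the hypotheses on \<open>zs\<close>, and
    \<open>Some \<pi>\<close> for the demand that \<pi> does not imply \<rho> at
    \<open>zs\<close>.\<close>
  let ?\<Phi> = "case_option ?D ?E"
  let ?I = "insert None (Some ` (p \<inter> FO ?B [s]))"
  have D: "?D \<in> FO ?B ?ts"
    using FB every_FO[of "Conj \<phi> (Neg \<sigma>)" ?B s "[]" n] s_sort by simp
  have hD: "holds M id zs ?D \<longleftrightarrow>
      (\<forall>z\<in>set zs. holds M id [z] \<phi> \<and> \<not> holds M id [z] \<sigma>) \<and> plug (Suc 0) zs \<rho> \<in> p"
    if "zs \<in> tuples M ?ts" for zs
    using holds_every[of "Conj \<phi> (Neg \<sigma>)" L _ s "[]" "[]" zs n M id] FB that \<delta>(2)[OF that]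
    by (simp add: fmlas_over_def tuples_replicate)
  have hE: "holds M id zs (?E \<pi>) \<longleftrightarrow> (\<exists>x\<in>car M s. holds M id [x] \<pi> \<and> \<not> holds M id (x # zs) \<rho>)"
    if "\<pi> \<in> FO U [s]" "length zs = n" for \<pi> zs
  proof -
    have "Conj \<pi> (Neg \<rho>) \<in> FO U (s # ?ts)" using that(1) \<rho> FO_append[of \<pi> U "[s]" ?ts] by simp
    moreover have "holds M id (x # zs) \<pi> \<longleftrightarrow> holds M id [x] \<pi>" for x
      using holds_append[of \<pi> L _ "[s]" "[x]" M id zs] that(1) by (simp add: fmlas_over_def)
    ultimately show ?thesis using that(2) unfolding fmlas_over_def by (subst holds_exh) auto
  qed
  have "\<exists>zs\<in>tuples M ?ts. \<forall>k\<in>?I. holds M id zs (?\<Phi> k)"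
  proof (rule realize_family[OF B(2,3) ts])
    fix k assume "k \<in> ?I"
    moreover have "?E \<pi> \<in> FO ?B ?ts" if "\<pi> \<in> FO ?B [s]" for \<pi>
    proof -
      have "Conj \<pi> (Neg \<rho>) \<in> FO ?B (s # ?ts)" using that FB FO_append[of \<pi> ?B "[s]" ?ts] by simp
      then show ?thesis using s_sort unfolding fmlas_over_def by (intro exh_fmlas) auto
    qed
    ultimately show "?\<Phi> k \<in> FO ?B ?ts" using D by auto
  next
    fix F assume F: "finite F" "F \<subseteq> ?I"
    have "finite (Some -` F)" using F(1) by (simp add: finite_vimageI)
    from finite_list[OF this] obtain \<pi>s where \<pi>s: "set \<pi>s = Some -` F" ..
    then have \<pi>sp: "set \<pi>s \<subseteq> p" using F(2) by auto
    \<comment> \<open>A counterexample to the conjunction is one to each of the finitely many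
      formulas \<pi> at once.\<close>
    then have "conjs s \<pi>s \<in> p" using gt_conjs[OF gt s_sort] by blast
    then obtain zs x where zs: "zs \<in> tuples M ?ts" "\<forall>z\<in>set zs. holds M id [z] \<phi> \<and> \<not> holds M id [z] \<sigma>"
      "plug (Suc 0) zs \<rho> \<in> p" "x \<in> car M s" "holds M id [x] (conjs s \<pi>s)" "\<not> holds M id (x # zs) \<rho>"
      using contra by blast
    have "holds M id zs (?\<Phi> k)" if "k \<in> F" for k
    proof (cases k)
      case None
      then show ?thesis using hD zs by simp
    next
      case (Some \<pi>)
      with that \<pi>s have "\<pi> \<in> set \<pi>s" by simp
      then show ?thesis
        using hE[of \<pi> zs] zs \<pi>sp gt_FO[OF gt] Some by (auto simp: tuples_replicate)
    qed
    then show "\<exists>zs\<in>tuples M ?ts. \<forall>k\<in>F. holds M id zs (?\<Phi> k)" using zs(1) by blast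
  qed
  then obtain zs where zs: "zs \<in> tuples M ?ts" "\<And>k. k \<in> ?I \<Longrightarrow> holds M id zs (?\<Phi> k)" by blast
  have zs': "\<forall>z\<in>set zs. holds M id [z] \<phi> \<and> \<not> holds M id [z] \<sigma>" "plug (Suc 0) zs \<rho> \<in> p"
    using zs(2)[of None] hD[OF zs(1)] by auto
  have "entails M [s] (restrict_type L M [s] p ?B) (restrict_type L M [s] p (?B \<union> set zs))"
    by (rule entails_tuple[OF B \<sigma> FB(1)]) (use zs(1) zs'(1) in \<open>auto simp: tuples_replicate\<close>)
  moreover have "plug (Suc 0) zs \<rho> \<in> restrict_type L M [s] p (?B \<union> set zs)"
    using zs'(2) plug_FO[OF FB(2) zs(1)] by (simp add: restrict_type_def)
  ultimately obtain F where F: "finite F" "F \<subseteq> restrict_type L M [s] p ?B"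
    "\<forall>xs\<in>tuples M [s]. realizes M id xs F \<longrightarrow> holds M id xs (plug (Suc 0) zs \<rho>)"
    unfolding entails_def by blast
  obtain \<pi>s where \<pi>s: "set \<pi>s = F" using finite_list[OF F(1)] by blast
  \<comment> \<open>The finite part of \<open>p\<close> used in the entailment is, as a conjunction,
    one of the formulas \<pi> that \<open>zs\<close> was chosen to defeat.\<close>
  have \<pi>: "conjs s \<pi>s \<in> p" "conjs s \<pi>s \<in> FO ?B [s]"
    using gt_conjs[OF gt s_sort, of \<pi>s] FO_conjs[OF s_sort, of \<pi>s ?B "[s]"] F(2) \<pi>s
    by (auto simp: restrict_type_def)
  then have "holds M id zs (?E (conjs s \<pi>s))" using zs(2)[of "Some (conjs s \<pi>s)"] by simp
  then obtain x where "x \<in> car M s" "holds M id [x] (conjs s \<pi>s)" "\<not> holds M id (x # zs) \<rho>"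
    using hE[OF FO_U[OF \<pi>(2)]] zs(1) by (auto simp: tuples_replicate)
  then show False
    using F(3) \<pi>s holds_plug1[OF FB(2) zs(1)] by (auto simp: realizes_def tuples_Cons)
qed

end

section \<open>Realizations in a larger monster model\<close>

locale extension = sat_structure L \<kappa> M + N: sat_structure L \<mu> N
  for L :: "('s, 'f, 'r) lang" and \<kappa> :: "'k rel" and M :: "('s, 'f, 'r, 'a) struc"
    and \<mu> :: "'l rel" and N :: "('s, 'f, 'r, 'b) struc" +
  fixes j :: "'a \<Rightarrow> 'b"
  assumes small_M: "small \<mu> (univ L M)"
    and elem: "elementary_on L M N (univ L M) j"
begin

lemma j_car: "s \<in> sorts L \<Longrightarrow> m \<in> car M s \<Longrightarrow> j m \<in> car N s"
  using elem carU unfolding elementary_on_def by blast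

lemma j_tuples: "ms \<in> tuples M ss \<Longrightarrow> set ss \<subseteq> sorts L \<Longrightarrow> map j ms \<in> tuples N ss"
  using j_car by (auto simp: tuples_def list_all2_conv_all_nth subset_iff)

lemma j_image: "j ` U \<subseteq> N.U"
  using j_car by (auto simp: univ_def)

lemma small_j: "small \<mu> (j ` U)"
  using small_M card_of_image ordLeq_ordLess_trans unfolding small_def by blast

lemma elem_sentence: "\<phi> \<in> FO U [] \<Longrightarrow> holds M id [] \<phi> \<longleftrightarrow> holds N j [] \<phi>"
  using elem by (simp add: elementary_on_def)

lemma elem_tuple:
  assumes "\<phi> \<in> FO U ss" "ms \<in> tuples M ss" "set ss \<subseteq> sorts L"
  shows "holds M id ms \<phi> \<longleftrightarrow> holds N j (map j ms) \<phi>"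
proof -
  have "plug 0 ms \<phi> \<in> FO U []"
    using FO_U[OF FO_plug[of \<phi> U "[]" ss ms]] assms by simp
  then have "holds M id [] (plug 0 ms \<phi>) \<longleftrightarrow> holds N j [] (plug 0 ms \<phi>)" by (rule elem_sentence)
  moreover have "holds M id [] (plug 0 ms \<phi>) \<longleftrightarrow> holds M id ms \<phi>"
    using holds_plug_id[of \<phi> U "[]" ss ms "[]"] assms by simp
  moreover have "holds N j [] (plug 0 ms \<phi>) \<longleftrightarrow> holds N j (map j ms) \<phi>"
    using holds_plug[of \<phi> L _ "[]" ss ms "[]" N j] assms by (simp add: fmlas_over_def tuples_length)
  ultimately show ?thesis by simp
qed

lemma elem_ex:
  assumes "\<phi> \<in> FO U ss" "set ss \<subseteq> sorts L" "xs \<in> tuples N ss" "holds N j xs \<phi>"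
  shows "\<exists>ms\<in>tuples M ss. holds M id ms \<phi>"
proof -
  have \<phi>: "\<phi> \<in> fmlas L (\<lambda>s. car M s \<inter> U) (ss @ [])" using assms(1) by (simp add: fmlas_over_def)
  have "exhs ss [] \<phi> \<in> FO U []" using \<phi> assms(2) unfolding fmlas_over_def by (intro exhs_fmlas) auto
  moreover have "holds N j [] (exhs ss [] \<phi>)" using holds_exhs[OF \<phi>, of "[]" N j] assms by auto
  ultimately have "holds M id [] (exhs ss [] \<phi>)" using elem_sentence by blast
  then show ?thesis using holds_exhs[OF \<phi>, of "[]" M id] assms by auto
qed

lemma elem_all:
  assumes "\<phi> \<in> FO U ss" "set ss \<subseteq> sorts L" "\<And>ms. ms \<in> tuples M ss \<Longrightarrow> holds M id ms \<phi>"
    "xs \<in> tuples N ss"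
  shows "holds N j xs \<phi>"
  using elem_ex[of "Neg \<phi>" ss xs] assms by auto

subsection \<open>Moving parameters between the two models\<close>

text \<open>Semi-isolation is stated with parameters in \<open>N\<close>, interpreted by the
  identity, while global types have parameters in \<open>M\<close>, interpreted by \<open>j\<close>.
  With no parameters to abstract, \<open>abst\<close> merely renames them along
  \<open>j\<close>.\<close>

definition up :: "'s list \<Rightarrow> ('s, 'f, 'r, 'a) sfm \<Rightarrow> ('s, 'f, 'r, 'b) sfm" where
  "up ss = abst ss [] [] j"

lemma up_FO: "\<phi> \<in> FO U ss \<Longrightarrow> set ss \<subseteq> sorts L \<Longrightarrow> up ss \<phi> \<in> N.FO (j ` U) ss"
  using abst_fmlas[of \<phi> L _ ss "[]" "[]" j "\<lambda>s. car N s \<inter> j ` U"] j_car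
  unfolding fmlas_over_def up_def by fastforce

lemma holds_up: "\<phi> \<in> FO U ss \<Longrightarrow> length xs = length ss \<Longrightarrow> holds N id xs (up ss \<phi>) \<longleftrightarrow> holds N j xs \<phi>"
  using holds_abst[of \<phi> L _ ss "[]" "[]" xs N id "[]" j] by (simp add: fmlas_over_def up_def)

text \<open>In \<open>down ss ts a \<theta>\<close> the tuple \<open>a\<close> of parameters is turned into new variables of sorts \<open>ts\<close>.\<close>

definition down ::
    "'s list \<Rightarrow> 's list \<Rightarrow> 'b list \<Rightarrow> ('s, 'f, 'r, 'b) sfm \<Rightarrow> ('s, 'f, 'r, 'a) sfm" where
  "down ss ts a = abst ss ts a (inv_into U j)"

lemma inv_j:
  assumes "c \<in> j ` U" "s \<in> sorts L" "c \<in> car N s"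
  shows "inv_into U j c \<in> car M s" "j (inv_into U j c) = c"
proof -
  show c: "j (inv_into U j c) = c" using assms(1) by (rule f_inv_into_f)
  obtain s' where s': "s' \<in> sorts L" "inv_into U j c \<in> car M s'"
    using inv_into_into[OF assms(1)] by (auto simp: univ_def)
  \<comment> \<open>Elements of \<open>M\<close> keep their sort under \<open>j\<close>, and in
    \<open>N\<close> a sort is determined by any of its elements.\<close>
  then have "s' = s" using N.disj[OF s'(1) assms(2)] j_car[OF s'] c assms(3) by simp
  then show "inv_into U j c \<in> car M s" using s' by simp
qed

lemma down_FO:
  assumes "\<theta> \<in> N.FO (j ` U \<union> set a) ss" "a \<in> tuples N ts" "set (ss @ ts) \<subseteq> sorts L"
  shows "down ss ts a \<theta> \<in> FO U (ss @ ts)"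
  unfolding down_def fmlas_over_def
proof (rule abst_fmlas)
  show "\<theta> \<in> fmlas L (\<lambda>s. car N s \<inter> (j ` U \<union> set a)) ss" using assms(1) by (simp add: fmlas_over_def)
  show "length ts = length a" using assms(2) by (simp add: tuples_length)
  fix s c assume s: "s \<in> sorts L" and c: "c \<in> car N s \<inter> (j ` U \<union> set a)"
  { assume "c \<in> set a"
    then have "index_of a c < length ts" "a ! index_of a c = c"
      using index_of[of c a] assms(2) by (auto simp: tuples_length)
    then have "c \<in> car N (ts ! index_of a c)" "ts ! index_of a c \<in> sorts L"
      using tuples_nth[OF assms(2)] assms(3) by fastforce+
    then show "ts ! index_of a c = s" using N.disj s c by blast }
  { assume "c \<notin> set a"
    then show "inv_into U j c \<in> car M s \<inter> U" using inv_j[of c s] s c carU[OF s] by auto }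
qed (use assms in auto)

lemma holds_down:
  assumes "\<theta> \<in> N.FO (j ` U \<union> set a) ss" "a \<in> tuples N ts" "length xs = length ss"
  shows "holds N j (xs @ a) (down ss ts a \<theta>) \<longleftrightarrow> holds N id xs \<theta>"
proof -
  have \<theta>: "\<theta> \<in> fmlas L (\<lambda>s. car N s \<inter> (j ` U \<union> set a)) ss" using assms(1) by (simp add: fmlas_over_def)
  have "holds N j (xs @ a) (down ss ts a \<theta>) \<longleftrightarrow>
      holds N (\<lambda>c. if c \<in> set a then a ! index_of a c else j (inv_into U j c)) xs \<theta>"
    unfolding down_def by (rule holds_abst[OF \<theta>]) (use assms in \<open>auto simp: tuples_length\<close>)
  also have "\<dots> \<longleftrightarrow> holds N id xs \<theta>"
  proof (rule holds_cong[OF \<theta>])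
    fix s c assume "s \<in> sorts L" "c \<in> car N s \<inter> (j ` U \<union> set a)"
    then show "(if c \<in> set a then a ! index_of a c else j (inv_into U j c)) = id c"
      using index_of(2)[of c a] f_inv_into_f[of c j U] by auto
  qed simp
  finally show ?thesis .
qed

text \<open>Since \<open>M\<close> is small for \<mu>, saturation of \<open>N\<close> applies over
  the whole image of \<open>M\<close>; finite satisfiability is inherited by elementarity.\<close>

lemma realize_N:
  assumes "\<Sigma> \<subseteq> FO U ss" "set ss \<subseteq> sorts L"
    "\<And>F. finite F \<Longrightarrow> F \<subseteq> \<Sigma> \<Longrightarrow> \<exists>ms\<in>tuples M ss. \<forall>\<phi>\<in>F. holds M id ms \<phi>"
  shows "\<exists>xs\<in>tuples N ss. \<forall>\<phi>\<in>\<Sigma>. holds N j xs \<phi>"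
proof -
  have "\<exists>xs\<in>tuples N ss. \<forall>\<phi>\<in>\<Sigma>. holds N id xs (up ss \<phi>)"
  proof (rule N.realize_family[OF j_image small_j assms(2)])
    fix \<phi> assume "\<phi> \<in> \<Sigma>"
    then show "up ss \<phi> \<in> N.FO (j ` U) ss" using assms by (intro up_FO) auto
  next
    fix F assume F: "finite F" "F \<subseteq> \<Sigma>"
    then obtain ms where ms: "ms \<in> tuples M ss" "\<forall>\<phi>\<in>F. holds M id ms \<phi>" using assms(3) by blast
    then have "holds N id (map j ms) (up ss \<phi>)" if "\<phi> \<in> F" for \<phi>
      using elem_tuple[of \<phi> ss ms] holds_up[of \<phi> ss "map j ms"] assms F(2) that
      by (auto simp: tuples_length)
    then show "\<exists>xs\<in>tuples N ss. \<forall>\<phi>\<in>F. holds N id xs (up ss \<phi>)"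
      using j_tuples[OF ms(1) assms(2)] by blast
  qed
  then show ?thesis using holds_up assms(1) by (metis subsetD tuples_length)
qed

lemma realize_type:
  assumes "global_type L M ss p"
  shows "\<exists>xs\<in>tuples N ss. realizes N j xs p"
  using realize_N[of p ss] gt_FO[OF assms] gt_sorts[OF assms] gt_realize[OF assms]
  by (auto simp: realizes_def)

definition tp :: "'s list \<Rightarrow> 'b list \<Rightarrow> ('s, 'f, 'r, 'a) sfm set" where
  "tp ss xs = {\<phi> \<in> FO U ss. holds N j xs \<phi>}"

text \<open>A sort \<open>s\<close> is supplied separately because \<open>ss\<close> may be empty,
  and conjunctions need a sort.\<close>

lemma tp_global:
  assumes "xs \<in> tuples N ss" "set ss \<subseteq> sorts L" "s \<in> sorts L"
  shows "global_type L M ss (tp ss xs)"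
proof -
  have "\<exists>ms\<in>tuples M ss. realizes M id ms F" if F: "finite F" "F \<subseteq> tp ss xs" for F
  proof -
    obtain \<phi>s where \<phi>s: "set \<phi>s = F" using finite_list[OF F(1)] by blast
    have "\<exists>ms\<in>tuples M ss. holds M id ms (conjs s \<phi>s)"
      by (rule elem_ex[OF _ assms(2,1)]) (use \<phi>s F in \<open>auto intro!: FO_conjs assms simp: tp_def\<close>)
    then show ?thesis using \<phi>s by (auto simp: realizes_def)
  qed
  then show ?thesis
    using assms(2) unfolding global_type_def finitely_satisfiable_def by (auto simp: tp_def)
qed

lemma realizes_iff:
  assumes "global_type L M ss p" "realizes N j xs p" "\<phi> \<in> FO U ss"
  shows "holds N j xs \<phi> \<longleftrightarrow> \<phi> \<in> p"
  using gt_Neg[OF assms(1,3)] assms(2) by (auto simp: realizes_def)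

subsection \<open>Semi-isolation and orthogonality\<close>

text \<open>The isolating formula has parameters from \<open>a\<close> and the image of
  \<open>M\<close>. It is traded for a formula \<chi> over \<open>M\<close> with extra variables for
  \<open>a\<close>, so that all further work is with formulas over \<open>M\<close>.\<close>

lemma semi_isolatedI:
  assumes "b \<in> tuples N ss" "a \<in> tuples N ts" "set (ss @ ts) \<subseteq> sorts L"
    and \<chi>: "\<chi> \<in> FO U (ss @ ts)" "holds N j (b @ a) \<chi>"
    and iso: "\<And>b' \<sigma>. b' \<in> tuples N ss \<Longrightarrow> holds N j (b' @ a) \<chi> \<Longrightarrow> \<sigma> \<in> FO U ss \<Longrightarrow>
      holds N j b \<sigma> \<Longrightarrow> holds N j b' \<sigma>"
  shows "semi_isolated L N (j ` U) ss b a"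
  unfolding semi_isolated_def
proof (intro bexI conjI)
  let ?\<theta> = "plug (length ss) a (up (ss @ ts) \<chi>)"
  have up: "up (ss @ ts) \<chi> \<in> N.FO (j ` U) (ss @ ts)" using \<chi>(1) assms(3) by (rule up_FO)
  show "?\<theta> \<in> N.FO (j ` U \<union> set a) ss" using up assms(2) by (rule N.FO_plug)
  have h: "holds N id b' ?\<theta> \<longleftrightarrow> holds N j (b' @ a) \<chi>" if "b' \<in> tuples N ss" for b'
    using N.holds_plug_id[OF up assms(2), of b'] holds_up[OF \<chi>(1), of "b' @ a"] that assms(2)
    by (simp add: tuples_length)
  then show "holds N id b ?\<theta>" using assms(1) \<chi>(2) by blast
  show "entails N ss {?\<theta>} {\<psi> \<in> N.FO (j ` U) ss. holds N id b \<psi>}"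
    unfolding entails_def
  proof
    fix \<psi> assume "\<psi> \<in> {\<psi> \<in> N.FO (j ` U) ss. holds N id b \<psi>}"
    then have \<psi>: "\<psi> \<in> N.FO (j ` U \<union> set []) ss" "holds N id b \<psi>" by auto
    have d: "down ss [] [] \<psi> \<in> FO U ss" using down_FO[OF \<psi>(1), of "[]"] assms(3) by simp
    have dh: "holds N j b' (down ss [] [] \<psi>) \<longleftrightarrow> holds N id b' \<psi>" if "b' \<in> tuples N ss" for b'
      using holds_down[OF \<psi>(1), of "[]" b'] that by (simp add: tuples_length)
    have "holds N id b' \<psi>" if "b' \<in> tuples N ss" "holds N id b' ?\<theta>" for b'
      using iso[OF that(1) _ d] h[OF that(1)] dh[OF that(1)] dh[OF assms(1)] \<psi>(2) that(2) by blast
    then show "\<exists>F. finite F \<and> F \<subseteq> {?\<theta>} \<and> (\<forall>xs\<in>tuples N ss. realizes N id xs F \<longrightarrow> holds N id xs \<psi>)"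
      by (intro exI[of _ "{?\<theta>}"]) (auto simp: realizes_def)
  qed
qed

lemma semi_isolatedD:
  assumes "semi_isolated L N (j ` U) ss b a"
    and "b \<in> tuples N ss" "a \<in> tuples N ts" "set (ss @ ts) \<subseteq> sorts L"
  shows "\<exists>\<chi>\<in>FO U (ss @ ts). holds N j (b @ a) \<chi> \<and>
    (\<forall>b'\<in>tuples N ss. holds N j (b' @ a) \<chi> \<longrightarrow> (\<forall>\<sigma>\<in>FO U ss. holds N j b \<sigma> \<longrightarrow> holds N j b' \<sigma>))"
proof -
  obtain \<theta> where \<theta>: "\<theta> \<in> N.FO (j ` U \<union> set a) ss" "holds N id b \<theta>"
    and ent: "entails N ss {\<theta>} {\<psi> \<in> N.FO (j ` U) ss. holds N id b \<psi>}"
    using assms(1) unfolding semi_isolated_def by blast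
  have h: "holds N j (b' @ a) (down ss ts a \<theta>) \<longleftrightarrow> holds N id b' \<theta>" if "b' \<in> tuples N ss" for b'
    using holds_down[OF \<theta>(1) assms(3)] that by (simp add: tuples_length)
  have "holds N j b' \<sigma>"
    if b': "b' \<in> tuples N ss" "holds N j (b' @ a) (down ss ts a \<theta>)" and \<sigma>: "\<sigma> \<in> FO U ss" "holds N j b \<sigma>" for b' \<sigma>
  proof -
    have "up ss \<sigma> \<in> {\<psi> \<in> N.FO (j ` U) ss. holds N id b \<psi>}"
      using up_FO[OF \<sigma>(1)] holds_up[OF \<sigma>(1), of b] \<sigma>(2) assms(2,4) by (auto simp: tuples_length)
    then obtain F where "F \<subseteq> {\<theta>}" "\<forall>xs\<in>tuples N ss. realizes N id xs F \<longrightarrow> holds N id xs (up ss \<sigma>)"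
      using ent unfolding entails_def by blast
    moreover have "realizes N id b' {\<theta>}" using h[OF b'(1)] b'(2) by (simp add: realizes_def)
    ultimately have "holds N id b' (up ss \<sigma>)" using b'(1) by (auto simp: realizes_def)
    then show ?thesis using holds_up[OF \<sigma>(1), of b'] b'(1) by (simp add: tuples_length)
  qed
  moreover have "holds N j (b @ a) (down ss ts a \<theta>)" using h[OF assms(2)] \<theta>(2) by simp
  ultimately show ?thesis using down_FO[OF \<theta>(1) assms(3,4)] by blast
qed

text \<open>This is non-orthogonality seen in \<open>N\<close>: two pairs of realizations with
  different types over \<open>M\<close>. Unlike the definition by completions it is visibly
  symmetric up to the order of variables.\<close>

definition distinguished ::
    "'s list \<Rightarrow> ('s, 'f, 'r, 'a) sfm set \<Rightarrow> 's list \<Rightarrow> ('s, 'f, 'r, 'a) sfm set \<Rightarrow> bool" where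
  "distinguished ss p ts q \<longleftrightarrow> (\<exists>\<theta>\<in>FO U (ss @ ts). \<exists>a\<in>tuples N ss. \<exists>a'\<in>tuples N ss.
     \<exists>b\<in>tuples N ts. \<exists>b'\<in>tuples N ts. realizes N j a p \<and> realizes N j a' p \<and>
       realizes N j b q \<and> realizes N j b' q \<and> holds N j (a @ b) \<theta> \<and> \<not> holds N j (a' @ b') \<theta>)"

lemma tp_pair:
  assumes "global_type L M ss p" "global_type L M ts q" "a \<in> tuples N ss" "b \<in> tuples N ts"
  shows "p \<union> shift (length ss) ` q \<subseteq> tp (ss @ ts) (a @ b) \<longleftrightarrow> realizes N j a p \<and> realizes N j b q"
proof -
  have "holds N j (a @ b) \<phi> \<longleftrightarrow> holds N j a \<phi>" if "\<phi> \<in> p" for \<phi>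
    using holds_append[of \<phi> L _ ss a N j b] gt_FO[OF assms(1) that] assms(3)
    by (simp add: fmlas_over_def tuples_length)
  moreover have "holds N j (a @ b) (shift (length ss) \<phi>) \<longleftrightarrow> holds N j b \<phi>" if "\<phi> \<in> q" for \<phi>
    using holds_shift[of \<phi> L _ ts a "length ss" N j b] gt_FO[OF assms(2) that] assms(3)
    by (simp add: fmlas_over_def tuples_length)
  moreover have "\<phi> \<in> FO U (ss @ ts)" if "\<phi> \<in> p" for \<phi>
    using gt_FO[OF assms(1) that] by (rule FO_append)
  moreover have "shift (length ss) \<phi> \<in> FO U (ss @ ts)" if "\<phi> \<in> q" for \<phi>
    using gt_FO[OF assms(2) that] unfolding fmlas_over_def by (rule shift_fmlas)
  ultimately show ?thesis by (auto simp: tp_def realizes_def)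
qed

text \<open>The completions of \<open>p\<close> together with the shifted \<open>q\<close> are
  exactly the types over \<open>M\<close> of pairs of realizations in \<open>N\<close>, since
  \<open>N\<close> realizes every global type of \<open>M\<close>.\<close>

lemma not_orthogonal_iff:
  assumes p: "global_type L M ss p" and q: "global_type L M ts q" and s: "s \<in> sorts L"
  shows "\<not> orthogonal L M ss p ts q \<longleftrightarrow> distinguished ss p ts q"
proof
  have st: "set (ss @ ts) \<subseteq> sorts L" using gt_sorts[OF p] gt_sorts[OF q] by simp
  let ?P = "\<lambda>u. global_type L M (ss @ ts) u \<and> p \<union> shift (length ss) ` q \<subseteq> u"
  have tpP: "?P (tp (ss @ ts) (a @ b))"
    if "a \<in> tuples N ss" "b \<in> tuples N ts" "realizes N j a p" "realizes N j b q" for a b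
    using tp_pair[OF p q that(1,2)] that tp_global[OF tuples_appendI[OF that(1,2)] st s] by blast
  {
    assume no: "\<not> orthogonal L M ss p ts q"
    obtain a b where a: "a \<in> tuples N ss" "realizes N j a p" and b: "b \<in> tuples N ts" "realizes N j b q"
      using realize_type[OF p] realize_type[OF q] by blast
    let ?u = "tp (ss @ ts) (a @ b)"
    have u: "?P ?u" using tpP a b by blast
    \<comment> \<open>One completion is at hand, so unique existence can only fail through a second
      one.\<close>
    have "\<exists>v. P v \<and> v \<noteq> u" if "P u" "\<not> (\<exists>!v. P v)" for P and u :: "('s, 'f, 'r, 'a) sfm set"
      using that by blast
    from this[OF u no[unfolded orthogonal_def]] have "\<exists>u'. ?P u' \<and> u' \<noteq> ?u" .
    then obtain u' where u': "?P u'" "u' \<noteq> ?u" by blast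
    note u'g = u'(1)[THEN conjunct1] and u'p = u'(1)[THEN conjunct2]
    obtain c where c': "c \<in> tuples N (ss @ ts)" "realizes N j c u'" using realize_type[OF u'g] by blast
    obtain a' b' where "c = a' @ b'" and ab': "a' \<in> tuples N ss" "b' \<in> tuples N ts"
      using c'(1) by (rule tuples_appendE)
    with c'(2) have c: "a' \<in> tuples N ss" "b' \<in> tuples N ts" "realizes N j (a' @ b') u'" by auto
    have "tp (ss @ ts) (a' @ b') = u'"
      using realizes_iff[OF u'g c(3)] gt_FO[OF u'g] unfolding tp_def by blast
    then have r: "realizes N j a' p" "realizes N j b' q" using tp_pair[OF p q c(1,2)] u'p by simp_all
    have "\<exists>\<theta>\<in>FO U (ss @ ts). holds N j (a @ b) \<theta> \<and> \<not> holds N j (a' @ b') \<theta>"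
    proof (rule ccontr)
      assume "\<not> ?thesis"
      then have *: "holds N j (a' @ b') \<theta>" if "\<theta> \<in> FO U (ss @ ts)" "holds N j (a @ b) \<theta>" for \<theta>
        using that by blast
      have "holds N j (a' @ b') \<theta> \<longleftrightarrow> holds N j (a @ b) \<theta>" if "\<theta> \<in> FO U (ss @ ts)" for \<theta>
        using *[of \<theta>] *[of "Neg \<theta>"] that by auto
      then have "tp (ss @ ts) (a' @ b') = ?u" by (auto simp: tp_def)
      with \<open>tp (ss @ ts) (a' @ b') = u'\<close> u'(2) show False by simp
    qed
    then show "distinguished ss p ts q" unfolding distinguished_def using a b c r by blast
  next
    assume "distinguished ss p ts q"
    then obtain \<theta> a a' b b' where \<theta>: "\<theta> \<in> FO U (ss @ ts)" and t: "a \<in> tuples N ss" "b \<in> tuples N ts"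
      "realizes N j a p" "realizes N j b q"
      and t': "a' \<in> tuples N ss" "b' \<in> tuples N ts" "realizes N j a' p" "realizes N j b' q"
      and h: "holds N j (a @ b) \<theta>" "\<not> holds N j (a' @ b') \<theta>"
      unfolding distinguished_def by blast
    have ne: "tp (ss @ ts) (a @ b) \<noteq> tp (ss @ ts) (a' @ b')" using \<theta> h by (auto simp: tp_def)
    have "\<not> (\<exists>!w. P w)" if "P u" "P v" "u \<noteq> v" for P and u v :: "('s, 'f, 'r, 'a) sfm set"
      using that by blast
    from this[of ?P, OF tpP[OF t] tpP[OF t'] ne] show "\<not> orthogonal L M ss p ts q"
      by (simp only: orthogonal_def not_False_eq_True)
  }
qed

text \<open>The two blocks of variables are exchanged. Minimality needs this, because it starts from
  q below p and ends with p below q.\<close>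

lemma distinguished_commute:
  assumes "distinguished ss p ts q" "set (ss @ ts) \<subseteq> sorts L"
  shows "distinguished ts q ss p"
proof -
  obtain \<theta> a a' b b' where \<theta>: "\<theta> \<in> FO U (ss @ ts)" and t: "a \<in> tuples N ss" "b \<in> tuples N ts"
    "realizes N j a p" "realizes N j b q" "a' \<in> tuples N ss" "b' \<in> tuples N ts" "realizes N j a' p" "realizes N j b' q"
    and h: "holds N j (a @ b) \<theta>" "\<not> holds N j (a' @ b') \<theta>"
    using assms unfolding distinguished_def by blast
  let ?n = "length (ss @ ts)"
  let ?\<pi> = "\<lambda>i. if i < length ss then length ts + i else i - length ss"
  have 1: "reix (ss @ ts) ?n ?\<pi> \<theta> \<in> FO U (ts @ ss)"
    using \<theta> assms(2) unfolding fmlas_over_def by (intro reix_fmlas) (auto simp: nth_append)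
  have 2: "holds N j (b @ a) (reix (ss @ ts) ?n ?\<pi> \<theta>) \<longleftrightarrow> holds N j (a @ b) \<theta>"
    if "a \<in> tuples N ss" "b \<in> tuples N ts" for a b
  proof -
    have len: "length a = length ss" "length b = length ts" using that by (auto simp: tuples_length)
    have "map (\<lambda>i. (b @ a) ! ?\<pi> i) [0..<length (ss @ ts)] = a @ b"
      by (rule nth_equalityI) (auto simp: len nth_append)
    then show ?thesis using \<theta> unfolding fmlas_over_def by (subst holds_reix) auto
  qed
  show ?thesis unfolding distinguished_def using 1 2 t h by blast
qed

text \<open>Stated for an arbitrary non-algebraic \<open>p\<close>, because minimality applies it
  with the roles of the two types exchanged.\<close>

lemma rk_le_distinguished:
  assumes p: "global_type L M ss p" and q: "global_type L M ts q" and s: "s \<in> sorts L"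
    and "\<not> algebraic M ss p" and rk: "rk_le L M N j ss p ts q"
  shows "distinguished ss p ts q"
proof (rule ccontr)
  assume nd: "\<not> distinguished ss p ts q"
  have ss: "set ss \<subseteq> sorts L" and ts: "set ts \<subseteq> sorts L" and st: "set (ss @ ts) \<subseteq> sorts L"
    using gt_sorts[OF p] gt_sorts[OF q] by auto
  obtain a b where a: "a \<in> tuples N ss" "realizes N j a p" and b: "b \<in> tuples N ts" "realizes N j b q"
    and "semi_isolated L N (j ` U) ss a b" using rk unfolding rk_le_def by blast
  then obtain \<chi> where \<chi>: "\<chi> \<in> FO U (ss @ ts)" "holds N j (a @ b) \<chi>"
    and iso: "\<And>a' \<sigma>. a' \<in> tuples N ss \<Longrightarrow> holds N j (a' @ b) \<chi> \<Longrightarrow> \<sigma> \<in> FO U ss \<Longrightarrow> holds N j a \<sigma> \<Longrightarrow> holds N j a' \<sigma>"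
    using semi_isolatedD[of ss a b ts] st by meson
  \<comment> \<open>A realization of \<open>?\<Sigma>\<close> in \<open>N\<close> would be a pair of
    realizations of \<open>p\<close> and \<open>q\<close> at which \<chi> fails, whereas \<chi>
    holds at \<open>a @ b\<close>.\<close>
  let ?\<Sigma> = "insert (Neg \<chi>) (p \<union> shift (length ss) ` q)"
  have \<Sigma>: "?\<Sigma> \<subseteq> FO U (ss @ ts)"
    using \<chi>(1) tp_pair[OF p q a(1) b(1)] a(2) b(2) by (auto simp: tp_def)
  have "\<not> (\<exists>xs\<in>tuples N (ss @ ts). \<forall>\<phi>\<in>?\<Sigma>. holds N j xs \<phi>)"
  proof
    assume "\<exists>xs\<in>tuples N (ss @ ts). \<forall>\<phi>\<in>?\<Sigma>. holds N j xs \<phi>"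
    then obtain xs where xs: "xs \<in> tuples N (ss @ ts)" "\<forall>\<phi>\<in>?\<Sigma>. holds N j xs \<phi>" by blast
    obtain a' b' where "xs = a' @ b'" and "a' \<in> tuples N ss" "b' \<in> tuples N ts"
      using xs(1) by (rule tuples_appendE)
    with xs(2) have c: "a' \<in> tuples N ss" "b' \<in> tuples N ts" "\<forall>\<phi>\<in>?\<Sigma>. holds N j (a' @ b') \<phi>" by auto
    then have "p \<union> shift (length ss) ` q \<subseteq> tp (ss @ ts) (a' @ b')" using \<Sigma> by (auto simp: tp_def)
    then have "realizes N j a' p" "realizes N j b' q" using tp_pair[OF p q c(1,2)] by auto
    moreover have "\<not> holds N j (a' @ b') \<chi>" using c(3) by simp
    ultimately show False using nd \<chi> a b c(1,2) unfolding distinguished_def by blast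
  qed
  then obtain F where F: "finite F" "F \<subseteq> ?\<Sigma>" "\<And>ms. ms \<in> tuples M (ss @ ts) \<Longrightarrow> \<exists>\<phi>\<in>F. \<not> holds M id ms \<phi>"
    using realize_N[OF \<Sigma> st] by metis
  obtain m where m: "m \<in> tuples M ss" "\<forall>\<phi>\<in>F \<inter> p. holds M id m \<phi>"
    using gt_realize[OF p, of "F \<inter> p"] F(1) by auto
  obtain \<phi>s where \<phi>s: "set \<phi>s = F - {Neg \<chi>}" using finite_list[OF finite_Diff[OF F(1)]] by blast
  \<comment> \<open>No tuple of \<open>M\<close> satisfies all of \<open>F\<close>, so
    \<open>?\<theta>\<close> is valid in \<open>M\<close> and thus in \<open>N\<close>. At the image
    of \<open>m\<close> followed by \<open>b\<close> the members of \<open>F\<close> taken from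
    \<open>p\<close> and \<open>q\<close> hold, which leaves only \<chi>.\<close>
  let ?\<theta> = "Neg (Conj (conjs s \<phi>s) (Neg \<chi>))"
  have \<phi>s_FO: "set \<phi>s \<subseteq> FO U (ss @ ts)"
    unfolding \<phi>s by (rule subset_trans[OF Diff_subset subset_trans[OF F(2) \<Sigma>]])
  have \<theta>: "?\<theta> \<in> FO U (ss @ ts)" using \<phi>s_FO \<chi>(1) by (auto intro!: FO_conjs s)
  have "holds M id ms ?\<theta>" if ms: "ms \<in> tuples M (ss @ ts)" for ms
  proof -
    obtain \<phi> where "\<phi> \<in> F" "\<not> holds M id ms \<phi>" using F(3)[OF ms] by blast
    moreover from this(1) have "\<phi> = Neg \<chi> \<or> \<phi> \<in> set \<phi>s" unfolding \<phi>s by blast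
    ultimately show ?thesis by fastforce
  qed
  from elem_all[OF \<theta> st this tuples_appendI[OF j_tuples[OF m(1) ss] b(1)]]
  have "holds N j (map j m @ b) ?\<theta>" .
  moreover have "holds N j (map j m @ b) \<phi>" if "\<phi> \<in> set \<phi>s" for \<phi>
  proof -
    have "\<phi> \<in> F" "\<phi> \<in> p \<union> shift (length ss) ` q" using \<phi>s F(2) that by auto
    then show ?thesis
    proof (elim UnE imageE)
      assume "\<phi> \<in> p"
      then have "holds N j (map j m) \<phi>"
        using elem_tuple[OF gt_FO[OF p] m(1) ss] m(2) \<open>\<phi> \<in> F\<close> by blast
      then show ?thesis
        using holds_append[of \<phi> L _ ss "map j m" N j b] gt_FO[OF p \<open>\<phi> \<in> p\<close>] m(1)
        by (simp add: fmlas_over_def tuples_length)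
    next
      fix \<phi>' assume \<phi>': "\<phi> = shift (length ss) \<phi>'" "\<phi>' \<in> q"
      then show ?thesis
        using holds_shift[of \<phi>' L _ ts "map j m" "length ss" N j b] gt_FO[OF q \<phi>'(2)] m(1) b(2)
        by (simp add: fmlas_over_def tuples_length realizes_def)
    qed
  qed
  ultimately have "holds N j (map j m @ b) \<chi>" by auto
  then have jm: "holds N j (map j m) \<sigma>" if "\<sigma> \<in> p" for \<sigma>
    using iso[OF j_tuples[OF m(1) ss]] gt_FO[OF p that] a(2) that by (auto simp: realizes_def)
  \<comment> \<open>This formula says \<open>x = m\<close>. Were it not in \<open>p\<close>, its
    negation would be in \<open>p\<close> and would hold at \<open>m\<close>, since the image of
    \<open>m\<close> realizes \<open>p\<close>.\<close>
  let ?e = "conjs s (map (\<lambda>i. Equal (Var (ss ! i, i)) (Par (m ! i))) [0..<length ss])"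
  have "Equal (Var (ss ! i, i)) (Par (m ! i)) \<in> FO U ss" if "i < length ss" for i
  proof -
    have "ss ! i \<in> sorts L" "m ! i \<in> car M (ss ! i)"
      using that ss tuples_nth[OF m(1)] by auto
    then show ?thesis using that carU
      by (auto simp: fmlas_over_def fmlas_iff vars_of_def intro!: exI[of _ "ss ! i"] has_sort.intros)
  qed
  then have e: "?e \<in> FO U ss" by (intro FO_conjs s) auto
  have he: "holds M id ms ?e \<longleftrightarrow> ms = m" if "ms \<in> tuples M ss" for ms
  proof -
    have "holds M id ms ?e \<longleftrightarrow> (\<forall>i<length ss. ms ! i = m ! i)"
      unfolding holds_conjs set_map set_upt ball_simps by (simp add: Ball_def holds_def)
    also have "\<dots> \<longleftrightarrow> ms = m"
      using nth_equalityI[of ms m] tuples_length[OF that] tuples_length[OF m(1)] by auto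
    finally show ?thesis .
  qed
  have "?e \<in> p"
  proof (rule ccontr)
    assume "?e \<notin> p"
    then have "Neg ?e \<in> p" using gt_Neg[OF p e] by blast
    then have "holds M id m (Neg ?e)" using jm elem_tuple[OF gt_FO[OF p] m(1) ss] by blast
    then show False using he[OF m(1)] by simp
  qed
  moreover have "{ms \<in> tuples M ss. holds M id ms ?e} \<subseteq> {m}" using he by blast
  ultimately show False using assms(4) finite_subset unfolding algebraic_def by blast
qed

end

section \<open>Non-orthogonality and the Rudin--Keisler order\<close>

locale sr_extension = sr_type L \<kappa> M s p A \<phi> A' + extension L \<kappa> M \<mu> N j
  for L :: "('s, 'f, 'r) lang" and \<kappa> :: "'k rel" and M :: "('s, 'f, 'r, 'a) struc"
    and s p A \<phi> A' and \<mu> :: "'l rel" and N :: "('s, 'f, 'r, 'b) struc" and j :: "'a \<Rightarrow> 'b"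
begin

text \<open>By strong regularity \<open>p\<close> entails its own extension to a tuple of elements that satisfy \<open>\<phi>\<close> and
  omit \<open>p\<close>, so a further element of such a tuple need only satisfy a suitable formula of \<open>p\<close>.\<close>

lemma imitate_Morley:
  assumes b: "b \<in> car N s" "realizes N j [b] p" and ts: "set ts \<subseteq> sorts L"
    and \<psi>: "\<psi> \<in> FO U (s # ts)" "holds N j (b # a) \<psi>" and a: "a \<in> tuples N ts"
    and noniso: "\<And>\<chi>. \<chi> \<in> FO U (s # ts) \<Longrightarrow> holds N j (b # a) \<chi> \<Longrightarrow>
      \<exists>b'\<in>car N s. holds N j (b' # a) \<chi> \<and> (\<exists>\<sigma>\<in>p. \<not> holds N j [b'] \<sigma>)"
    and B: "A \<subseteq> B" "B \<subseteq> U" "small \<kappa> B" and \<rho>: "\<rho> \<in> FO B (replicate n s)"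
    and mor: "\<And>es. mor B es \<Longrightarrow> length es = n \<Longrightarrow> holds M id es \<rho>"
  shows "\<exists>zs\<in>tuples N (replicate n s). holds N j zs \<rho> \<and>
    (\<forall>z\<in>set zs. holds N j [z] \<phi> \<and> (\<exists>\<sigma>\<in>p. \<not> holds N j [z] \<sigma>) \<and> holds N j (z # a) \<psi>)"
  using B \<rho> mor
proof (induction n arbitrary: B \<rho>)
  case 0
  have "\<rho> \<in> FO U []" using FO_U[OF 0(4)] by simp
  moreover have "holds M id [] \<rho>" using 0(5)[of "[]"] by (simp add: id_def)
  ultimately have "holds N j [] \<rho>" using elem_sentence by blast
  then show ?case by simp
next
  case (Suc n)
  let ?ts = "replicate n s"
  have rs: "set ?ts \<subseteq> sorts L" using s_sort by auto
  have \<rho>B: "\<rho> \<in> FO B (s # ?ts)" using Suc.prems(4) by simp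
  then have \<rho>: "\<rho> \<in> FO U (s # ?ts)" by (rule FO_U)
  \<comment> \<open>\<delta> says of the older elements that \<rho> holds when a new realization of
    \<open>p\<close> is put in front of them. Its parameters may lie outside \<open>B\<close>, so
    the induction hypothesis is applied over a larger base.\<close>
  obtain \<delta> where \<delta>: "\<delta> \<in> FO U ?ts" "\<And>c. c \<in> tuples M ?ts \<Longrightarrow> holds M id c \<delta> \<longleftrightarrow> plug (Suc 0) c \<rho> \<in> p"
    using definable[OF \<rho> rs] by blast
  obtain P where P: "finite P" "P \<subseteq> U" "\<delta> \<in> FO P ?ts" using FO_finite[OF \<delta>(1)] by metis
  have "\<exists>zs\<in>tuples N ?ts. holds N j zs \<delta> \<and>
    (\<forall>z\<in>set zs. holds N j [z] \<phi> \<and> (\<exists>\<sigma>\<in>p. \<not> holds N j [z] \<sigma>) \<and> holds N j (z # a) \<psi>)"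
  proof (rule Suc.IH[of "B \<union> P"])
    show "A \<subseteq> B \<union> P" "B \<union> P \<subseteq> U" using Suc.prems(1,2) P(2) by auto
    show "small \<kappa> (B \<union> P)" by (rule small_Un[OF Suc.prems(3) small_finite[OF P(1)]])
    show "\<delta> \<in> FO (B \<union> P) ?ts" using P(3) by (rule FO_mono) simp
    fix es assume es: "mor (B \<union> P) es" "length es = n"
    let ?C = "B \<union> P \<union> set es"
    have esU: "set es \<subseteq> U" using mor_car[OF es(1)] carU[OF s_sort] by blast
    have "small \<kappa> ?C" using small_Un[OF Suc.prems(3) small_finite[of "P \<union> set es"]] P(1) by (simp add: Un_assoc)
    then obtain x where x: "rlz ?C x" using rlz_ex[of ?C] Suc.prems(2) P(2) esU by auto
    have "mor B (x # es)" using es(1) x by (auto elim: mor_mono rlz_mono)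
    then have "holds M id (x # es) \<rho>" using Suc.prems(5)[of "x # es"] es(2) by (simp add: id_def)
    moreover have est: "es \<in> tuples M ?ts" using mor_tuples[OF es(1)] es(2) by simp
    moreover have "\<rho> \<in> FO ?C (s # ?ts)" using \<rho>B by (rule FO_mono) auto
    ultimately have "plug (Suc 0) es \<rho> \<in> p" using rlz_plug[OF x, of \<rho> ?ts es] by simp
    then show "holds M id es \<delta>" using \<delta>(2)[OF est] by simp
  qed
  then obtain zs where zs: "zs \<in> tuples N ?ts" "holds N j zs \<delta>"
    and zs': "\<And>z. z \<in> set zs \<Longrightarrow> holds N j [z] \<phi> \<and> (\<exists>\<sigma>\<in>p. \<not> holds N j [z] \<sigma>) \<and> holds N j (z # a) \<psi>"
    by blast
  \<comment> \<open>Each \<open>z\<close> omits \<open>p\<close> through a formula of its own. The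
    conjunction of these is a single formula of \<open>p\<close> that fails at all of them, as
    \<open>uniform_entailment\<close> requires.\<close>
  obtain f where f: "\<And>z. z \<in> set zs \<Longrightarrow> f z \<in> p \<and> \<not> holds N j [z] (f z)" using zs' by metis
  let ?\<sigma> = "conjs s (map f zs)"
  have \<sigma>: "?\<sigma> \<in> p" by (rule gt_conjs[OF gt s_sort]) (use f in auto)
  obtain \<pi> where \<pi>: "\<pi> \<in> p" and unif: "\<And>ms x. ms \<in> tuples M ?ts \<Longrightarrow>
      (\<forall>z\<in>set ms. holds M id [z] \<phi> \<and> \<not> holds M id [z] ?\<sigma>) \<Longrightarrow> plug (Suc 0) ms \<rho> \<in> p \<Longrightarrow>
      x \<in> car M s \<Longrightarrow> holds M id [x] \<pi> \<Longrightarrow> holds M id (x # ms) \<rho>"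
    using uniform_entailment[OF \<sigma> \<rho>] by blast
  have \<phi>U: "\<phi> \<in> FO U [s]" and \<pi>U: "\<pi> \<in> FO U [s]" and \<sigma>U: "?\<sigma> \<in> FO U [s]"
    using gt_FO[OF gt] \<phi>_p \<pi> \<sigma> by auto
  let ?D = "Conj (every s [] n (Conj \<phi> (Neg ?\<sigma>))) \<delta>"
  have D: "?D \<in> FO U ?ts"
    using every_FO[of "Conj \<phi> (Neg ?\<sigma>)" U s "[]" n] \<phi>U \<sigma>U s_sort \<delta>(1) by simp
  have hD: "holds X k ys ?D \<longleftrightarrow> (\<forall>z\<in>set ys. holds X k [z] \<phi> \<and> \<not> holds X k [z] ?\<sigma>) \<and> holds X k ys \<delta>"
    if "length ys = n" for ys k and X :: "('s, 'f, 'r, 'x) struc"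
    using holds_every[of "Conj \<phi> (Neg ?\<sigma>)" L _ s "[]" "[]" ys n X k] \<phi>U \<sigma>U that
    by (simp add: fmlas_over_def del: holds_conjs)
  \<comment> \<open>This is the conclusion of \<open>uniform_entailment\<close> as one formula over
    \<open>M\<close>, with \<delta> in place of membership in \<open>p\<close>. It is valid in
    \<open>M\<close> and hence in \<open>N\<close>, where \<open>zs\<close> lives.\<close>
  let ?F = "Neg (Conj (shift (Suc 0) ?D) (Conj \<pi> (Neg \<rho>)))"
  have F: "?F \<in> FO U (s # ?ts)"
    using shift_fmlas[of ?D L _ ?ts "[s]"] D \<rho> FO_append[OF \<pi>U, of ?ts] by (simp add: fmlas_over_def)
  have hF: "holds X k (x # ys) ?F \<longleftrightarrow> (holds X k ys ?D \<longrightarrow> holds X k [x] \<pi> \<longrightarrow> holds X k (x # ys) \<rho>)"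
    if "length ys = n" for x ys k and X :: "('s, 'f, 'r, 'x) struc"
  proof -
    have "holds X k ([x] @ ys) (shift (Suc 0) ?D) \<longleftrightarrow> holds X k ys ?D"
      by (rule holds_shift[OF D[unfolded fmlas_over_def]]) simp
    moreover have "holds X k ([x] @ ys) \<pi> \<longleftrightarrow> holds X k [x] \<pi>"
      by (rule holds_append[OF \<pi>U[unfolded fmlas_over_def]]) simp
    ultimately show ?thesis unfolding append_Cons append_Nil holds_Neg[of _ _ _ "Conj _ _"]
        holds_Conj[of _ _ _ "shift _ _"] holds_Conj[of _ _ _ \<pi>] holds_Neg[of _ _ _ \<rho>] by blast
  qed
  have "holds M id ms ?F" if ms_in: "ms \<in> tuples M (s # ?ts)" for ms
  proof -
    obtain x ys where ms: "ms = x # ys" "x \<in> car M s" "ys \<in> tuples M ?ts"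
      using ms_in unfolding tuples_Cons by blast
    have len: "length ys = n" using tuples_length[OF ms(3)] by simp
    show ?thesis unfolding ms(1) hF[OF len] hD[OF len] \<delta>(2)[OF ms(3)] using unif[OF ms(3) _ _ ms(2)] by blast
  qed
  then have FN: "holds N j (x # zs) ?F" if "x \<in> car N s" for x
    using elem_all[OF F] zs(1) that s_sort rs by auto
  have len: "length zs = n" using tuples_length[OF zs(1)] by simp
  have "holds N j zs ?D" unfolding hD[OF len] using zs(2) zs' f by auto
  then have step: "holds N j (x # zs) \<rho>" if "x \<in> car N s" "holds N j [x] \<pi>" for x
    using FN[OF that(1)] that(2) unfolding hF[OF len] by blast
  \<comment> \<open>\<open>b\<close> satisfies this, as \<phi> and \<pi> belong to \<open>p\<close>.
    The solution \<open>b'\<close> omitting \<open>p\<close> is the new element: \<pi> gives it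
    \<rho> over \<open>zs\<close>, and \<phi> keeps strong regularity applicable to the longer
    tuple.\<close>
  let ?\<chi> = "Conj \<psi> (Conj \<phi> \<pi>)"
  have \<chi>: "?\<chi> \<in> FO U (s # ts)"
    using \<psi>(1) FO_append[OF \<phi>U, of ts] FO_append[OF \<pi>U, of ts] by simp
  have h\<chi>: "holds N j (x # a) ?\<chi> \<longleftrightarrow> holds N j (x # a) \<psi> \<and> holds N j [x] \<phi> \<and> holds N j [x] \<pi>" for x
    using holds_append[of \<phi> L _ "[s]" "[x]" N j a] holds_append[of \<pi> L _ "[s]" "[x]" N j a] \<phi>U \<pi>U
    by (simp add: fmlas_over_def)
  have "holds N j (b # a) ?\<chi>" unfolding h\<chi> using \<psi>(2) b(2) \<phi>_p \<pi> by (auto simp: realizes_def)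
  then obtain b' where b': "b' \<in> car N s" "holds N j (b' # a) ?\<chi>" "\<exists>\<sigma>\<in>p. \<not> holds N j [b'] \<sigma>"
    using noniso[OF \<chi>] by blast
  have "b' # zs \<in> tuples N (replicate (Suc n) s)" using b'(1) zs(1) by simp
  moreover have "holds N j (b' # zs) \<rho>" using step b' unfolding h\<chi> by blast
  moreover have "\<forall>z\<in>set (b' # zs). holds N j [z] \<phi> \<and> (\<exists>\<sigma>\<in>p. \<not> holds N j [z] \<sigma>) \<and> holds N j (z # a) \<psi>"
    using zs' b' unfolding h\<chi> by simp
  ultimately show ?case by blast
qed

text \<open>That \<psi> holds at \<open>b # a\<close> while \<open>a\<close> violates \<delta> means
  that \<open>b\<close> does not realize the extension of \<open>p\<close> to \<open>a\<close> given
  by its definitions. This dependence is turned into semi-isolation.\<close>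

lemma semi_isolated_of_dependent:
  assumes b: "b \<in> car N s" "realizes N j [b] p" and a: "a \<in> tuples N ts" and ts: "set ts \<subseteq> sorts L"
    and \<psi>: "\<psi> \<in> FO U (s # ts)" "holds N j (b # a) \<psi>"
    and \<delta>: "\<delta> \<in> FO U ts" "\<And>c. c \<in> tuples M ts \<Longrightarrow> holds M id c \<delta> \<longleftrightarrow> plug (Suc 0) c \<psi> \<in> p" "\<not> holds N j a \<delta>"
  shows "semi_isolated L N (j ` U) [s] [b] a"
proof (rule ccontr)
  assume not_iso: "\<not> ?thesis"
  \<comment> \<open>The type of \<open>b\<close> over \<open>M\<close> is \<open>p\<close>, so a
    formula true of \<open>b\<close> can fail to semi-isolate it only by having a solution that
    omits \<open>p\<close>.\<close>
  have noniso: "\<exists>b'\<in>car N s. holds N j (b' # a) \<chi> \<and> (\<exists>\<sigma>\<in>p. \<not> holds N j [b'] \<sigma>)"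
    if \<chi>: "\<chi> \<in> FO U (s # ts)" "holds N j (b # a) \<chi>" for \<chi>
  proof (rule ccontr)
    assume contra: "\<not> ?thesis"
    have "semi_isolated L N (j ` U) [s] [b] a"
    proof (rule semi_isolatedI[of _ _ _ ts \<chi>])
      fix b' \<sigma> assume "b' \<in> tuples N [s]" "holds N j (b' @ a) \<chi>" "\<sigma> \<in> FO U [s]" "holds N j [b] \<sigma>"
      moreover from this have "\<sigma> \<in> p" using realizes_iff[OF gt b(2)] by blast
      ultimately show "holds N j b' \<sigma>" using contra by (auto simp: tuples_Cons)
    qed (use b a ts \<chi> s_sort in auto)
    with not_iso show False by blast
  qed
  obtain n where n: "\<And>fs c. mor A fs \<Longrightarrow> n \<le> length fs \<Longrightarrow> c \<in> tuples M ts \<Longrightarrow>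
    \<forall>z\<in>set fs. holds M id (z # c) \<psi> \<Longrightarrow> plug (Suc 0) c \<psi> \<in> p" using majority[OF \<psi>(1) ts] by blast
  let ?rs = "replicate n s"
  let ?\<theta> = "Conj (every s ts n \<psi>) (Neg \<delta>)"
  let ?\<rho> = "Neg (exhs ts ?rs ?\<theta>)"
  have rs: "set (ts @ ?rs) \<subseteq> sorts L" using ts s_sort by auto
  have \<theta>: "?\<theta> \<in> FO U (ts @ ?rs)"
    using every_FO[OF \<psi>(1), of n] ts s_sort FO_append[OF \<delta>(1), of ?rs] by simp
  have h\<rho>: "holds X k zs ?\<rho> \<longleftrightarrow>
      (\<forall>c\<in>tuples X ts. (\<forall>z\<in>set zs. holds X k (z # c) \<psi>) \<longrightarrow> holds X k c \<delta>)"
    if len: "length zs = n" for zs k and X :: "('s, 'f, 'r, 'x) struc"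
  proof -
    have "holds X k (c @ zs) ?\<theta> \<longleftrightarrow> (\<forall>z\<in>set zs. holds X k (z # c) \<psi>) \<and> \<not> holds X k c \<delta>"
      if "c \<in> tuples X ts" for c
      using holds_every[of \<psi> L _ s ts c zs n X k] holds_append[of \<delta> L _ ts c X k zs] \<psi>(1) \<delta>(1) len
        tuples_length[OF that] by (simp add: fmlas_over_def)
    moreover have "holds X k zs ?\<rho> \<longleftrightarrow> \<not> (\<exists>c\<in>tuples X ts. holds X k (c @ zs) ?\<theta>)"
      using holds_exhs[of ?\<theta> L _ ts ?rs zs X k] \<theta> rs len by (simp add: fmlas_over_def del: holds_conjs holds_Conj)
    ultimately show ?thesis by blast
  qed
  have "?\<rho> \<in> FO U ?rs" using \<theta> rs unfolding fmlas_over_def fmlas_Neg by (intro exhs_fmlas) auto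
  \<comment> \<open>\<rho> contains the parameters of \<psi> and \<delta>, which need not lie in
    \<open>A\<close>. Morley sequences over the larger base are Morley over \<open>A\<close>, so the
    bound \<open>n\<close> still applies to them.\<close>
  then obtain P where P: "finite P" "P \<subseteq> U" "?\<rho> \<in> FO P ?rs" by (rule FO_finite)
  have "\<exists>zs\<in>tuples N ?rs. holds N j zs ?\<rho> \<and>
    (\<forall>z\<in>set zs. holds N j [z] \<phi> \<and> (\<exists>\<sigma>\<in>p. \<not> holds N j [z] \<sigma>) \<and> holds N j (z # a) \<psi>)"
  proof (rule imitate_Morley[OF b ts \<psi> a noniso, of "A \<union> P"])
    show "A \<union> P \<subseteq> U" using A P by auto
    show "small \<kappa> (A \<union> P)" by (rule small_Un[OF A(2) small_finite[OF P(1)]])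
    show "?\<rho> \<in> FO (A \<union> P) ?rs" using P(3) by (rule FO_mono) simp
    fix es assume es: "mor (A \<union> P) es" "length es = n"
    then have "mor A es" by (auto elim: mor_mono)
    then show "holds M id es ?\<rho>" unfolding h\<rho>[OF es(2)] using n[of es] es(2) \<delta>(2) by blast
  qed auto
  then obtain zs where zs: "zs \<in> tuples N ?rs" "holds N j zs ?\<rho>" "\<forall>z\<in>set zs. holds N j (z # a) \<psi>" by blast
  have "length zs = n" using tuples_length[OF zs(1)] by simp
  from zs(2)[unfolded h\<rho>[OF this]] have "holds N j a \<delta>" using a zs(3) by blast
  with \<delta>(3) show False by blast
qed

text \<open>The two pairs disagree on \<psi>, but \<open>a\<close> and \<open>a'\<close> both
  realize \<open>q\<close> and so agree on \<delta>. If \<delta> fails at them, \<psi> and the first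
  pair show dependence; otherwise \<open>Neg \<psi>\<close> and the second pair do, because
  \<open>Neg \<delta>\<close> defines \<open>Neg \<psi>\<close>.\<close>

lemma rk_le_of_distinguished:
  assumes q: "global_type L M ts q" and "distinguished [s] p ts q"
  shows "rk_le L M N j [s] p ts q"
proof -
  have ts: "set ts \<subseteq> sorts L" using gt_sorts[OF q] .
  obtain \<psi> b b' a a' where \<psi>: "\<psi> \<in> FO U (s # ts)" and b: "b \<in> car N s" "realizes N j [b] p"
    and b': "b' \<in> car N s" "realizes N j [b'] p" and a: "a \<in> tuples N ts" "realizes N j a q"
    and a': "a' \<in> tuples N ts" "realizes N j a' q"
    and h: "holds N j (b # a) \<psi>" "\<not> holds N j (b' # a') \<psi>"
    using assms(2) unfolding distinguished_def bex_tuples_Cons by auto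
  obtain \<delta> where \<delta>: "\<delta> \<in> FO U ts" "\<And>c. c \<in> tuples M ts \<Longrightarrow> holds M id c \<delta> \<longleftrightarrow> plug (Suc 0) c \<psi> \<in> p"
    using definable[OF \<psi> ts] by blast
  have rk: "rk_le L M N j [s] p ts q"
    if "semi_isolated L N (j ` U) [s] [x] y" "x \<in> car N s" "realizes N j [x] p" "y \<in> tuples N ts" "realizes N j y q" for x y
    unfolding rk_le_def using that by (intro bexI[of _ "[x]"] bexI[of _ y]) auto
  show ?thesis
  proof (cases "holds N j a \<delta>")
    case False
    then show ?thesis using rk semi_isolated_of_dependent[OF b a(1) ts \<psi> h(1) \<delta>] a b by blast
  next
    case True
    then have "holds N j a' \<delta>"
      using realizes_iff[OF q a(2) \<delta>(1)] realizes_iff[OF q a'(2) \<delta>(1)] by simp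
    moreover have "holds M id c (Neg \<delta>) \<longleftrightarrow> plug (Suc 0) c (Neg \<psi>) \<in> p" if "c \<in> tuples M ts" for c
      using \<delta>(2)[OF that] plug_Neg_in[OF \<psi> that ts] by simp
    ultimately have "semi_isolated L N (j ` U) [s] [b'] a'"
      using semi_isolated_of_dependent[OF b' a'(1) ts, of "Neg \<psi>" "Neg \<delta>"] \<psi> h(2) \<delta>(1) by simp
    then show ?thesis using rk a' b' by blast
  qed
qed

theorem rk_minimal:
  assumes "global_type L M ts q" "\<not> algebraic M ts q" "rk_le L M N j ts q [s] p"
  shows "rk_le L M N j [s] p ts q"
proof (rule rk_le_of_distinguished[OF assms(1)])
  have "distinguished ts q [s] p" by (rule rk_le_distinguished[OF assms(1) gt s_sort assms(2,3)])
  then show "distinguished [s] p ts q"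
    by (rule distinguished_commute) (use gt_sorts[OF assms(1)] s_sort in auto)
qed

theorem not_orthogonal_iff_rk_le:
  assumes "global_type L M ts q"
  shows "\<not> orthogonal L M [s] p ts q \<longleftrightarrow> rk_le L M N j [s] p ts q"
  using not_orthogonal_iff[OF gt assms s_sort] rk_le_of_distinguished[OF assms]
    rk_le_distinguished[OF gt assms s_sort nonalg] by blast

end

section \<open>Saturation of the structure of imaginaries\<close>

text \<open>An element of sort \<open>z\<close> of the imaginary structure is the class \<open>cl z xs\<close> of a tuple \<open>xs\<close> of
  home sorts \<open>hs z\<close>.\<close>

fun hs :: "('s, 'f, 'r) eq_sort \<Rightarrow> 's list" where
  "hs (Home s) = [s]"
| "hs (Quot ss E) = ss"

fun cl :: "('s, 'f, 'r, 'a) struc \<Rightarrow> ('s, 'f, 'r) eq_sort \<Rightarrow> 'a list \<Rightarrow> ('s, 'f, 'r, 'a) eq_elem" where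
  "cl M (Home s) xs = Elem (hd xs)"
| "cl M (Quot ss E) xs = Class ss E (def_rel M ss E `` {xs})"

text \<open>A class in a carrier is non-empty, so the choice returns one of its members.\<close>

fun rep :: "('s, 'f, 'r, 'a) eq_elem \<Rightarrow> 'a list" where
  "rep (Elem a) = [a]"
| "rep (Class ss E X) = (SOME xs. xs \<in> X)"

section \<open>Blocks of quantifiers over chosen variables\<close>

primrec exv :: "('s \<times> nat) list \<Rightarrow> ('s, 'f, 'r, 'c) sfm \<Rightarrow> ('s, 'f, 'r, 'c) sfm" where
  "exv [] \<phi> = \<phi>"
| "exv (w # ws) \<phi> = Exists w (exv ws \<phi>)"

fun upds :: "('v \<Rightarrow> 'a) \<Rightarrow> 'v list \<Rightarrow> 'a list \<Rightarrow> 'v \<Rightarrow> 'a" where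
  "upds e (w # ws) (x # xs) = upds (e(w := x)) ws xs"
| "upds e _ _ = e"

lemma sat_exv: "sat M j e (exv ws \<phi>) \<longleftrightarrow> (\<exists>xs\<in>tuples M (map fst ws). sat M j (upds e ws xs) \<phi>)"
  by (induction ws arbitrary: e) (simp_all add: bex_tuples_Cons)

lemma well_sorted_exv: "well_sorted L C (exv ws \<phi>) \<longleftrightarrow> fst ` set ws \<subseteq> sorts L \<and> well_sorted L C \<phi>"
  by (induction ws) auto

lemma fv_exv: "fv (exv ws \<phi>) = fv \<phi> - set ws"
  by (induction ws) auto

lemma upds_notin: "v \<notin> set ws \<Longrightarrow> upds e ws xs v = e v"
  by (induction e ws xs rule: upds.induct) auto

lemma upds_in: "length xs = length ws \<Longrightarrow> distinct ws \<Longrightarrow> map (upds e ws xs) ws = xs"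
  by (induction e ws xs rule: upds.induct) (auto simp: upds_notin)

lemma sat_cong_fv:
  assumes "\<And>v. v \<in> fv \<phi> \<Longrightarrow> e v = e' v"
  shows "sat M j e \<phi> \<longleftrightarrow> sat M j e' \<phi>"
  using assms
proof (induction \<phi> arbitrary: e e')
  case (Rel r ts)
  then have "map (eval M j e) ts = map (eval M j e') ts" by (auto intro!: eval_cong_vars)
  then show ?case by (simp only: sat.simps)
next
  case (Equal t u)
  then have "eval M j e t = eval M j e' t" "eval M j e u = eval M j e' u" by (auto intro!: eval_cong_vars)
  then show ?case by simp
next
  case (Conj \<phi> \<psi>)
  then show ?case by (metis UnCI fv.simps(4) sat.simps(4))
next
  case (Exists v \<phi>)
  have "sat M j (e(v := a)) \<phi> \<longleftrightarrow> sat M j (e'(v := a)) \<phi>" for a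
    by (rule Exists.IH) (use Exists.prems in auto)
  then show ?case by simp
qed (metis fv.simps(3) sat.simps(3))

lemma finite_tm_vars: "finite (tm_vars t)"
  by (induction t) auto

lemma finite_fv: "finite (fv \<phi>)"
  by (induction \<phi>) (auto simp: finite_tm_vars)

lemma index_bound:
  assumes "finite W"
  shows "\<exists>K. \<forall>w\<in>W. snd w < (K :: nat)"
  using finite_imageI[OF assms, of snd] by (auto simp: finite_nat_set_iff_bounded)

lemma has_sort_Var: "fst v = s \<Longrightarrow> s \<in> sorts L \<Longrightarrow> has_sort L C (Var v) s"
  by (cases v) (auto intro: has_sort.intros)

lemma eval_car:
  assumes "has_sort L C t s" "is_structure L M" "\<And>s. s \<in> sorts L \<Longrightarrow> C s \<subseteq> car M s"
    "\<And>v. v \<in> tm_vars t \<Longrightarrow> e v \<in> car M (fst v)"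
  shows "eval M id e t \<in> car M s"
  using assms(1,4)
proof (induction rule: has_sort.induct)
  case (3 f ss s ts)
  have "map (eval M id e) ts \<in> tuples M ss"
    unfolding tuples_def mem_Collect_eq list_all2_conv_all_nth
  proof (intro conjI allI impI)
    show "length (map (eval M id e) ts) = length ss" using 3(2) by (auto dest: list_all2_lengthD)
    fix i assume i: "i < length (map (eval M id e) ts)"
    have "e v \<in> car M (fst v)" if "v \<in> tm_vars (ts ! i)" for v
      by (rule 3(3)) (use that i in \<open>auto intro!: bexI[of _ "ts ! i"]\<close>)
    then show "map (eval M id e) ts ! i \<in> car M (ss ! i)"
      using 3(2) i by (auto simp: list_all2_conv_all_nth id_def)
  qed
  then show ?case using 3(1) assms(2) by (simp add: is_structure_def id_def)
qed (use assms(3) in auto)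

lemma nth_concat:
  assumes "i < length xss" "k < length (xss ! i)"
  shows "concat xss ! (length (concat (take i xss)) + k) = xss ! i ! k"
    and "length (concat (take i xss)) + k < length (concat xss)"
proof -
  have "concat xss = concat (take i xss) @ xss ! i @ concat (drop (Suc i) xss)"
    using id_take_nth_drop[OF assms(1)] by (metis concat.simps(2) concat_append)
  then show "concat xss ! (length (concat (take i xss)) + k) = xss ! i ! k"
    and "length (concat (take i xss)) + k < length (concat xss)"
    using assms(2) by (simp_all add: nth_append)
qed

section \<open>Translation of formulas about imaginaries into the home sorts\<close>

locale imaginaries =
  fixes L :: "('s, 'f, 'r) lang" and M :: "('s, 'f, 'r, 'a) struc"
  assumes lang: "language L" and struct: "is_structure L M"
begin

abbreviation "LE \<equiv> eq_lang L M"
abbreviation "ME \<equiv> eq_struc M"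
abbreviation "ecl \<equiv> cl M"

lemma eq_sort_cases:
  assumes "z \<in> sorts LE"
  obtains s where "z = Home s" "s \<in> sorts L" | ss E where "z = Quot ss E" "def_equiv L M ss E"
  using assms by (auto simp: eq_lang_def)

lemma hs_sorts: "z \<in> sorts LE \<Longrightarrow> set (hs z) \<subseteq> sorts L"
  by (erule eq_sort_cases) (auto simp: def_equiv_def)

lemma car_eq: "z \<in> sorts LE \<Longrightarrow> car ME z = ecl z ` tuples M (hs z)"
proof (erule eq_sort_cases)
  fix s assume "z = Home s"
  moreover have "tuples M [s] = (\<lambda>x. [x]) ` car M s" by (auto simp: tuples_Cons)
  ultimately show ?thesis by (simp add: eq_struc_def image_image)
next
  fix ss E assume "z = Quot ss E"
  then show ?thesis by (auto simp: eq_struc_def quotient_def image_iff)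
qed

lemma ecl_eq_Quot:
  assumes "def_equiv L M ss E" "xs \<in> tuples M ss" "ys \<in> tuples M ss"
  shows "ecl (Quot ss E) xs = ecl (Quot ss E) ys \<longleftrightarrow> holds M (\<lambda>_. undefined) (xs @ ys) E"
  using eq_equiv_class_iff[of "tuples M ss" "def_rel M ss E" xs ys] assms
  by (auto simp: def_equiv_def def_rel_def)

lemma rep:
  assumes "z \<in> sorts LE" "c \<in> car ME z"
  shows "rep c \<in> tuples M (hs z)" "ecl z (rep c) = c"
proof -
  have "rep c \<in> tuples M (hs z) \<and> ecl z (rep c) = c"
    using assms(1)
  proof (cases rule: eq_sort_cases)
    case (1 s)
    then show ?thesis using assms(2) by (auto simp: eq_struc_def)
  next
    case (2 ss E)
    let ?R = "def_rel M ss E"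
    have R: "equiv (tuples M ss) ?R" using 2(2) by (simp add: def_equiv_def)
    obtain xs where xs: "xs \<in> tuples M ss" "c = Class ss E (?R `` {xs})"
      using assms(2) car_eq[OF assms(1)] 2(1) by auto
    have "xs \<in> ?R `` {xs}" using equiv_class_self[OF R xs(1)] .
    then have "rep c \<in> ?R `` {xs}" using xs(2) by (auto intro: someI)
    then have "(xs, rep c) \<in> ?R" by simp
    then have "rep c \<in> tuples M ss" "?R `` {rep c} = ?R `` {xs}"
      using equiv_class_eq[OF R] by (auto simp: def_rel_def)
    then show ?thesis using 2(1) xs(2) by simp
  qed
  then show "rep c \<in> tuples M (hs z)" "ecl z (rep c) = c" by auto
qed

text \<open>A class carries its sort as data, so disjointness has to be inherited from
  \<open>M\<close> only between home sorts.\<close>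

lemma eq_disj:
  assumes "z \<in> sorts LE" "z' \<in> sorts LE" "c \<in> car ME z" "c \<in> car ME z'"
  shows "z = z'"
proof -
  have "car M s \<inter> car M s' = {}" if "s \<in> sorts L" "s' \<in> sorts L" "s \<noteq> s'" for s s'
    using struct that by (auto simp: is_structure_def)
  then show ?thesis using assms
    by (elim eq_sort_cases) (auto simp: eq_struc_def)
qed

context
  fixes A :: "('s, 'f, 'r, 'a) eq_elem set"
begin

abbreviation "A_home \<equiv> \<Union>c\<in>A. set (rep c)"
abbreviation "CE \<equiv> (\<lambda>z. car ME z \<inter> A)"
abbreviation "CH \<equiv> (\<lambda>s. car M s \<inter> A_home)"

text \<open>Below \<open>h\<close> assigns to every variable of sort \<open>z\<close> a list of variables of sorts \<open>hs z\<close>.\<close>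

abbreviation "ev h e \<equiv> (\<lambda>v. ecl (fst v) (map e (h v)))"

text \<open>A term of sort \<open>z\<close> is translated to a list of home terms, whose values form
  a representative of the value of the term.\<close>

definition tm_ok where
  "tm_ok h t z us \<longleftrightarrow> list_all2 (has_sort L CH) us (hs z) \<and> (\<Union>u\<in>set us. tm_vars u) \<subseteq> (\<Union>v\<in>tm_vars t. set (h v)) \<and>
     (\<forall>e. eval ME id (ev h e) t = ecl z (map (eval M id e) us))"

text \<open>All symbols of the language of imaginaries, projections included, take arguments of home
  sorts only. These translate to single terms, so an argument list becomes a list of the same
  length.\<close>

lemma translate_home_tms:
  assumes "list_all2 (\<lambda>t z. \<exists>us. tm_ok h t z us) ts (map Home ss)"
  shows "\<exists>us. list_all2 (has_sort L CH) us ss \<and> (\<Union>u\<in>set us. tm_vars u) \<subseteq> (\<Union>t\<in>set ts. \<Union>v\<in>tm_vars t. set (h v)) \<and>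
    (\<forall>e. map (eval ME id (ev h e)) ts = map Elem (map (eval M id e) us))"
  using assms
proof (induction ss arbitrary: ts)
  case Nil
  then show ?case by simp
next
  case (Cons s ss)
  then obtain t ts' us where ts: "ts = t # ts'" "list_all2 (\<lambda>t z. \<exists>us. tm_ok h t z us) ts' (map Home ss)"
    and us: "tm_ok h t (Home s) us" by (auto simp: list_all2_Cons2)
  obtain vs where vs: "list_all2 (has_sort L CH) vs ss"
    "(\<Union>u\<in>set vs. tm_vars u) \<subseteq> (\<Union>t\<in>set ts'. \<Union>v\<in>tm_vars t. set (h v))"
    "\<forall>e. map (eval ME id (ev h e)) ts' = map Elem (map (eval M id e) vs)" using Cons.IH[OF ts(2)] by blast
  obtain u where u: "us = [u]" "has_sort L CH u s"
    using us by (auto simp: tm_ok_def list_all2_Cons2)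
  have u': "tm_vars u \<subseteq> (\<Union>v\<in>tm_vars t. set (h v))" "\<forall>e. eval ME id (ev h e) t = Elem (eval M id e u)"
    using us u(1) by (auto simp: tm_ok_def)
  show ?case
  proof (intro exI[of _ "u # vs"] conjI)
    show "list_all2 (has_sort L CH) (u # vs) (s # ss)" using u(2) vs(1) by simp
    show "(\<Union>u\<in>set (u # vs). tm_vars u) \<subseteq> (\<Union>t\<in>set ts. \<Union>v\<in>tm_vars t. set (h v))"
      unfolding ts(1) list.set(2) UN_insert by (rule Un_mono[OF u'(1) vs(2)])
    show "\<forall>e. map (eval ME id (ev h e)) ts = map Elem (map (eval M id e) (u # vs))"
      using u'(2) vs(3) ts(1) by simp
  qed
qed

text \<open>A parameter is replaced by its chosen representative, which is why the new parameters
  come from \<open>A_home\<close>. A projection disappears: its translated arguments already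
  represent the class.\<close>

lemma translate_tm:
  assumes "has_sort LE CE t z" "\<And>v. v \<in> tm_vars t \<Longrightarrow> map fst (h v) = hs (fst v)"
  shows "\<exists>us. tm_ok h t z us"
  using assms
proof (induction rule: has_sort.induct)
  case (1 z n)
  have "map fst (h (z, n)) = hs z" using 1(2)[of "(z, n)"] by simp
  then have "list_all2 (has_sort L CH) (map Var (h (z, n))) (hs z)"
    using hs_sorts[OF 1(1)] unfolding list_all2_map1
    by (auto simp: list_all2_conv_all_nth list_eq_iff_nth_eq subset_iff intro!: has_sort_Var)
  then show ?case by (intro exI[of _ "map Var (h (z, n))"]) (auto simp: tm_ok_def o_def)
next
  case (2 z c)
  have "list_all2 (has_sort L CH) (map Par (rep c)) (hs z)"
    unfolding list_all2_conv_all_nth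
  proof (intro conjI allI impI)
    have c: "rep c \<in> tuples M (hs z)" using rep(1)[OF 2(1)] 2(2) by blast
    show "length (map Par (rep c)) = length (hs z)" using tuples_length[OF c] by simp
    fix i assume "i < length (map Par (rep c))"
    then show "has_sort L CH (map Par (rep c) ! i) (hs z ! i)"
      using tuples_nth[OF c, of i] tuples_length[OF c] hs_sorts[OF 2(1)] 2(2)
      by (auto intro!: has_sort.intros)
  qed
  then show ?case using rep(2)[OF 2(1), of c] 2(2)
    by (intro exI[of _ "map Par (rep c)"]) (auto simp: tm_ok_def o_def)
next
  case (3 f zs z ts)
  have ok: "list_all2 (\<lambda>t z. \<exists>us. tm_ok h t z us) ts zs"
    using 3(2)
  proof (rule list.rel_mono_strong)
    fix t z assume "t \<in> set ts"
      and IH: "has_sort LE CE t z \<and> ((\<forall>v. v \<in> tm_vars t \<longrightarrow> map fst (h v) = hs (fst v)) \<longrightarrow> (\<exists>us. tm_ok h t z us))"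
    then have "map fst (h v) = hs (fst v)" if "v \<in> tm_vars t" for v
      using 3(3)[of v] that by auto
    with IH show "\<exists>us. tm_ok h t z us" by blast
  qed
  show ?case
  proof (cases f)
    case (Base g)
    then obtain ss s where g: "fsig L g = Some (ss, s)" "zs = map Home ss" "z = Home s"
      using 3(1) by (auto simp: eq_lang_def)
    obtain us where us: "list_all2 (has_sort L CH) us ss"
      "(\<Union>u\<in>set us. tm_vars u) \<subseteq> (\<Union>t\<in>set ts. \<Union>v\<in>tm_vars t. set (h v))"
      "\<forall>e. map (eval ME id (ev h e)) ts = map Elem (map (eval M id e) us)"
      using translate_home_tms[OF ok[unfolded g(2)]] by blast
    have "has_sort L CH (Fun g us) s" using g(1) us(1) by (rule has_sort.intros)
    moreover have "eval ME id (ev h e) (Fun f ts) = ecl z (map (eval M id e) [Fun g us])" for e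
      unfolding eval.simps us(3)[rule_format] using Base g by (simp add: eq_struc_def o_def)
    ultimately show ?thesis using g us(2) by (intro exI[of _ "[Fun g us]"]) (auto simp: tm_ok_def)
  next
    case (Proj ss E)
    then have g: "def_equiv L M ss E" "zs = map Home ss" "z = Quot ss E"
      using 3(1) by (auto simp: eq_lang_def split: if_splits)
    obtain us where us: "list_all2 (has_sort L CH) us ss"
      "(\<Union>u\<in>set us. tm_vars u) \<subseteq> (\<Union>t\<in>set ts. \<Union>v\<in>tm_vars t. set (h v))"
      "\<forall>e. map (eval ME id (ev h e)) ts = map Elem (map (eval M id e) us)"
      using translate_home_tms[OF ok[unfolded g(2)]] by blast
    have "eval ME id (ev h e) (Fun f ts) = ecl z (map (eval M id e) us)" for e
      unfolding eval.simps us(3)[rule_format] using Proj g by (simp add: eq_struc_def o_def)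
    then show ?thesis using g us(1,2) by (intro exI[of _ us]) (auto simp: tm_ok_def)
  qed
qed

text \<open>Assignments must respect sorts here because of equality in quotient sorts: the relation
  defined by \<open>E\<close> is restricted to tuples in the carriers, and only there does equality
  of classes amount to \<open>E\<close>.\<close>

definition fm_ok where
  "fm_ok h \<Phi> \<phi> \<longleftrightarrow> well_sorted L CH \<phi> \<and> fv \<phi> \<subseteq> (\<Union>v\<in>fv \<Phi>. set (h v)) \<and>
     (\<forall>e. (\<forall>w\<in>(\<Union>v\<in>fv \<Phi>. set (h v)). e w \<in> car M (fst w)) \<longrightarrow> (sat M id e \<phi> \<longleftrightarrow> sat ME id (ev h e) \<Phi>))"

lemma translate_Equal:
  assumes "has_sort LE CE t z" "has_sort LE CE u z" "z \<in> sorts LE"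
    "\<And>v. v \<in> fv (Equal t u) \<Longrightarrow> map fst (h v) = hs (fst v)"
  shows "\<exists>\<phi>. fm_ok h (Equal t u) \<phi>"
proof -
  obtain ts us where ts: "tm_ok h t z ts" and us: "tm_ok h u z us"
    using translate_tm[OF assms(1), of h] translate_tm[OF assms(2), of h] assms(4) by auto
  show ?thesis using assms(3)
  proof (cases rule: eq_sort_cases)
    case (1 s)
    then obtain t' u' where "ts = [t']" "us = [u']" "has_sort L CH t' s" "has_sort L CH u' s"
      using ts us by (auto simp: tm_ok_def list_all2_Cons2)
    with ts us 1 show ?thesis by (intro exI[of _ "Equal t' u'"]) (auto simp: tm_ok_def fm_ok_def)
  next
    case (2 ss E)
    have E: "E \<in> fmlas L (\<lambda>_. {}) (ss @ ss)" using 2(2) by (simp add: def_equiv_def)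
    have sorted: "list_all2 (has_sort L CH) ts ss" "list_all2 (has_sort L CH) us ss"
      using ts us 2(1) by (auto simp: tm_ok_def)
    have "finite (\<Union>x\<in>set (ts @ us). tm_vars x)" using finite_tm_vars by auto
    then obtain K where "\<forall>w\<in>(\<Union>x\<in>set (ts @ us). tm_vars x). snd w < K" using index_bound by meson
    then have K: "snd w < K" if "x \<in> set (ts @ us)" "w \<in> tm_vars x" for x w
      using that by blast
    \<comment> \<open>\<open>K\<close> exceeds every index in the substituted terms, so no
      quantifier of \<open>E\<close> captures a variable. \<open>E\<close> has no parameters;
      \<open>Par undefined\<close> is an arbitrary value for their image.\<close>
    let ?\<phi> = "tsub K (ts @ us) (\<lambda>_. Par undefined) E"
    have ws: "well_sorted L CH ?\<phi>"
      by (rule well_sorted_tsub[OF E]) (use sorted in \<open>auto intro: list_all2_appendI\<close>)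
    have len: "length (ts @ us) = length (ss @ ss)"
      using sorted[THEN list_all2_lengthD] by simp
    have "fv ?\<phi> \<subseteq> (\<Union>x\<in>set (ts @ us). tm_vars x)" by (rule tsub_fv[OF E len]) simp
    also have "\<dots> \<subseteq> (\<Union>v\<in>fv (Equal t u). set (h v))" using ts us unfolding tm_ok_def by auto
    finally have fv: "fv ?\<phi> \<subseteq> (\<Union>v\<in>fv (Equal t u). set (h v))" .
    have "sat M id e ?\<phi> \<longleftrightarrow> sat ME id (ev h e) (Equal t u)"
      if e: "\<forall>w\<in>(\<Union>v\<in>fv (Equal t u). set (h v)). e w \<in> car M (fst w)" for e
    proof -
      have tup: "map (eval M id e) xs \<in> tuples M ss"
        if "list_all2 (has_sort L CH) xs ss" "(\<Union>x\<in>set xs. tm_vars x) \<subseteq> (\<Union>v\<in>fv (Equal t u). set (h v))" for xs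
        unfolding tuples_def mem_Collect_eq list_all2_conv_all_nth
      proof (intro conjI allI impI)
        show "length (map (eval M id e) xs) = length ss" using that(1) by (auto dest: list_all2_lengthD)
        fix i assume i: "i < length (map (eval M id e) xs)"
        have "eval M id e (xs ! i) \<in> car M (ss ! i)"
        proof (rule eval_car[OF _ struct])
          show "has_sort L CH (xs ! i) (ss ! i)" using that(1) i by (auto simp: list_all2_conv_all_nth)
          fix v assume "v \<in> tm_vars (xs ! i)"
          moreover have "xs ! i \<in> set xs" using i by simp
          ultimately have "v \<in> (\<Union>x\<in>set xs. tm_vars x)" by blast
          then show "e v \<in> car M (fst v)" using e subsetD[OF that(2)] by simp
        qed simp
        then show "map (eval M id e) xs ! i \<in> car M (ss ! i)" using i by simp
      qed
      have tt: "map (eval M id e) ts \<in> tuples M ss" "map (eval M id e) us \<in> tuples M ss"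
      proof -
        have "(\<Union>x\<in>set ts. tm_vars x) \<subseteq> (\<Union>v\<in>tm_vars t. set (h v))" using ts by (simp add: tm_ok_def)
        also have "\<dots> \<subseteq> (\<Union>v\<in>fv (Equal t u). set (h v))" by (rule UN_mono) auto
        finally show "map (eval M id e) ts \<in> tuples M ss" by (rule tup[OF sorted(1)])
        have "(\<Union>x\<in>set us. tm_vars x) \<subseteq> (\<Union>v\<in>tm_vars u. set (h v))" using us by (simp add: tm_ok_def)
        also have "\<dots> \<subseteq> (\<Union>v\<in>fv (Equal t u). set (h v))" by (rule UN_mono) auto
        finally show "map (eval M id e) us \<in> tuples M ss" by (rule tup[OF sorted(2)])
      qed
      have "sat M id e ?\<phi> \<longleftrightarrow> holds M (\<lambda>c. eval M id e (Par undefined)) (map (eval M id e) (ts @ us)) E"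
        by (rule sat_tsub[OF E len]) (use K in auto)
      also have "\<dots> \<longleftrightarrow> holds M (\<lambda>_. undefined) (map (eval M id e) ts @ map (eval M id e) us) E"
        by simp
      also have "\<dots> \<longleftrightarrow> ecl z (map (eval M id e) ts) = ecl z (map (eval M id e) us)"
        unfolding 2(1) by (rule ecl_eq_Quot[OF 2(2) tt, symmetric])
      also have "\<dots> \<longleftrightarrow> sat ME id (ev h e) (Equal t u)" using ts us by (simp add: tm_ok_def)
      finally show ?thesis .
    qed
    with ws fv show ?thesis unfolding fm_ok_def by blast
  qed
qed

text \<open>A quantifier over an imaginary sort becomes a block of quantifiers over representatives.
  The list \<open>h v\<close> may share variables with the lists of other free variables, so it is
  replaced by a fresh one; this is why the induction hypothesis ranges over all
  \<open>h\<close>.\<close>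

lemma translate_Exists:
  assumes z: "fst v \<in> sorts LE" and h: "\<And>u. u \<in> fv (Exists v \<Phi>) \<Longrightarrow> map fst (h u) = hs (fst u)"
    and IH: "\<And>h. (\<And>u. u \<in> fv \<Phi> \<Longrightarrow> map fst (h u) = hs (fst u)) \<Longrightarrow> \<exists>\<phi>. fm_ok h \<Phi> \<phi>"
  shows "\<exists>\<phi>. fm_ok h (Exists v \<Phi>) \<phi>"
proof -
  let ?W = "\<Union>u\<in>fv \<Phi> - {v}. set (h u)"
  have "finite ?W" using finite_fv by auto
  then obtain K where K: "\<forall>w\<in>?W. snd w < K" using index_bound by meson
  \<comment> \<open>Indices from \<open>K\<close> on avoid the lists belonging to the other free
    variables.\<close>
  let ?vs = "map (\<lambda>i. (hs (fst v) ! i, K + i)) [0..<length (hs (fst v))]"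
  obtain ws where ws: "map fst ws = hs (fst v)" "distinct ws" "set ws \<inter> ?W = {}"
  proof
    show "map fst ?vs = hs (fst v)" by (simp add: o_def map_nth)
    show "distinct ?vs" by (simp add: distinct_map inj_on_def)
    have "w \<notin> ?W" if "w \<in> set ?vs" for w
    proof
      assume "w \<in> ?W"
      with K have "snd w < K" by blast
      with that show False by auto
    qed
    then show "set ?vs \<inter> ?W = {}" by blast
  qed
  have ws_len: "length ws = length (hs (fst v))" using ws(1) by (metis length_map)
  let ?h = "h(v := ws)"
  have "map fst (?h u) = hs (fst u)" if "u \<in> fv \<Phi>" for u using h[of u] ws(1) that by simp
  then obtain \<phi> where \<phi>: "fm_ok ?h \<Phi> \<phi>" using IH by blast
  have fvs: "(\<Union>u\<in>fv \<Phi>. set (?h u)) \<subseteq> ?W \<union> set ws"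
  proof
    fix w assume "w \<in> (\<Union>u\<in>fv \<Phi>. set (?h u))"
    then obtain u where u: "u \<in> fv \<Phi>" "w \<in> set (?h u)" by blast
    show "w \<in> ?W \<union> set ws"
    proof (cases "u = v")
      case True
      with u(2) show ?thesis by (simp only: fun_upd_same) blast
    next
      case False
      then have "w \<in> set (h u)" using u(2) by simp
      then show ?thesis using u(1) False by blast
    qed
  qed
  have "sat M id e (exv ws \<phi>) \<longleftrightarrow> sat ME id (ev h e) (Exists v \<Phi>)"
    if e: "\<forall>w\<in>?W. e w \<in> car M (fst w)" for e
  proof -
    have "sat M id (upds e ws xs) \<phi> \<longleftrightarrow> sat ME id ((ev h e)(v := ecl (fst v) xs)) \<Phi>"
      if xs: "xs \<in> tuples M (hs (fst v))" for xs
    proof -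
      have m: "map (upds e ws xs) ws = xs"
        by (rule upds_in[OF _ ws(2)]) (use tuples_length[OF xs] ws_len in simp)
      have "upds e ws xs w \<in> car M (fst w)" if "w \<in> (\<Union>u\<in>fv \<Phi>. set (?h u))" for w
      proof (cases "w \<in> set ws")
        case True
        then obtain i where i: "i < length ws" "w = ws ! i" by (metis in_set_conv_nth)
        then have "upds e ws xs w = xs ! i" using m by (metis nth_map)
        moreover have "fst w = hs (fst v) ! i" "i < length (hs (fst v))"
          using i ws(1) ws_len by (metis nth_map)+
        ultimately show ?thesis using tuples_nth[OF xs] by simp
      next
        case False
        then have "w \<in> ?W" using that fvs by blast
        then show ?thesis using e unfolding upds_notin[OF False] by blast
      qed
      then have "sat M id (upds e ws xs) \<phi> \<longleftrightarrow> sat ME id (ev ?h (upds e ws xs)) \<Phi>"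
        using \<phi> unfolding fm_ok_def by blast
      also have "\<dots> \<longleftrightarrow> sat ME id ((ev h e)(v := ecl (fst v) xs)) \<Phi>"
      proof (rule sat_cong_fv)
        fix u assume u: "u \<in> fv \<Phi>"
        show "ev ?h (upds e ws xs) u = ((ev h e)(v := ecl (fst v) xs)) u"
        proof (cases "u = v")
          case True
          then show ?thesis using m by simp
        next
          case False
          then have "map (upds e ws xs) (h u) = map e (h u)"
            using u ws(3) by (intro map_cong refl upds_notin) auto
          then show ?thesis using False by (simp only: fun_upd_apply if_False)
        qed
      qed
      finally show ?thesis .
    qed
    then show ?thesis unfolding sat_exv ws(1) sat.simps car_eq[OF z] by blast
  qed
  moreover have "well_sorted L CH (exv ws \<phi>)"
    using \<phi> hs_sorts[OF z] ws(1) unfolding well_sorted_exv fm_ok_def by (metis set_map)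
  moreover have "fv (exv ws \<phi>) \<subseteq> ?W" using \<phi> fvs unfolding fv_exv fm_ok_def by blast
  ultimately show ?thesis unfolding fm_ok_def fv.simps by blast
qed

lemma translate_fm:
  assumes "well_sorted LE CE \<Phi>" "\<And>v. v \<in> fv \<Phi> \<Longrightarrow> map fst (h v) = hs (fst v)"
  shows "\<exists>\<phi>. fm_ok h \<Phi> \<phi>"
  using assms
proof (induction \<Phi> arbitrary: h)
  case (Equal t u)
  then obtain z where z: "has_sort LE CE t z" "has_sort LE CE u z" by auto
  have "z \<in> sorts LE" using z(1)
  proof (cases rule: has_sort.cases)
    case (3 f ss ts)
    then show ?thesis using lang by (cases f) (auto simp: eq_lang_def language_def split: if_splits)
  qed auto
  then show ?case using translate_Equal[OF z] Equal(2) by blast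
next
  case (Rel r ts)
  then obtain ss where ss: "rsig L r = Some ss" "list_all2 (has_sort LE CE) ts (map Home ss)"
    by (auto simp: eq_lang_def)
  have "list_all2 (\<lambda>t z. \<exists>us. tm_ok h t z us) ts (map Home ss)"
    using ss(2)
  proof (rule list.rel_mono_strong)
    fix t z assume "t \<in> set ts" "has_sort LE CE t z"
    then show "\<exists>us. tm_ok h t z us" using translate_tm[of t z h] Rel(2) by auto
  qed
  from translate_home_tms[OF this] obtain us where us: "list_all2 (has_sort L CH) us ss"
      "(\<Union>u\<in>set us. tm_vars u) \<subseteq> (\<Union>t\<in>set ts. \<Union>v\<in>tm_vars t. set (h v))"
      "\<forall>e. map (eval ME id (ev h e)) ts = map Elem (map (eval M id e) us)"
    by blast
  have "sat M id e (Rel r us) \<longleftrightarrow> sat ME id (ev h e) (Rel r ts)" for e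
    unfolding sat.simps us(3)[rule_format] 
    by (simp add: eq_struc_def inj_image_mem_iff[OF inj_mapI] inj_def del: map_map)
  then show ?case using ss(1) us(1,2) by (intro exI[of _ "Rel r us"]) (auto simp: fm_ok_def)
next
  case (Neg \<Phi>)
  have "\<exists>\<phi>. fm_ok h \<Phi> \<phi>"
    by (rule Neg.IH) (use Neg.prems in \<open>simp_all only: well_sorted.simps fv.simps\<close>)
  then obtain \<phi> where "fm_ok h \<Phi> \<phi>" by blast
  then show ?case by (intro exI[of _ "Neg \<phi>"]) (auto simp: fm_ok_def)
next
  case (Conj \<Phi> \<Psi>)
  have "\<exists>\<phi>. fm_ok h \<Phi> \<phi>"
    by (rule Conj.IH(1)) (use Conj.prems in \<open>simp_all only: well_sorted.simps fv.simps Un_iff simp_thms\<close>)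
  moreover have "\<exists>\<psi>. fm_ok h \<Psi> \<psi>"
    by (rule Conj.IH(2)) (use Conj.prems in \<open>simp_all only: well_sorted.simps fv.simps Un_iff simp_thms\<close>)
  ultimately obtain \<phi> \<psi> where "fm_ok h \<Phi> \<phi>" "fm_ok h \<Psi> \<psi>" by blast
  then have ok: "fm_ok h \<Phi> \<phi>" "fm_ok h \<Psi> \<psi>" by auto
  have "sat M id e (Conj \<phi> \<psi>) \<longleftrightarrow> sat ME id (ev h e) (Conj \<Phi> \<Psi>)"
    if "\<forall>w\<in>(\<Union>v\<in>fv (Conj \<Phi> \<Psi>). set (h v)). e w \<in> car M (fst w)" for e
  proof -
    have "sat M id e \<phi> \<longleftrightarrow> sat ME id (ev h e) \<Phi>" "sat M id e \<psi> \<longleftrightarrow> sat ME id (ev h e) \<Psi>"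
      using that ok unfolding fm_ok_def fv.simps by (blast, blast)
    then show ?thesis unfolding sat.simps by blast
  qed
  moreover have "fv (Conj \<phi> \<psi>) \<subseteq> (\<Union>v\<in>fv (Conj \<Phi> \<Psi>). set (h v))"
    using ok unfolding fm_ok_def fv.simps UN_Un by blast
  moreover have "well_sorted L CH (Conj \<phi> \<psi>)" using ok by (simp add: fm_ok_def)
  ultimately show ?case unfolding fm_ok_def by blast
next
  case (Exists v \<Phi>)
  show ?case
    by (rule translate_Exists[OF _ Exists.prems(2) Exists.IH]) (use Exists.prems(1) in simp_all)
qed

end

end

text \<open>A tuple of imaginaries is represented by the concatenation of representatives of its
  entries. A set of formulas about imaginaries thus becomes one about home tuples, over the
  representatives of its parameters. These form a small set, because each representative is
  finite.\<close>

theorem saturated_eq: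
  fixes L :: "('s, 'f, 'r) lang" and M :: "('s, 'f, 'r, 'a) struc"
  assumes "sat_structure L \<kappa> M" "language L" "is_structure L M"
  shows "saturated (eq_lang L M) \<kappa> (eq_struc M)"
proof -
  interpret sat_structure L \<kappa> M by fact
  interpret imaginaries L M by unfold_locales fact+
  have "\<exists>xs\<in>tuples ME zs. realizes ME id xs \<Sigma>"
    if A: "A \<subseteq> univ LE ME" "small \<kappa> A" and zs: "set zs \<subseteq> sorts LE"
      and \<Sigma>: "\<Sigma> \<subseteq> fmlas_over LE ME A zs" and fs: "finitely_satisfiable ME zs \<Sigma>" for A zs \<Sigma>
  proof -
    let ?B = "\<Union>c\<in>A. set (rep c)"
    have BU: "?B \<subseteq> U"
    proof
      fix x assume "x \<in> ?B"
      then obtain c z where c: "c \<in> A" "x \<in> set (rep c)" "z \<in> sorts LE" "c \<in> car ME z"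
        using A(1) by (auto simp: univ_def)
      then show "x \<in> U" using tuplesU[OF rep(1)[OF c(3,4)] hs_sorts[OF c(3)]] by auto
    qed
    have Bsmall: "small \<kappa> ?B"
    proof (cases "finite A")
      case True
      then show ?thesis by (intro small_finite) auto
    next
      case False
      have "|?B| \<le>o |A|"
      proof (rule card_of_UNION_ordLeq_infinite[OF False])
        show "|A| \<le>o |A|" by (rule ordLeq_refl) (rule card_of_Card_order)
        show "\<forall>c\<in>A. |set (rep c)| \<le>o |A|"
          using False
          by (auto intro!: ordLess_imp_ordLeq finite_ordLess_infinite simp: Field_card_of intro: card_of_Well_order[unfolded Field_card_of])
      qed
      then show ?thesis using A(2) unfolding small_def by (rule ordLeq_ordLess_trans)
    qed
    let ?xss = "map hs zs"
    let ?us = "concat ?xss"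
    let ?off = "\<lambda>i. length (concat (take i ?xss))"
    \<comment> \<open>The variable at position \<open>i\<close> becomes a block of home variables
      that starts at \<open>?off i\<close>, where the blocks of the earlier variables end.\<close>
    define h where "h = (\<lambda>v :: ('s, 'f, 'r) eq_sort \<times> nat.
      map (\<lambda>k. (hs (fst v) ! k, ?off (snd v) + k)) [0..<length (hs (fst v))])"
    \<comment> \<open>\<open>pr\<close> reads a home tuple in blocks and takes the class of
      each.\<close>
    define pr where "pr xs = map (\<lambda>i. ecl (zs ! i) (map (\<lambda>k. xs ! (?off i + k)) [0..<length (hs (zs ! i))])) [0..<length zs]"
      for xs
    have us: "set ?us \<subseteq> sorts L" using hs_sorts zs by auto
    have h_sorts: "map fst (h v) = hs (fst v)" for v by (simp add: h_def o_def map_nth)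
    have h_var: "w \<in> vars_of ?us" if iw: "i < length zs" "w \<in> set (h (zs ! i, i))" for i w
    proof -
      obtain k where k: "k < length (hs (zs ! i))" "w = (hs (zs ! i) ! k, ?off i + k)"
        using iw(2) by (auto simp: h_def)
      then show ?thesis using nth_concat[of i ?xss k] iw(1) by (auto simp: vars_of_def)
    qed
    have "\<forall>\<Phi>\<in>\<Sigma>. \<exists>\<phi>. fm_ok A h \<Phi> \<phi>"
    proof
      fix \<Phi> assume "\<Phi> \<in> \<Sigma>"
      then have "well_sorted LE (\<lambda>z. car ME z \<inter> A) \<Phi>" using \<Sigma> by (auto simp: fmlas_over_def fmlas_iff)
      then show "\<exists>\<phi>. fm_ok A h \<Phi> \<phi>" by (rule translate_fm) (rule h_sorts)
    qed
    then obtain tr where tr: "\<And>\<Phi>. \<Phi> \<in> \<Sigma> \<Longrightarrow> fm_ok A h \<Phi> (tr \<Phi>)" by metis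
    have fv\<Sigma>: "(\<Union>v\<in>fv \<Phi>. set (h v)) \<subseteq> vars_of ?us" if "\<Phi> \<in> \<Sigma>" for \<Phi>
    proof
      fix w assume "w \<in> (\<Union>v\<in>fv \<Phi>. set (h v))"
      then obtain v where v: "v \<in> fv \<Phi>" "w \<in> set (h v)" by blast
      have "v \<in> vars_of zs" using fmlas_fv v(1) subsetD[OF \<Sigma> that] unfolding fmlas_over_def by metis
      then obtain i where "v = (zs ! i, i)" "i < length zs" by (rule vars_ofE)
      then show "w \<in> vars_of ?us" using h_var[of i w] v(2) by simp
    qed
    have hold: "holds M id xs (tr \<Phi>) \<longleftrightarrow> holds ME id (pr xs) \<Phi>" if "\<Phi> \<in> \<Sigma>" "xs \<in> tuples M ?us" for \<Phi> xs
    proof -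
      have "\<forall>w\<in>(\<Union>v\<in>fv \<Phi>. set (h v)). val xs w \<in> car M (fst w)"
      proof
        fix w assume "w \<in> (\<Union>v\<in>fv \<Phi>. set (h v))"
        then have "w \<in> vars_of ?us" using fv\<Sigma>[OF that(1)] by blast
        then obtain i where "w = (?us ! i, i)" "i < length ?us" by (rule vars_ofE)
        then show "val xs w \<in> car M (fst w)" using tuples_nth[OF that(2), of i] by simp
      qed
      then have "holds M id xs (tr \<Phi>) \<longleftrightarrow> sat ME id (\<lambda>v. ecl (fst v) (map (val xs) (h v))) \<Phi>"
        using tr[OF that(1)] unfolding fm_ok_def holds_val by blast
      also have "\<dots> \<longleftrightarrow> holds ME id (pr xs) \<Phi>"
        unfolding holds_val
      proof (rule sat_cong_fv)
        fix v assume "v \<in> fv \<Phi>"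
        then have "v \<in> vars_of zs" using fmlas_fv subsetD[OF \<Sigma> that(1)] unfolding fmlas_over_def by metis
        then obtain i where "v = (zs ! i, i)" "i < length zs" by (rule vars_ofE)
        then show "ecl (fst v) (map (val xs) (h v)) = val (pr xs) v"
          by (simp add: h_def pr_def o_def)
      qed
      finally show ?thesis .
    qed
    have pr_tup: "pr xs \<in> tuples ME zs" if "xs \<in> tuples M ?us" for xs
      unfolding tuples_def mem_Collect_eq list_all2_conv_all_nth
    proof (intro conjI allI impI)
      show "length (pr xs) = length zs" by (simp add: pr_def)
      fix i assume "i < length (pr xs)"
      then have i: "i < length zs" "zs ! i \<in> sorts LE" using zs by (auto simp: pr_def)
      have "map (\<lambda>k. xs ! (?off i + k)) [0..<length (hs (zs ! i))] \<in> tuples M (hs (zs ! i))"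
        unfolding tuples_def mem_Collect_eq list_all2_conv_all_nth
      proof (intro conjI allI impI)
        fix k assume "k < length (map (\<lambda>k. xs ! (?off i + k)) [0..<length (hs (zs ! i))])"
        then have k: "k < length (hs (zs ! i))" by simp
        have "?us ! (?off i + k) = hs (zs ! i) ! k" "?off i + k < length ?us"
          using nth_concat[of i ?xss k] i(1) k by simp_all
        then show "map (\<lambda>k. xs ! (?off i + k)) [0..<length (hs (zs ! i))] ! k \<in> car M (hs (zs ! i) ! k)"
          using tuples_nth[OF that, of "?off i + k"] k by simp
      qed simp
      then show "pr xs ! i \<in> car ME (zs ! i)" using car_eq[OF i(2)] i(1) by (simp add: pr_def)
    qed
    \<comment> \<open>Surjectivity transfers finite satisfiability: a solution among the imaginaries
      lifts to a solution in home sorts.\<close>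
    have pr_surj: "\<exists>xs\<in>tuples M ?us. pr xs = ys" if ys: "ys \<in> tuples ME zs" for ys
    proof -
      let ?yss = "map rep ys"
      have len: "length ys = length zs" using tuples_length[OF ys] .
      have r: "rep (ys ! i) \<in> tuples M (hs (zs ! i))" "ecl (zs ! i) (rep (ys ! i)) = ys ! i" if "i < length zs" for i
        using rep[of "zs ! i" "ys ! i"] tuples_nth[OF ys that] subsetD[OF zs nth_mem[OF that]] by auto
      have lens: "map length ?yss = map length ?xss"
        using len tuples_length[OF r(1)] by (intro nth_equalityI) simp_all
      have off: "length (concat (take i ?yss)) = ?off i" for i
        unfolding length_concat take_map[symmetric] lens ..
      have "concat ?yss \<in> tuples M ?us"
      proof -
        have "list_all2 (\<lambda>xs ss. xs \<in> tuples M ss) ?yss ?xss"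
          using len r(1) by (auto simp: list_all2_conv_all_nth)
        then show ?thesis by (induction rule: list_all2_induct) (auto intro: tuples_appendI)
      qed
      moreover have "pr (concat ?yss) = ys"
      proof (rule nth_equalityI)
        show "length (pr (concat ?yss)) = length ys" using len by (simp add: pr_def)
        fix i assume "i < length (pr (concat ?yss))"
        then have i: "i < length zs" by (simp add: pr_def)
        have "map (\<lambda>k. concat ?yss ! (?off i + k)) [0..<length (hs (zs ! i))] = rep (ys ! i)"
        proof (rule nth_equalityI)
          show l: "length (map (\<lambda>k. concat ?yss ! (?off i + k)) [0..<length (hs (zs ! i))]) = length (rep (ys ! i))"
            using tuples_length[OF r(1)[OF i]] by simp
          fix k assume "k < length (map (\<lambda>k. concat ?yss ! (?off i + k)) [0..<length (hs (zs ! i))])"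
          then show "map (\<lambda>k. concat ?yss ! (?off i + k)) [0..<length (hs (zs ! i))] ! k = rep (ys ! i) ! k"
            using nth_concat(1)[of i ?yss k] off[of i] i len l by simp
        qed
        then show "pr (concat ?yss) ! i = ys ! i" using r(2)[OF i] i by (simp add: pr_def)
      qed
      ultimately show ?thesis by blast
    qed
    have "\<exists>xs\<in>tuples M ?us. \<forall>\<Phi>\<in>\<Sigma>. holds M id xs (tr \<Phi>)"
    proof (rule realize_family[OF BU Bsmall us])
      show "tr \<Phi> \<in> FO ?B ?us" if "\<Phi> \<in> \<Sigma>" for \<Phi>
        using tr[OF that] fv\<Sigma>[OF that] unfolding fm_ok_def fmlas_over_def fmlas_iff by blast
      fix F assume F: "finite F" "F \<subseteq> \<Sigma>"
      then obtain ys where ys: "ys \<in> tuples ME zs" "realizes ME id ys F"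
        using fs unfolding finitely_satisfiable_def by blast
      obtain xs where xs: "xs \<in> tuples M ?us" "pr xs = ys" using pr_surj[OF ys(1)] by blast
      have "\<forall>\<Phi>\<in>F. holds M id xs (tr \<Phi>)"
        using hold[OF _ xs(1)] subsetD[OF F(2)] ys(2) xs(2) by (simp add: realizes_def)
      with xs(1) show "\<exists>xs\<in>tuples M ?us. \<forall>\<Phi>\<in>F. holds M id xs (tr \<Phi>)" by blast
    qed
    then obtain xs where xs: "xs \<in> tuples M ?us" "\<forall>\<Phi>\<in>\<Sigma>. holds M id xs (tr \<Phi>)" by blast
    have "realizes ME id (pr xs) \<Sigma>" using hold[OF _ xs(1)] xs(2) by (simp add: realizes_def)
    then show ?thesis using pr_tup[OF xs(1)] by blast
  qed
  then show ?thesis unfolding saturated_def by blast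
qed

theorem theorem2:
  fixes L :: "('s, 'f, 'r) lang"
    and T :: "('s, 'f, 'r, unit) sfm set"
    and M :: "('s, 'f, 'r, 'a) struc"
    and \<kappa> :: "'k rel"
    and N :: "(('s, 'f, 'r) eq_sort, ('s, 'f, 'r) eq_fun, 'r, 'b) struc"
    and \<mu> :: "'l rel"
    and j :: "('s, 'f, 'r, 'a) eq_elem \<Rightarrow> 'b"
    and s :: "('s, 'f, 'r) eq_sort"
    and p :: "(('s, 'f, 'r) eq_sort, ('s, 'f, 'r) eq_fun, 'r, ('s, 'f, 'r, 'a) eq_elem) sfm set"
  assumes "language L"
    and "complete_theory L T"
    and "monster_model L T \<kappa> M"
    and "larger_monster (eq_lang L M) (eq_struc M) \<mu> N j"
    and "global_type (eq_lang L M) (eq_struc M) [s] p"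
    and "generically_stable (eq_lang L M) \<kappa> (eq_struc M) [s] p"
    and "strongly_regular (eq_lang L M) \<kappa> (eq_struc M) s p"
  shows "(\<forall>ts q. global_type (eq_lang L M) (eq_struc M) ts q \<and> \<not> algebraic (eq_struc M) ts q \<longrightarrow>
            rk_le (eq_lang L M) (eq_struc M) N j ts q [s] p \<longrightarrow>
            rk_le (eq_lang L M) (eq_struc M) N j [s] p ts q) \<and>
         (\<forall>ts q. global_type (eq_lang L M) (eq_struc M) ts q \<and> invariant_type (eq_lang L M) \<kappa> (eq_struc M) ts q \<longrightarrow>
            (\<not> orthogonal (eq_lang L M) (eq_struc M) [s] p ts q \<longleftrightarrow>
             rk_le (eq_lang L M) (eq_struc M) N j [s] p ts q))"
proof -
  let ?L = "eq_lang L M" and ?M = "eq_struc M"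
  have M: "is_structure L M" "Card_order \<kappa>" "natLeq <o \<kappa>" "saturated L \<kappa> M"
    using assms(3) by (simp_all add: monster_model_def)
  have N: "is_structure ?L N" "Card_order \<mu>" "natLeq <o \<mu>" "saturated ?L \<mu> N"
    "small \<mu> (univ ?L ?M)" "elementary_on ?L ?M N (univ ?L ?M) j"
    using assms(4) by (simp_all add: larger_monster_def monster_model_def)
  have M_sat: "sat_structure L \<kappa> M" by (rule sat_structureI[OF M])
  \<comment> \<open>The saturation assumed of \<open>M\<close> concerns home sorts, while
    \<open>p\<close> and \<open>q\<close> are types of its imaginaries. \<open>N\<close> is a model
    in the language of imaginaries from the start.\<close>
  have "saturated ?L \<kappa> ?M" by (rule saturated_eq[OF M_sat assms(1) M(1)])
  then have E_sat: "sat_structure ?L \<kappa> ?M"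
    using imaginaries.eq_disj[OF imaginaries.intro[OF assms(1) M(1)]] M(2,3)
    by (simp add: sat_structure_def)
  have N_sat: "sat_structure ?L \<mu> N" by (rule sat_structureI[OF N(1-4)])
  obtain A where A: "gs_type ?L \<kappa> ?M s p A"
    using assms(6) E_sat unfolding generically_stable_def gs_type_def gs_type_axioms_def by blast
  obtain \<phi> where "strongly_regular_pair ?L \<kappa> ?M s p \<phi>"
    using assms(7) unfolding strongly_regular_def by blast
  then have "\<exists>A'. sr_type_axioms ?L \<kappa> ?M s p \<phi> A'"
    unfolding strongly_regular_pair_def sr_type_axioms_def by (rule ex_forward) simp
  then obtain A' where "sr_type_axioms ?L \<kappa> ?M s p \<phi> A'" ..
  with A have "sr_type ?L \<kappa> ?M s p A \<phi> A'" by (rule sr_type.intro)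
  then interpret sr_extension ?L \<kappa> ?M s p A \<phi> A' \<mu> N j
    by (intro sr_extension.intro extension.intro E_sat N_sat extension_axioms.intro N(5,6))
  show ?thesis using rk_minimal not_orthogonal_iff_rk_le by blast
qed

end
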